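(* Let $R$ be a commutative Noetherian ring with identity, $\mathfrak{a}$ an ideal of $R$, $M$ a finitely generated $R$-module, $X$ an $R$-module, and $t$ a positive integer. Suppose that $X$ satisfies the following equivalent conditions: (a) $H^{i}_{\mathfrak{a}}(X)=0$ for all $0\le i<t$; (b) $\operatorname{Ext}^{i}_{R}(R/\mathfrak{a},X)=0$ for all $0\le i<t$. Then: (i) $H^{i}_{\mathfrak{a}}(M,X)=0$ for all $0\le i<t$. (ii) $H^{t}_{\mathfrak{a}}(M,X)\cong \operatorname{Hom}_{R}(M,H^{t}_{\mathfrak{a}}(X))$. (iii) $\operatorname{Ext}^{t}_{R}(R/\mathfrak{a},X)\cong \operatorname{Hom}_{R}(R/\mathfrak{a},H^{t}_{\mathfrak{a}}(X))$.
   Context: $H^{i}_{\mathfrak{a}}(X)$ denotes the $i$-th ordinary local cohomology module of $X$ with respect to $\mathfrak{a}$ (the $i$-th right derived functor of the $\mathfrak{a}$-torsion functor $\Gamma_{\mathfrak{a}}$). For $R$-modules $M,X$ and $i\ge 0$, the generalized local cohomology module is $H^{i}_{\mathfrak{a}}(M,X)=\varinjlim_{n}\operatorname{Ext}^{i}_{R}(M/\mathfrak{a}^{n}M,X)$. *)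

theory Defs
  imports "HOL-Algebra.Module" "HOL-Algebra.Ideal_Product" "HOL-Algebra.Ring_Divisibility"
begin

section \<open>Modules over a commutative ring\<close>

text \<open>
  Modules are those of \<^theory>\<open>HOL-Algebra.Module\<close>. The fields \<open>mult\<close> and \<open>one\<close> of the record are
  irrelevant for modules; they are left undefined in the modules constructed below.
\<close>

definition mod_hom ::
  "('a, 'r) ring_scheme \<Rightarrow> ('a, 'm) module \<Rightarrow> ('a, 'n) module \<Rightarrow> ('m \<Rightarrow> 'n) \<Rightarrow> bool"
  where "mod_hom R M N f \<longleftrightarrow>
    f \<in> carrier M \<rightarrow> carrier N \<and>
    (\<forall>x\<in>carrier M. \<forall>y\<in>carrier M. f (x \<oplus>\<^bsub>M\<^esub> y) = f x \<oplus>\<^bsub>N\<^esub> f y) \<and>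
    (\<forall>r\<in>carrier R. \<forall>x\<in>carrier M. f (r \<odot>\<^bsub>M\<^esub> x) = r \<odot>\<^bsub>N\<^esub> f x)"

definition mod_iso :: "('a, 'r) ring_scheme \<Rightarrow> ('a, 'm) module \<Rightarrow> ('a, 'n) module \<Rightarrow> bool"
  where "mod_iso R M N \<longleftrightarrow> (\<exists>f. mod_hom R M N f \<and> bij_betw f (carrier M) (carrier N))"

definition zero_module :: "('a, 'm) module \<Rightarrow> bool"
  where "zero_module M \<longleftrightarrow> carrier M = {\<zero>\<^bsub>M\<^esub>}"

definition mod_span :: "('a, 'r) ring_scheme \<Rightarrow> ('a, 'm) module \<Rightarrow> 'm set \<Rightarrow> 'm set"
  where "mod_span R M A = \<Inter> {N. submodule N R M \<and> A \<subseteq> N}"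

definition fin_gen_module :: "('a, 'r) ring_scheme \<Rightarrow> ('a, 'm) module \<Rightarrow> bool"
  where "fin_gen_module R M \<longleftrightarrow>
    (\<exists>A. finite A \<and> A \<subseteq> carrier M \<and> mod_span R M A = carrier M)"

definition ring_module :: "('a, 'r) ring_scheme \<Rightarrow> ('a, 'a) module"
  where "ring_module R =
    \<lparr>carrier = carrier R, monoid.mult = undefined, one = undefined,
     zero = \<zero>\<^bsub>R\<^esub>, add = add R, smult = monoid.mult R\<rparr>"

definition Hom_module ::
  "('a, 'r) ring_scheme \<Rightarrow> ('a, 'm) module \<Rightarrow> ('a, 'n) module \<Rightarrow> ('a, 'm \<Rightarrow> 'n) module"
  where "Hom_module R M N =
    \<lparr>carrier = {f \<in> extensional (carrier M). mod_hom R M N f},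
     monoid.mult = undefined, one = undefined,
     zero = (\<lambda>x\<in>carrier M. \<zero>\<^bsub>N\<^esub>),
     add = (\<lambda>f g. \<lambda>x\<in>carrier M. f x \<oplus>\<^bsub>N\<^esub> g x),
     smult = (\<lambda>r f. \<lambda>x\<in>carrier M. r \<odot>\<^bsub>N\<^esub> f x)\<rparr>"

definition quot_module :: "('a, 'm) module \<Rightarrow> 'm set \<Rightarrow> ('a, 'm set) module"
  where "quot_module M N =
    \<lparr>carrier = a_rcosets\<^bsub>M\<^esub> N, monoid.mult = undefined, one = undefined,
     zero = N, add = (\<lambda>A B. A <+>\<^bsub>M\<^esub> B),
     smult = (\<lambda>r A. \<Union>x\<in>A. N +>\<^bsub>M\<^esub> (r \<odot>\<^bsub>M\<^esub> x))\<rparr>"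

text \<open>The power \<open>\<aa>\<^sup>n\<close> is taken in the monoid of ideals; in particular \<open>\<aa>\<^sup>0 = R\<close>.\<close>

definition ideal_pow :: "('a, 'r) ring_scheme \<Rightarrow> 'a set \<Rightarrow> nat \<Rightarrow> 'a set"
  where "ideal_pow R \<aa> n = \<aa> [^]\<^bsub>ideals_set R\<^esub> n"

definition ideal_smult :: "('a, 'r) ring_scheme \<Rightarrow> 'a set \<Rightarrow> ('a, 'm) module \<Rightarrow> 'm set"
  where "ideal_smult R J M = mod_span R M {r \<odot>\<^bsub>M\<^esub> x | r x. r \<in> J \<and> x \<in> carrier M}"


section \<open>Cochain complexes and injective resolutions\<close>

definition coboundaries :: "(nat \<Rightarrow> ('a, 'c) module) \<Rightarrow> (nat \<Rightarrow> 'c \<Rightarrow> 'c) \<Rightarrow> nat \<Rightarrow> 'c set"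
  where "coboundaries C d i =
    (case i of 0 \<Rightarrow> {\<zero>\<^bsub>C 0\<^esub>} | Suc j \<Rightarrow> d j ` carrier (C j))"

definition cohomology ::
  "(nat \<Rightarrow> ('a, 'c) module) \<Rightarrow> (nat \<Rightarrow> 'c \<Rightarrow> 'c) \<Rightarrow> nat \<Rightarrow> ('a, 'c set) module"
  where "cohomology C d i =
    quot_module ((C i)\<lparr>carrier := a_kernel (C i) (C (Suc i)) (d i)\<rparr>) (coboundaries C d i)"

text \<open>
  HOL cannot quantify over types inside a definition, so the test modules are those carried by the
  same type \<open>'i\<close> as \<open>E\<close>. As soon as \<open>'i\<close> contains a copy of \<open>R\<close>, Baer's criterion
  shows that this is injectivity with respect to modules carried by arbitrary types.
\<close>

definition injective_module :: "('a, 'r) ring_scheme \<Rightarrow> ('a, 'i) module \<Rightarrow> bool"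
  where "injective_module R E \<longleftrightarrow> module R E \<and>
    (\<forall>(L :: ('a, 'i) module) (N :: ('a, 'i) module) u f.
       module R L \<and> module R N \<and> mod_hom R L N u \<and> inj_on u (carrier L) \<and> mod_hom R L E f
       \<longrightarrow> (\<exists>g. mod_hom R N E g \<and> (\<forall>x\<in>carrier L. g (u x) = f x)))"

definition injective_resolution ::
  "('a, 'r) ring_scheme \<Rightarrow> ('a, 'x) module \<Rightarrow> (nat \<Rightarrow> ('a, 'i) module) \<Rightarrow>
   (nat \<Rightarrow> 'i \<Rightarrow> 'i) \<Rightarrow> ('x \<Rightarrow> 'i) \<Rightarrow> bool"
  where "injective_resolution R X E d \<epsilon> \<longleftrightarrow>
    (\<forall>n. injective_module R (E n)) \<and>
    (\<forall>n. mod_hom R (E n) (E (Suc n)) (d n)) \<and>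
    mod_hom R X (E 0) \<epsilon> \<and> inj_on \<epsilon> (carrier X) \<and>
    \<epsilon> ` carrier X = a_kernel (E 0) (E 1) (d 0) \<and>
    (\<forall>n. d n ` carrier (E n) = a_kernel (E (Suc n)) (E (Suc (Suc n))) (d (Suc n)))"

text \<open>
  A type large enough to carry an injective resolution of every \<open>R\<close>-module \<open>X\<close> with carrier in
  \<open>'x\<close>, where \<open>R\<close> has carrier in \<open>'a\<close>. Its cardinality is \<open>\<kappa> = 2\<^sup>\<lambda>\<close> with
  \<open>\<lambda> = max(|'a|, |'x|, \<aleph>\<^sub>0)\<close>. An \<open>R\<close>-module \<open>Y\<close> with \<open>|Y| \<le> \<kappa>\<close> embeds into a divisible abelian
  group \<open>D\<close> with \<open>|D| \<le> \<kappa>\<close>, hence into the injective module \<open>Hom\<^sub>\<int>(R, D)\<close>, of cardinality at most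
  \<open>\<kappa>\<^sup>\<lambda> = \<kappa>\<close>; the cokernel is again of cardinality at most \<open>\<kappa>\<close>. The type contains a copy of \<open>R\<close>,
  so \<^const>\<open>injective_module\<close> has its usual meaning there.
\<close>

type_synonym ('a, 'x) res = "('a + 'x + nat) list set"

text \<open>
  A fixed choice of an injective resolution of \<open>X\<close>; another choice changes the derived functors
  below only up to isomorphism.
\<close>

definition inj_res ::
  "('a, 'r) ring_scheme \<Rightarrow> ('a, 'x) module \<Rightarrow>
   (nat \<Rightarrow> ('a, ('a, 'x) res) module) \<times> (nat \<Rightarrow> ('a, 'x) res \<Rightarrow> ('a, 'x) res)"
  where "inj_res R X = (SOME p. \<exists>\<epsilon>. injective_resolution R X (fst p) (snd p) \<epsilon>)"


section \<open>Ext and local cohomology\<close>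

definition Hom_complex ::
  "('a, 'r) ring_scheme \<Rightarrow> ('a, 'n) module \<Rightarrow> ('a, 'x) module \<Rightarrow>
   nat \<Rightarrow> ('a, 'n \<Rightarrow> ('a, 'x) res) module"
  where "Hom_complex R N X i = Hom_module R N (fst (inj_res R X) i)"

definition Hom_diff ::
  "('a, 'r) ring_scheme \<Rightarrow> ('a, 'n) module \<Rightarrow> ('a, 'x) module \<Rightarrow>
   nat \<Rightarrow> ('n \<Rightarrow> ('a, 'x) res) \<Rightarrow> ('n \<Rightarrow> ('a, 'x) res)"
  where "Hom_diff R N X i f = compose (carrier N) (snd (inj_res R X) i) f"

definition Ext ::
  "('a, 'r) ring_scheme \<Rightarrow> nat \<Rightarrow> ('a, 'n) module \<Rightarrow> ('a, 'x) module \<Rightarrow>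
   ('a, ('n \<Rightarrow> ('a, 'x) res) set) module"
  where "Ext R i N X = cohomology (Hom_complex R N X) (Hom_diff R N X) i"

text \<open>The map \<open>Ext R i N X \<rightarrow> Ext R i N' X\<close> induced by a homomorphism \<open>u : N' \<rightarrow> N\<close>.\<close>

definition Ext_map ::
  "('a, 'r) ring_scheme \<Rightarrow> nat \<Rightarrow> ('a, 'k) module \<Rightarrow> ('k \<Rightarrow> 'n) \<Rightarrow> ('a, 'x) module \<Rightarrow>
   ('n \<Rightarrow> ('a, 'x) res) set \<Rightarrow> ('k \<Rightarrow> ('a, 'x) res) set"
  where "Ext_map R i N' u X A =
    (\<Union>f\<in>A. coboundaries (Hom_complex R N' X) (Hom_diff R N' X) i
              +>\<^bsub>Hom_complex R N' X i\<^esub> compose (carrier N') f u)"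

definition torsion_module ::
  "('a, 'r) ring_scheme \<Rightarrow> 'a set \<Rightarrow> ('a, 'm) module \<Rightarrow> ('a, 'm) module"
  where "torsion_module R \<aa> M =
    M\<lparr>carrier := {x \<in> carrier M. \<exists>n. \<forall>r\<in>ideal_pow R \<aa> n. r \<odot>\<^bsub>M\<^esub> x = \<zero>\<^bsub>M\<^esub>}\<rparr>"

text \<open>
  On homomorphisms the torsion functor is restriction, so the differentials are those of the
  resolution.
\<close>

definition local_cohomology ::
  "('a, 'r) ring_scheme \<Rightarrow> 'a set \<Rightarrow> nat \<Rightarrow> ('a, 'x) module \<Rightarrow> ('a, ('a, 'x) res set) module"
  where "local_cohomology R \<aa> i X =
    cohomology (\<lambda>n. torsion_module R \<aa> (fst (inj_res R X) n)) (snd (inj_res R X)) i"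

text \<open>
  The direct limit of a system \<open>\<phi> m n : E m \<rightarrow> E n\<close> (\<open>m \<le> n\<close>), as the set of classes of pairs
  \<open>(n, x)\<close> with \<open>x \<in> E n\<close>.
\<close>

definition dirlim_rel ::
  "(nat \<Rightarrow> ('a, 'e) module) \<Rightarrow> (nat \<Rightarrow> nat \<Rightarrow> 'e \<Rightarrow> 'e) \<Rightarrow> ((nat \<times> 'e) \<times> (nat \<times> 'e)) set"
  where "dirlim_rel E \<phi> =
    {((m, x), (n, y)) | m x n y. x \<in> carrier (E m) \<and> y \<in> carrier (E n) \<and>
       (\<exists>k. m \<le> k \<and> n \<le> k \<and> \<phi> m k x = \<phi> n k y)}"

definition dirlim ::
  "(nat \<Rightarrow> ('a, 'e) module) \<Rightarrow> (nat \<Rightarrow> nat \<Rightarrow> 'e \<Rightarrow> 'e) \<Rightarrow> ('a, (nat \<times> 'e) set) module"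
  where "dirlim E \<phi> =
    \<lparr>carrier = (SIGMA n:UNIV. carrier (E n)) // dirlim_rel E \<phi>,
     monoid.mult = undefined, one = undefined,
     zero = dirlim_rel E \<phi> `` {(0, \<zero>\<^bsub>E 0\<^esub>)},
     add = (\<lambda>A B. \<Union>(m, x)\<in>A. \<Union>(n, y)\<in>B.
        dirlim_rel E \<phi> `` {(max m n, \<phi> m (max m n) x \<oplus>\<^bsub>E (max m n)\<^esub> \<phi> n (max m n) y)}),
     smult = (\<lambda>r A. \<Union>(n, x)\<in>A. dirlim_rel E \<phi> `` {(n, r \<odot>\<^bsub>E n\<^esub> x)})\<rparr>"

definition pow_quot ::
  "('a, 'r) ring_scheme \<Rightarrow> 'a set \<Rightarrow> ('a, 'm) module \<Rightarrow> nat \<Rightarrow> ('a, 'm set) module"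
  where "pow_quot R \<aa> M n = quot_module M (ideal_smult R (ideal_pow R \<aa> n) M)"

text \<open>The canonical surjection from \<open>M/\<aa>\<^sup>nM\<close> onto \<open>M/\<aa>\<^sup>mM\<close>, for \<open>m \<le> n\<close>.\<close>

definition pow_quot_proj ::
  "('a, 'r) ring_scheme \<Rightarrow> 'a set \<Rightarrow> ('a, 'm) module \<Rightarrow> nat \<Rightarrow> 'm set \<Rightarrow> 'm set"
  where "pow_quot_proj R \<aa> M m A = (\<Union>x\<in>A. ideal_smult R (ideal_pow R \<aa> m) M +>\<^bsub>M\<^esub> x)"

definition gen_local_cohomology ::
  "('a, 'r) ring_scheme \<Rightarrow> 'a set \<Rightarrow> nat \<Rightarrow> ('a, 'm) module \<Rightarrow> ('a, 'x) module \<Rightarrow>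
   ('a, (nat \<times> ('m set \<Rightarrow> ('a, 'x) res) set) set) module"
  where "gen_local_cohomology R \<aa> i M X =
    dirlim (\<lambda>n. Ext R i (pow_quot R \<aa> M n) X)
           (\<lambda>m n. Ext_map R i (pow_quot R \<aa> M n) (pow_quot_proj R \<aa> M m) X)"

end

theory Submission
  imports Complex_Main "HOL-Algebra.IntRing" Defs
begin

text \<open>
  Let \<open>E\<close> be the injective resolution of \<open>X\<close> and \<open>J = \<Gamma>\<^sub>\<aa>(E)\<close>. Over a Noetherian ring each \<open>J\<^sup>i\<close>
  is again injective, so if \<open>H\<^sup>i(J) = 0\<close> for \<open>i < t\<close>, then \<open>J\<close> splits in degrees up to \<open>t\<close>. Hence
  for every module \<open>N\<close> the cohomology of \<open>Hom(N, J)\<close> vanishes below \<open>t\<close> and is \<open>Hom(N, H\<^sup>t(J))\<close> in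
  degree \<open>t\<close>. If a power of \<open>\<aa>\<close> kills \<open>N\<close>, then \<open>Hom(N, J) = Hom(N, E)\<close>, which computes
  \<open>Ext(N, X)\<close>. The case \<open>N = R/\<aa>\<close> gives (iii) and, since a nonzero \<open>\<aa>\<close>-torsion module has a
  nonzero element killed by \<open>\<aa>\<close>, the equivalence of (a) and (b) by induction on the degree. The
  cases \<open>N = M/\<aa>\<^sup>n M\<close> give (i) and (ii) in the limit, because every homomorphism from the finitely
  generated module \<open>M\<close> to the torsion module \<open>H\<^sup>t(J)\<close> factors through some \<open>M/\<aa>\<^sup>n M\<close>.

  The chosen resolution has its meaning only if one exists on the prescribed carrier type. Every
  module embeds into an injective module of characters with values in \<open>\<complex>\<^sup>*\<close>; a downward
  Loewenheim-Skolem argument cuts the latter down to an injective submodule of the right size.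
\<close>

section \<open>Homomorphisms and submodules\<close>

text \<open>Hom(N, -) is only left exact, so vanishing cohomology of a complex says nothing by
  itself about the cohomology of its Hom complex. The remedy is the splitting: sections of the
  differentials are linear maps, and composing a homomorphism with them solves every lifting problem
  pointwise and linearly at once. No spectral sequence is involved.

  Two obstacles shape the formal text. First, \<open>injective_module\<close> tests only modules on
  its own carrier type, whereas ideals, quotients and character groups live on other types. Baer's
  condition mentions no further type, and it is equivalent to \<open>injective_module\<close> once
  the type contains a copy of R; injectivity is therefore carried as \<open>baer_module\<close>.
  Second, the direct limit is a bare set of classes of pairs. Here the modules Ext in degree
  \<open>t\<close> of the quotients of M all embed, compatibly, into the single module of
  homomorphisms from M to the local cohomology, so the limit is identified with the union of their
  images.\<close>

locale plain_module = module R M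
  for R :: "('a, 'r) ring_scheme" (structure) and M :: "('a, 'm) module" (structure)

lemma plain_moduleI: "module R M \<Longrightarrow> plain_module R M"
  by (simp add: plain_module_def)

lemma mod_homI:
  assumes "\<And>x. x \<in> carrier M \<Longrightarrow> f x \<in> carrier N"
    and "\<And>x y. x \<in> carrier M \<Longrightarrow> y \<in> carrier M \<Longrightarrow> f (x \<oplus>\<^bsub>M\<^esub> y) = f x \<oplus>\<^bsub>N\<^esub> f y"
    and "\<And>r x. r \<in> carrier R \<Longrightarrow> x \<in> carrier M \<Longrightarrow> f (r \<odot>\<^bsub>M\<^esub> x) = r \<odot>\<^bsub>N\<^esub> f x"
  shows "mod_hom R M N f"
  using assms by (auto simp: mod_hom_def)

lemma mod_hom_closed: "mod_hom R M N f \<Longrightarrow> x \<in> carrier M \<Longrightarrow> f x \<in> carrier N"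
  by (auto simp: mod_hom_def)

lemma mod_hom_add:
  "mod_hom R M N f \<Longrightarrow> x \<in> carrier M \<Longrightarrow> y \<in> carrier M \<Longrightarrow> f (x \<oplus>\<^bsub>M\<^esub> y) = f x \<oplus>\<^bsub>N\<^esub> f y"
  by (auto simp: mod_hom_def)

lemma mod_hom_smult:
  "mod_hom R M N f \<Longrightarrow> r \<in> carrier R \<Longrightarrow> x \<in> carrier M \<Longrightarrow> f (r \<odot>\<^bsub>M\<^esub> x) = r \<odot>\<^bsub>N\<^esub> f x"
  by (auto simp: mod_hom_def)

lemma mod_hom_zero:
  assumes "module R M" "module R N" "mod_hom R M N f"
  shows "f \<zero>\<^bsub>M\<^esub> = \<zero>\<^bsub>N\<^esub>"
proof -
  interpret M: plain_module R M by (rule plain_moduleI) fact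
  interpret N: plain_module R N by (rule plain_moduleI) fact
  have "f (\<zero>\<^bsub>R\<^esub> \<odot>\<^bsub>M\<^esub> \<zero>\<^bsub>M\<^esub>) = \<zero>\<^bsub>R\<^esub> \<odot>\<^bsub>N\<^esub> f \<zero>\<^bsub>M\<^esub>"
    using assms(3) by (rule mod_hom_smult) auto
  then show ?thesis
    using assms(3) by (simp add: mod_hom_closed)
qed

lemma mod_hom_minus:
  assumes "module R M" "module R N" "mod_hom R M N f" "x \<in> carrier M" "y \<in> carrier M"
  shows "f (x \<ominus>\<^bsub>M\<^esub> y) = f x \<ominus>\<^bsub>N\<^esub> f y"
proof -
  interpret M: plain_module R M by (rule plain_moduleI) fact
  interpret N: plain_module R N by (rule plain_moduleI) fact
  have "f (\<ominus>\<^bsub>M\<^esub> y) = \<ominus>\<^bsub>N\<^esub> f y"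
    using mod_hom_smult[OF assms(3), of "\<ominus>\<^bsub>R\<^esub> \<one>\<^bsub>R\<^esub>" y] assms
    by (simp add: M.smult_l_minus N.smult_l_minus mod_hom_closed)
  then show ?thesis
    using assms by (simp add: M.minus_eq N.minus_eq mod_hom_add)
qed

lemma mod_hom_comp:
  assumes "mod_hom R L M f" "mod_hom R M N g"
  shows "mod_hom R L N (\<lambda>x. g (f x))"
  using assms by (auto simp: mod_hom_def Pi_iff)

lemma mod_hom_cong:
  assumes "module R M" "mod_hom R M N f" "\<And>x. x \<in> carrier M \<Longrightarrow> f x = g x"
  shows "mod_hom R M N g"
proof -
  interpret M: plain_module R M by (rule plain_moduleI) fact
  show ?thesis
    using assms(2) by (auto simp: mod_hom_def Pi_iff assms(3)[symmetric])
qed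

lemma (in plain_module) mod_hom_restrict_iff [simp]:
  "mod_hom R M N (restrict f (carrier M)) \<longleftrightarrow> mod_hom R M N f"
  using mod_hom_cong[OF module_axioms, of N f "restrict f (carrier M)"]
    mod_hom_cong[OF module_axioms, of N "restrict f (carrier M)" f] by auto

lemma a_kernel_eq: "a_kernel M N f = {x \<in> carrier M. f x = \<zero>\<^bsub>N\<^esub>}"
  by (simp add: a_kernel_def kernel_def)

lemma (in plain_module) submodule_minusI:
  assumes "H \<subseteq> carrier M" "\<zero>\<^bsub>M\<^esub> \<in> H"
    and "\<And>a b. a \<in> H \<Longrightarrow> b \<in> H \<Longrightarrow> a \<oplus>\<^bsub>M\<^esub> b \<in> H"
    and smult: "\<And>a x. a \<in> carrier R \<Longrightarrow> x \<in> H \<Longrightarrow> a \<odot>\<^bsub>M\<^esub> x \<in> H"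
  shows "submodule H R M"
proof (rule submoduleI)
  show "\<ominus>\<^bsub>M\<^esub> a \<in> H" if "a \<in> H" for a
    using smult[of "\<ominus> \<one>" a] that assms(1) by (auto simp: smult_l_minus)
qed (use assms in auto)

lemma (in plain_module) minus_eq_zero_iff:
  "x \<in> carrier M \<Longrightarrow> y \<in> carrier M \<Longrightarrow> x \<ominus>\<^bsub>M\<^esub> y = \<zero>\<^bsub>M\<^esub> \<longleftrightarrow> x = y"
  by (metis M.add.inv_closed M.add.inv_equality M.add.inv_inv M.minus_eq M.r_neg)

lemma (in plain_module) diff_add_cancel_left:
  "x \<in> carrier M \<Longrightarrow> y \<in> carrier M \<Longrightarrow> (x \<ominus>\<^bsub>M\<^esub> y) \<oplus>\<^bsub>M\<^esub> y = x"
  by (simp add: M.minus_eq M.a_assoc M.l_neg)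

lemma (in plain_module) diff_diff_left:
  "x \<in> carrier M \<Longrightarrow> y \<in> carrier M \<Longrightarrow> x \<ominus>\<^bsub>M\<^esub> (x \<ominus>\<^bsub>M\<^esub> y) = y"
  by (simp add: M.minus_eq M.minus_add M.a_assoc[symmetric] M.r_neg)

lemma (in plain_module) diff_add_diff:
  assumes "a \<in> carrier M" "b \<in> carrier M" "c \<in> carrier M" "e \<in> carrier M"
  shows "(a \<oplus>\<^bsub>M\<^esub> b) \<ominus>\<^bsub>M\<^esub> (c \<oplus>\<^bsub>M\<^esub> e) = (a \<ominus>\<^bsub>M\<^esub> c) \<oplus>\<^bsub>M\<^esub> (b \<ominus>\<^bsub>M\<^esub> e)"
  using assms by (simp add: M.minus_eq M.minus_add M.a_ac)

lemma (in plain_module) smult_diff: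
  assumes "r \<in> carrier R" "x \<in> carrier M" "y \<in> carrier M"
  shows "r \<odot>\<^bsub>M\<^esub> (x \<ominus>\<^bsub>M\<^esub> y) = r \<odot>\<^bsub>M\<^esub> x \<ominus>\<^bsub>M\<^esub> r \<odot>\<^bsub>M\<^esub> y"
  using assms by (simp add: M.minus_eq smult_r_distr smult_r_minus)

lemma (in plain_module) submodule_diff:
  assumes "submodule H R M" "x \<in> H" "y \<in> H"
  shows "x \<ominus>\<^bsub>M\<^esub> y \<in> H"
  using submoduleE[OF assms(1)] assms by (auto simp: M.minus_eq)

lemma (in plain_module) submodule_zero: "submodule H R M \<Longrightarrow> \<zero>\<^bsub>M\<^esub> \<in> H"
  using submodule.axioms(1) subgroup.one_closed by fastforce

lemma (in plain_module) submodule_restrict: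
  assumes "submodule H R M" "submodule K R M" "H \<subseteq> K"
  shows "submodule H R (M\<lparr>carrier := K\<rparr>)"
proof -
  interpret K: plain_module R "M\<lparr>carrier := K\<rparr>"
    by (rule plain_moduleI submodule.submodule_is_module[OF assms(2) module_axioms])+
  show ?thesis
    by (rule K.submodule_minusI)
      (use submoduleE[OF assms(1)] submodule_zero[OF assms(1)] assms(3) in auto)
qed

lemma submodule_kernel:
  assumes "module R M" "module R N" "mod_hom R M N f"
  shows "submodule {x \<in> carrier M. f x = \<zero>\<^bsub>N\<^esub>} R M"
proof -
  interpret M: plain_module R M by (rule plain_moduleI) fact
  interpret N: plain_module R N by (rule plain_moduleI) fact
  show ?thesis
    by (rule M.submodule_minusI)
      (use assms mod_hom_zero[OF assms] in \<open>auto simp: mod_hom_add mod_hom_smult\<close>)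
qed

lemma submodule_image:
  assumes "module R M" "module R N" "mod_hom R M N f"
  shows "submodule (f ` carrier M) R N"
proof -
  interpret M: plain_module R M by (rule plain_moduleI) fact
  interpret N: plain_module R N by (rule plain_moduleI) fact
  show ?thesis
  proof (rule N.submodule_minusI)
    show "\<zero>\<^bsub>N\<^esub> \<in> f ` carrier M"
      using mod_hom_zero[OF assms] by (metis M.M.zero_closed imageI)
    show "a \<oplus>\<^bsub>N\<^esub> b \<in> f ` carrier M" if "a \<in> f ` carrier M" "b \<in> f ` carrier M" for a b
      using that mod_hom_add[OF assms(3), symmetric] by auto
    show "a \<odot>\<^bsub>N\<^esub> x \<in> f ` carrier M" if "a \<in> carrier R" "x \<in> f ` carrier M" for a x
      using that mod_hom_smult[OF assms(3), symmetric] by auto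
  qed (use assms mod_hom_closed in fast)
qed

lemma (in plain_module) mod_span_least:
  "submodule N R M \<Longrightarrow> A \<subseteq> N \<Longrightarrow> mod_span R M A \<subseteq> N"
  by (auto simp: mod_span_def)

lemma (in plain_module) mod_span_superset: "A \<subseteq> mod_span R M A"
  by (auto simp: mod_span_def)

lemma (in plain_module) mod_span_submodule:
  assumes "A \<subseteq> carrier M"
  shows "submodule (mod_span R M A) R M"
proof (rule submodule_minusI)
  show "mod_span R M A \<subseteq> carrier M"
    by (rule mod_span_least) (use assms carrier_is_submodule in auto)
qed (auto simp: mod_span_def submodule_zero submoduleE)


section \<open>Quotient modules\<close>

text \<open>A coset is formed with the addition alone. Hence a coset in the module of cocycles is
  the same set as in the ambient cochain module, and classes can be computed there.\<close>

lemma r_coset_carrier_update [simp]: "a_r_coset (M\<lparr>carrier := K\<rparr>) = a_r_coset M"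
  by (intro ext) (simp add: a_r_coset_def')

context plain_module
begin

lemma coset_eq_iff:
  assumes "submodule N R M" "x \<in> carrier M" "y \<in> carrier M"
  shows "N +>\<^bsub>M\<^esub> x = N +>\<^bsub>M\<^esub> y \<longleftrightarrow> x \<ominus>\<^bsub>M\<^esub> y \<in> N"
proof -
  have sub: "subgroup N (add_monoid M)" "N \<subseteq> carrier M"
    using assms(1) submodule.axioms(1) submoduleE(1) by blast+
  have d: "x \<ominus>\<^bsub>M\<^esub> y = x \<oplus>\<^bsub>M\<^esub> (\<ominus>\<^bsub>M\<^esub> y)" "x \<ominus>\<^bsub>M\<^esub> y \<in> carrier M"
    using assms by (simp_all add: M.minus_eq)
  show ?thesis
  proof
    assume "N +>\<^bsub>M\<^esub> x = N +>\<^bsub>M\<^esub> y"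
    then show "x \<ominus>\<^bsub>M\<^esub> y \<in> N"
      using M.a_coset_add_inv2[OF _ assms(2,3) sub(2)] M.a_coset_join1[OF _ d(2) sub(1)] d(1) by metis
  next
    assume "x \<ominus>\<^bsub>M\<^esub> y \<in> N"
    then show "N +>\<^bsub>M\<^esub> x = N +>\<^bsub>M\<^esub> y"
      using M.a_coset_add_inv1[OF _ assms(2,3) sub(2)] M.a_coset_join2[OF d(2) sub(1)] d(1) by metis
  qed
qed

lemma self_in_coset:
  assumes "submodule N R M" "x \<in> carrier M"
  shows "x \<in> N +>\<^bsub>M\<^esub> x"
  using submodule_zero[OF assms(1)] assms(2) by (force simp: a_r_coset_def')

lemma coset_memD:
  assumes "submodule N R M" "x \<in> carrier M" "y \<in> N +>\<^bsub>M\<^esub> x"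
  shows "y \<in> carrier M" "N +>\<^bsub>M\<^esub> y = N +>\<^bsub>M\<^esub> x"
proof -
  show y: "y \<in> carrier M"
    using assms submoduleE(1)[OF assms(1)] by (auto simp: a_r_coset_def')
  obtain n where n: "n \<in> N" "y = n \<oplus>\<^bsub>M\<^esub> x"
    using assms by (auto simp: a_r_coset_def')
  then have "y \<ominus>\<^bsub>M\<^esub> x = n"
    using submoduleE(1)[OF assms(1)] assms(2) by (auto simp: M.minus_eq M.a_assoc M.r_neg)
  then show "N +>\<^bsub>M\<^esub> y = N +>\<^bsub>M\<^esub> x"
    using coset_eq_iff[OF assms(1) y assms(2)] n by simp
qed

lemma quot_carrier: "carrier (quot_module M N) = (\<lambda>x. N +>\<^bsub>M\<^esub> x) ` carrier M"
  by (auto simp: quot_module_def A_RCOSETS_def')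

lemma quot_zero:
  assumes "submodule N R M"
  shows "\<zero>\<^bsub>quot_module M N\<^esub> = N +>\<^bsub>M\<^esub> \<zero>\<^bsub>M\<^esub>"
  using submoduleE(1)[OF assms] by (simp add: quot_module_def)

lemma quot_add:
  assumes "submodule N R M" "x \<in> carrier M" "y \<in> carrier M"
  shows "(N +>\<^bsub>M\<^esub> x) \<oplus>\<^bsub>quot_module M N\<^esub> (N +>\<^bsub>M\<^esub> y) = N +>\<^bsub>M\<^esub> (x \<oplus>\<^bsub>M\<^esub> y)"
proof -
  interpret abelian_subgroup N M
    using M.abelian_group_axioms submodule.axioms(1)[OF assms(1)]
    by (intro abelian_subgroupI3 additive_subgroupI) auto
  show ?thesis
    using a_rcos_sum assms by (simp add: quot_module_def)
qed

text \<open>In this encoding, scalar multiplication on a quotient and the canonical projections are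
  unions over all representatives. If the term does not depend on the representative, the union
  collapses to it, because a coset is nonempty.\<close>

lemma Union_coset_eqI:
  assumes "submodule N R M" "x \<in> carrier M"
    and "\<And>y. y \<in> carrier M \<Longrightarrow> N +>\<^bsub>M\<^esub> y = N +>\<^bsub>M\<^esub> x \<Longrightarrow> F y = c"
  shows "(\<Union>y\<in>N +>\<^bsub>M\<^esub> x. F y) = c"
proof -
  have "F y = c" if "y \<in> N +>\<^bsub>M\<^esub> x" for y
    using assms(3) coset_memD[OF assms(1,2) that] by simp
  then show ?thesis
    using self_in_coset[OF assms(1,2)] by auto
qed

lemma quot_smult:
  assumes "submodule N R M" "r \<in> carrier R" "x \<in> carrier M"
  shows "r \<odot>\<^bsub>quot_module M N\<^esub> (N +>\<^bsub>M\<^esub> x) = N +>\<^bsub>M\<^esub> (r \<odot>\<^bsub>M\<^esub> x)"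
proof -
  have "(\<Union>y\<in>N +>\<^bsub>M\<^esub> x. N +>\<^bsub>M\<^esub> (r \<odot>\<^bsub>M\<^esub> y)) = N +>\<^bsub>M\<^esub> (r \<odot>\<^bsub>M\<^esub> x)"
  proof (rule Union_coset_eqI[OF assms(1,3)])
    fix y assume y: "y \<in> carrier M" "N +>\<^bsub>M\<^esub> y = N +>\<^bsub>M\<^esub> x"
    then have "r \<odot>\<^bsub>M\<^esub> (y \<ominus>\<^bsub>M\<^esub> x) \<in> N"
      using coset_eq_iff assms submoduleE(4)[OF assms(1)] by blast
    then show "N +>\<^bsub>M\<^esub> (r \<odot>\<^bsub>M\<^esub> y) = N +>\<^bsub>M\<^esub> (r \<odot>\<^bsub>M\<^esub> x)"
      using coset_eq_iff[OF assms(1)] assms y by (simp add: smult_diff)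
  qed
  then show ?thesis
    by (simp add: quot_module_def)
qed

lemma quot_module_is_module:
  assumes "submodule N R M"
  shows "module R (quot_module M N)"
proof -
  let ?Q = "quot_module M N"
  note q = quot_zero[OF assms] quot_add[OF assms] quot_smult[OF assms]
  have mem: "N +>\<^bsub>M\<^esub> x \<in> carrier ?Q" if "x \<in> carrier M" for x
    using that by (simp add: quot_carrier)
  have ex: "\<exists>z\<in>carrier M. x = N +>\<^bsub>M\<^esub> z" if "x \<in> carrier ?Q" for x
    using that by (auto simp: quot_carrier)
  have neg: "\<exists>y\<in>carrier ?Q. y \<oplus>\<^bsub>?Q\<^esub> x = \<zero>\<^bsub>?Q\<^esub>" if "x \<in> carrier ?Q" for x
  proof -
    obtain z where "z \<in> carrier M" "x = N +>\<^bsub>M\<^esub> z"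
      using ex[OF \<open>x \<in> carrier ?Q\<close>] by auto
    then show ?thesis
      by (intro bexI[of _ "N +>\<^bsub>M\<^esub> (\<ominus>\<^bsub>M\<^esub> z)"]) (simp_all add: q mem M.l_neg)
  qed
  show ?thesis
  proof (rule moduleI)
    show "cring R" by (rule R.is_cring)
    show "abelian_group ?Q"
    proof (rule abelian_groupI)
      fix x y assume "x \<in> carrier ?Q" "y \<in> carrier ?Q"
      then obtain x' y' where xy: "x' \<in> carrier M" "x = N +>\<^bsub>M\<^esub> x'" "y' \<in> carrier M" "y = N +>\<^bsub>M\<^esub> y'"
        using ex by metis
      then show "x \<oplus>\<^bsub>?Q\<^esub> y \<in> carrier ?Q"
        by (simp add: q mem)
      from xy show "x \<oplus>\<^bsub>?Q\<^esub> y = y \<oplus>\<^bsub>?Q\<^esub> x"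
        by (simp add: q M.a_comm)
      fix z assume "z \<in> carrier ?Q"
      then obtain z' where z: "z' \<in> carrier M" "z = N +>\<^bsub>M\<^esub> z'"
        using ex by metis
      with xy show "x \<oplus>\<^bsub>?Q\<^esub> y \<oplus>\<^bsub>?Q\<^esub> z = x \<oplus>\<^bsub>?Q\<^esub> (y \<oplus>\<^bsub>?Q\<^esub> z)"
        by (simp add: q M.a_assoc)
    next
      fix x assume "x \<in> carrier ?Q"
      then obtain x' where "x' \<in> carrier M" "x = N +>\<^bsub>M\<^esub> x'"
        using ex by metis
      then show "\<zero>\<^bsub>?Q\<^esub> \<oplus>\<^bsub>?Q\<^esub> x = x"
        \<comment> \<open>The zero must stay in the form of a coset of \<open>\<zero>\<close>, since
          \<open>q(2)\<close> applies only to sums of two cosets.\<close>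
        by (simp add: q(2) q(1) del: M.a_coset_add_zero)
    next
      show "\<zero>\<^bsub>?Q\<^esub> \<in> carrier ?Q"
        using mem[OF M.zero_closed] q(1) by metis
    qed (rule neg)
  next
    fix a x assume ax: "a \<in> carrier R" "x \<in> carrier ?Q"
    then obtain x' where x: "x' \<in> carrier M" "x = N +>\<^bsub>M\<^esub> x'"
      using ex by metis
    with ax show "a \<odot>\<^bsub>?Q\<^esub> x \<in> carrier ?Q"
      by (simp add: q mem)
    show "a \<odot>\<^bsub>?Q\<^esub> (x \<oplus>\<^bsub>?Q\<^esub> y) = a \<odot>\<^bsub>?Q\<^esub> x \<oplus>\<^bsub>?Q\<^esub> a \<odot>\<^bsub>?Q\<^esub> y" if "y \<in> carrier ?Q" for y
    proof -
      obtain y' where "y' \<in> carrier M" "y = N +>\<^bsub>M\<^esub> y'"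
        using ex \<open>y \<in> carrier ?Q\<close> by metis
      with ax x show ?thesis
        by (simp add: q smult_r_distr)
    qed
    fix b assume b: "b \<in> carrier R"
    from ax x b show "(a \<oplus> b) \<odot>\<^bsub>?Q\<^esub> x = a \<odot>\<^bsub>?Q\<^esub> x \<oplus>\<^bsub>?Q\<^esub> b \<odot>\<^bsub>?Q\<^esub> x"
      by (simp add: q smult_l_distr)
    from ax x b show "a \<otimes> b \<odot>\<^bsub>?Q\<^esub> x = a \<odot>\<^bsub>?Q\<^esub> (b \<odot>\<^bsub>?Q\<^esub> x)"
      by (simp add: q smult_assoc1)
  next
    fix x assume "x \<in> carrier ?Q"
    then obtain x' where x: "x' \<in> carrier M" "x = N +>\<^bsub>M\<^esub> x'"
      using ex by metis
    then show "\<one> \<odot>\<^bsub>?Q\<^esub> x = x"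
      by (simp add: q)
  qed
qed

lemma quot_proj_hom:
  assumes "submodule N R M"
  shows "mod_hom R M (quot_module M N) (\<lambda>x. N +>\<^bsub>M\<^esub> x)"
  by (rule mod_homI) (auto simp: quot_carrier quot_add[OF assms] quot_smult[OF assms])

end


section \<open>Transport of structure\<close>

text \<open>Moves a module to another carrier type along a map that is injective on the carrier.
  Ideals, cokernels and the small injective modules are brought into a prescribed type in this
  way.\<close>

definition transport_module :: "('m \<Rightarrow> 'n) \<Rightarrow> ('a, 'm) module \<Rightarrow> ('a, 'n) module"
  where "transport_module \<phi> M =
    \<lparr>carrier = \<phi> ` carrier M, monoid.mult = undefined, one = undefined,
     zero = \<phi> \<zero>\<^bsub>M\<^esub>,
     add = (\<lambda>x y. \<phi> (inv_into (carrier M) \<phi> x \<oplus>\<^bsub>M\<^esub> inv_into (carrier M) \<phi> y)),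
     smult = (\<lambda>r x. \<phi> (r \<odot>\<^bsub>M\<^esub> inv_into (carrier M) \<phi> x))\<rparr>"

lemma transport_carrier [simp]: "carrier (transport_module \<phi> M) = \<phi> ` carrier M"
  by (simp add: transport_module_def)

lemma transport_zero: "\<zero>\<^bsub>transport_module \<phi> M\<^esub> = \<phi> \<zero>\<^bsub>M\<^esub>"
  by (simp add: transport_module_def)

lemma transport_add:
  assumes "inj_on \<phi> (carrier M)" "x \<in> carrier M" "y \<in> carrier M"
  shows "\<phi> x \<oplus>\<^bsub>transport_module \<phi> M\<^esub> \<phi> y = \<phi> (x \<oplus>\<^bsub>M\<^esub> y)"
  using assms by (simp add: transport_module_def)

lemma transport_smult:
  assumes "inj_on \<phi> (carrier M)" "x \<in> carrier M"
  shows "r \<odot>\<^bsub>transport_module \<phi> M\<^esub> \<phi> x = \<phi> (r \<odot>\<^bsub>M\<^esub> x)"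
  using assms by (simp add: transport_module_def)

lemma transport_hom:
  "inj_on \<phi> (carrier M) \<Longrightarrow> mod_hom R M (transport_module \<phi> M) \<phi>"
  by (rule mod_homI) (auto simp: transport_add transport_smult)

lemma transport_inv_hom:
  assumes "module R M" "inj_on \<phi> (carrier M)"
  shows "mod_hom R (transport_module \<phi> M) M (inv_into (carrier M) \<phi>)"
proof -
  interpret M: plain_module R M by (rule plain_moduleI) fact
  show ?thesis
    by (rule mod_homI) (auto simp: transport_add transport_smult assms(2))
qed

lemma transport_is_module:
  assumes "module R M" "inj_on \<phi> (carrier M)"
  shows "module R (transport_module \<phi> M)"
proof -
  interpret M: plain_module R M by (rule plain_moduleI) fact
  note tr = transport_add[OF assms(2)] transport_smult[OF assms(2)] transport_zero
  show ?thesis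
  proof (intro moduleI abelian_groupI)
    show "\<exists>y\<in>carrier (transport_module \<phi> M). y \<oplus>\<^bsub>transport_module \<phi> M\<^esub> x = \<zero>\<^bsub>transport_module \<phi> M\<^esub>"
      if x: "x \<in> carrier (transport_module \<phi> M)" for x
    proof -
      obtain z where "z \<in> carrier M" "x = \<phi> z"
        using x by auto
      then show ?thesis
        by (intro bexI[of _ "\<phi> (\<ominus>\<^bsub>M\<^esub> z)"]) (auto simp: tr M.M.l_neg)
    qed
  qed (auto simp: tr M.M.a_ac M.smult_l_distr M.smult_r_distr M.smult_assoc1 M.R.is_cring)
qed

section \<open>Baer modules\<close>

text \<open>Partial homomorphisms are represented by their graphs, so that neither Baer's condition nor
  Zorn's lemma has to mention functions on submodules.\<close>

definition lin_graph ::
  "('a, 'r) ring_scheme \<Rightarrow> ('a, 'm) module \<Rightarrow> ('a, 'n) module \<Rightarrow> ('m \<times> 'n) set \<Rightarrow> bool"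
  where "lin_graph R M E G \<longleftrightarrow>
    G \<subseteq> carrier M \<times> carrier E \<and> (\<zero>\<^bsub>M\<^esub>, \<zero>\<^bsub>E\<^esub>) \<in> G \<and>
    (\<forall>x u y v. (x, u) \<in> G \<longrightarrow> (y, v) \<in> G \<longrightarrow> (x \<oplus>\<^bsub>M\<^esub> y, u \<oplus>\<^bsub>E\<^esub> v) \<in> G) \<and>
    (\<forall>r\<in>carrier R. \<forall>x u. (x, u) \<in> G \<longrightarrow> (r \<odot>\<^bsub>M\<^esub> x, r \<odot>\<^bsub>E\<^esub> u) \<in> G) \<and>
    (\<forall>u. (\<zero>\<^bsub>M\<^esub>, u) \<in> G \<longrightarrow> u = \<zero>\<^bsub>E\<^esub>)"

text \<open>A linear graph over \<open>ring_module R\<close> is a homomorphism on an ideal, its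
  domain; the condition says that it is multiplication by one element. Only the types of R and E
  occur, which frees injectivity from the choice of test types.\<close>

definition baer_module :: "('a, 'r) ring_scheme \<Rightarrow> ('a, 'i) module \<Rightarrow> bool"
  where "baer_module R E \<longleftrightarrow> module R E \<and>
    (\<forall>G. lin_graph R (ring_module R) E G \<longrightarrow> (\<exists>e\<in>carrier E. \<forall>(r, u)\<in>G. u = r \<odot>\<^bsub>E\<^esub> e))"

lemma lin_graphI:
  assumes "\<And>x u. (x, u) \<in> G \<Longrightarrow> x \<in> carrier M" "\<And>x u. (x, u) \<in> G \<Longrightarrow> u \<in> carrier E"
    and "(\<zero>\<^bsub>M\<^esub>, \<zero>\<^bsub>E\<^esub>) \<in> G"
    and "\<And>x u y v. (x, u) \<in> G \<Longrightarrow> (y, v) \<in> G \<Longrightarrow> (x \<oplus>\<^bsub>M\<^esub> y, u \<oplus>\<^bsub>E\<^esub> v) \<in> G"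
    and "\<And>r x u. r \<in> carrier R \<Longrightarrow> (x, u) \<in> G \<Longrightarrow> (r \<odot>\<^bsub>M\<^esub> x, r \<odot>\<^bsub>E\<^esub> u) \<in> G"
    and "\<And>u. (\<zero>\<^bsub>M\<^esub>, u) \<in> G \<Longrightarrow> u = \<zero>\<^bsub>E\<^esub>"
  shows "lin_graph R M E G"
  unfolding lin_graph_def
proof (intro conjI allI ballI impI)
  show "G \<subseteq> carrier M \<times> carrier E"
    using assms(1,2) by auto
qed (rule assms; assumption)+

lemma lin_graphD:
  assumes "lin_graph R M E G"
  shows "\<And>x u. (x, u) \<in> G \<Longrightarrow> x \<in> carrier M" "\<And>x u. (x, u) \<in> G \<Longrightarrow> u \<in> carrier E"
    "(\<zero>\<^bsub>M\<^esub>, \<zero>\<^bsub>E\<^esub>) \<in> G"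
    "\<And>x u y v. (x, u) \<in> G \<Longrightarrow> (y, v) \<in> G \<Longrightarrow> (x \<oplus>\<^bsub>M\<^esub> y, u \<oplus>\<^bsub>E\<^esub> v) \<in> G"
    "\<And>r x u. r \<in> carrier R \<Longrightarrow> (x, u) \<in> G \<Longrightarrow> (r \<odot>\<^bsub>M\<^esub> x, r \<odot>\<^bsub>E\<^esub> u) \<in> G"
    "\<And>u. (\<zero>\<^bsub>M\<^esub>, u) \<in> G \<Longrightarrow> u = \<zero>\<^bsub>E\<^esub>"
proof -
  from assms have G: "G \<subseteq> carrier M \<times> carrier E"
    by (simp add: lin_graph_def)
  show "\<And>x u. (x, u) \<in> G \<Longrightarrow> x \<in> carrier M" "\<And>x u. (x, u) \<in> G \<Longrightarrow> u \<in> carrier E"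
    using G by auto
qed (use assms in \<open>simp_all add: lin_graph_def\<close>)

lemma (in cring) ring_module_is_module: "module R (ring_module R)"
  by (intro moduleI abelian_groupI) (auto simp: ring_module_def a_ac l_distr r_distr m_assoc
      is_cring intro: l_neg)

lemma ring_module_simps [simp]:
  "carrier (ring_module R) = carrier R" "\<zero>\<^bsub>ring_module R\<^esub> = \<zero>\<^bsub>R\<^esub>"
  "x \<oplus>\<^bsub>ring_module R\<^esub> y = x \<oplus>\<^bsub>R\<^esub> y" "r \<odot>\<^bsub>ring_module R\<^esub> x = r \<otimes>\<^bsub>R\<^esub> x"
  by (simp_all add: ring_module_def)

lemma (in plain_module) neg_eq_smult: "x \<in> carrier M \<Longrightarrow> \<ominus>\<^bsub>M\<^esub> x = (\<ominus> \<one>) \<odot>\<^bsub>M\<^esub> x"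
  by (simp add: smult_l_minus)

text \<open>Single-valuedness is built into \<open>lin_graph\<close> only over zero; subtracting two
  pairs with the same first entry reduces the general case to that one.\<close>

lemma lin_graph_unique:
  assumes "module R M" "module R E" "lin_graph R M E G" "(x, u) \<in> G" "(x, v) \<in> G"
  shows "u = v"
proof -
  interpret M: plain_module R M by (rule plain_moduleI) fact
  interpret E: plain_module R E by (rule plain_moduleI) fact
  note G = lin_graphD[OF assms(3)]
  have "(x \<oplus>\<^bsub>M\<^esub> (\<ominus>\<^bsub>R\<^esub> \<one>\<^bsub>R\<^esub>) \<odot>\<^bsub>M\<^esub> x, u \<oplus>\<^bsub>E\<^esub> (\<ominus>\<^bsub>R\<^esub> \<one>\<^bsub>R\<^esub>) \<odot>\<^bsub>E\<^esub> v) \<in> G"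
    using assms(4,5) G(4,5) by simp
  then have "u \<ominus>\<^bsub>E\<^esub> v = \<zero>\<^bsub>E\<^esub>"
    using G(1,2,6) assms(4,5)
    by (simp add: M.neg_eq_smult[symmetric] E.neg_eq_smult[symmetric] M.M.r_neg E.M.minus_eq)
  then show ?thesis
    using E.minus_eq_zero_iff G(2) assms(4,5) by blast
qed

lemma lin_graph_domain:
  assumes "module R M" "lin_graph R M E G"
  shows "submodule (Domain G) R M"
proof -
  interpret M: plain_module R M by (rule plain_moduleI) fact
  note G = lin_graphD[OF assms(2)]
  show ?thesis
  proof (rule M.submodule_minusI)
    show "Domain G \<subseteq> carrier M"
      using G(1) by auto
    show "\<zero>\<^bsub>M\<^esub> \<in> Domain G"
      using G(3) by (rule DomainI)
    fix x assume "x \<in> Domain G"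
    then obtain u where u: "(x, u) \<in> G"
      by auto
    show "r \<odot>\<^bsub>M\<^esub> x \<in> Domain G" if "r \<in> carrier R" for r
      by (rule DomainI[OF G(5)[OF that u]])
    fix y assume "y \<in> Domain G"
    then obtain v where v: "(y, v) \<in> G"
      by auto
    show "x \<oplus>\<^bsub>M\<^esub> y \<in> Domain G"
      by (rule DomainI[OF G(4)[OF u v]])
  qed
qed

lemma lin_graph_hom:
  assumes "module R M" "module R E" "lin_graph R M E G" "carrier M \<subseteq> Domain G"
  obtains g where "mod_hom R M E g" "\<forall>(x, u)\<in>G. g x = u"
proof -
  define g where "g x = (THE u. (x, u) \<in> G)" for x
  note G = lin_graphD[OF assms(3)]
  have g: "g x = u" if "(x, u) \<in> G" for x u
    unfolding g_def using lin_graph_unique[OF assms(1-3)] that by blast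
  have gx: "(x, g x) \<in> G" if "x \<in> carrier M" for x
    using assms(4) that g by blast
  have "mod_hom R M E g"
  proof (rule mod_homI)
    fix x assume x: "x \<in> carrier M"
    show "g x \<in> carrier E"
      by (rule G(2)[OF gx[OF x]])
    show "g (x \<oplus>\<^bsub>M\<^esub> y) = g x \<oplus>\<^bsub>E\<^esub> g y" if "y \<in> carrier M" for y
      by (rule g[OF G(4)[OF gx[OF x] gx[OF that]]])
    show "g (r \<odot>\<^bsub>M\<^esub> x) = r \<odot>\<^bsub>E\<^esub> g x" if "r \<in> carrier R" for r
      by (rule g[OF G(5)[OF that gx[OF x]]])
  qed
  then show ?thesis
    using that g by auto
qed

text \<open>Zorn's lemma on linear graphs; Baer's condition says that a graph whose domain omits \<open>x\<close>
  can be enlarged to one whose domain contains \<open>x\<close>.\<close>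

theorem baer_extend:
  assumes "module R M" "baer_module R E" "lin_graph R M E G"
  obtains g where "mod_hom R M E g" "\<forall>(x, u)\<in>G. g x = u"
proof -
  interpret M: plain_module R M by (rule plain_moduleI) fact
  have modE: "module R E"
    using assms(2) by (simp add: baer_module_def)
  interpret E: plain_module R E by (rule plain_moduleI) fact
  define \<G> where "\<G> = {H. lin_graph R M E H \<and> G \<subseteq> H}"
  have "\<exists>H\<in>\<G>. \<forall>K\<in>\<G>. H \<subseteq> K \<longrightarrow> K = H"
  proof (rule subset_Zorn_nonempty)
    show "\<G> \<noteq> {}"
      using assms(3) by (auto simp: \<G>_def)
    fix C assume "C \<noteq> {}" "subset.chain \<G> C"
    then have C: "C \<subseteq> \<G>" "\<And>H K. H \<in> C \<Longrightarrow> K \<in> C \<Longrightarrow> H \<subseteq> K \<or> K \<subseteq> H"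
      by (auto simp: subset.chain_def)
    then have lin: "lin_graph R M E H" "G \<subseteq> H" if "H \<in> C" for H
      using that by (auto simp: \<G>_def)
    have "lin_graph R M E (\<Union>C)"
    proof (rule lin_graphI)
      show "(\<zero>\<^bsub>M\<^esub>, \<zero>\<^bsub>E\<^esub>) \<in> \<Union>C"
        using \<open>C \<noteq> {}\<close> lin_graphD(3)[OF lin(1)] by blast
      fix x u assume xu: "(x, u) \<in> \<Union>C"
      then show "x \<in> carrier M" "u \<in> carrier E"
        using lin_graphD(1,2)[OF lin(1)] by blast+
      show "(r \<odot>\<^bsub>M\<^esub> x, r \<odot>\<^bsub>E\<^esub> u) \<in> \<Union>C" if "r \<in> carrier R" for r
        using lin_graphD(5)[OF lin(1)] xu that by blast
      fix y v assume yv: "(y, v) \<in> \<Union>C"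
      obtain H K where "H \<in> C" "K \<in> C" "(x, u) \<in> H" "(y, v) \<in> K"
        using xu yv by blast
      then obtain L where "L \<in> C" "(x, u) \<in> L" "(y, v) \<in> L"
        using C(2) by blast
      then show "(x \<oplus>\<^bsub>M\<^esub> y, u \<oplus>\<^bsub>E\<^esub> v) \<in> \<Union>C"
        using lin_graphD(4)[OF lin(1)] by blast
    next
      show "u = \<zero>\<^bsub>E\<^esub>" if "(\<zero>\<^bsub>M\<^esub>, u) \<in> \<Union>C" for u
        using lin_graphD(6)[OF lin(1)] that by blast
    qed
    then show "\<Union>C \<in> \<G>"
      using lin(2) \<open>C \<noteq> {}\<close> by (auto simp: \<G>_def)
  qed
  then obtain H where H: "lin_graph R M E H" "G \<subseteq> H"
    and max: "\<And>K. lin_graph R M E K \<Longrightarrow> H \<subseteq> K \<Longrightarrow> K = H"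
    unfolding \<G>_def by (smt (verit) mem_Collect_eq subset_trans)
  note HD = lin_graphD[OF H(1)]
  have "carrier M \<subseteq> Domain H"
  proof
    fix x assume x: "x \<in> carrier M"
    \<comment> \<open>The scalars that move \<open>x\<close> into the domain of H form an ideal, and
      H prescribes a value at each such multiple. The element \<open>e\<close> from Baer's condition
      is compatible with all of these values, so it can serve as the value at
      \<open>x\<close>.\<close>
    define B where "B = {(r, u). r \<in> carrier R \<and> (r \<odot>\<^bsub>M\<^esub> x, u) \<in> H}"
    have "lin_graph R (ring_module R) E B"
      by (rule lin_graphI)
        (auto simp: B_def x M.smult_l_distr M.smult_assoc1 HD(3) intro: HD(2,4,5,6))
    then obtain e where e: "e \<in> carrier E" "\<forall>(r, u)\<in>B. u = r \<odot>\<^bsub>E\<^esub> e"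
      using assms(2) unfolding baer_module_def by meson
    then have eB: "\<And>r u. (r, u) \<in> B \<Longrightarrow> u = r \<odot>\<^bsub>E\<^esub> e"
      by auto
    define K where "K = {(y \<oplus>\<^bsub>M\<^esub> r \<odot>\<^bsub>M\<^esub> x, u \<oplus>\<^bsub>E\<^esub> r \<odot>\<^bsub>E\<^esub> e) | y u r. (y, u) \<in> H \<and> r \<in> carrier R}"
    have KI: "(y \<oplus>\<^bsub>M\<^esub> r \<odot>\<^bsub>M\<^esub> x, u \<oplus>\<^bsub>E\<^esub> r \<odot>\<^bsub>E\<^esub> e) \<in> K" if "(y, u) \<in> H" "r \<in> carrier R" for y u r
      using that by (auto simp: K_def)
    have KE: thesis if "(z, w) \<in> K"
      "\<And>y u r. (y, u) \<in> H \<Longrightarrow> r \<in> carrier R \<Longrightarrow> z = y \<oplus>\<^bsub>M\<^esub> r \<odot>\<^bsub>M\<^esub> x \<Longrightarrow> w = u \<oplus>\<^bsub>E\<^esub> r \<odot>\<^bsub>E\<^esub> e \<Longrightarrow> thesis"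
      for z w thesis
      using that by (auto simp: K_def)
    have "lin_graph R M E K"
    proof (rule lin_graphI)
      show "(\<zero>\<^bsub>M\<^esub>, \<zero>\<^bsub>E\<^esub>) \<in> K"
        using KI[OF HD(3) M.R.zero_closed] x e(1) by simp
      fix z w assume "(z, w) \<in> K"
      then obtain y u r where yur: "(y, u) \<in> H" "r \<in> carrier R" "z = y \<oplus>\<^bsub>M\<^esub> r \<odot>\<^bsub>M\<^esub> x" "w = u \<oplus>\<^bsub>E\<^esub> r \<odot>\<^bsub>E\<^esub> e"
        by (rule KE)
      note c = HD(1)[OF yur(1)] HD(2)[OF yur(1)]
      show "z \<in> carrier M" "w \<in> carrier E"
        using yur c x e(1) by simp_all
      show "(s \<odot>\<^bsub>M\<^esub> z, s \<odot>\<^bsub>E\<^esub> w) \<in> K" if s: "s \<in> carrier R" for s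
        using KI[OF HD(5)[OF s yur(1)], of "s \<otimes>\<^bsub>R\<^esub> r"] yur c x e(1) s
        by (simp add: M.smult_r_distr E.smult_r_distr M.smult_assoc1 E.smult_assoc1)
      fix z' w' assume "(z', w') \<in> K"
      then obtain y' u' r' where yur': "(y', u') \<in> H" "r' \<in> carrier R"
        "z' = y' \<oplus>\<^bsub>M\<^esub> r' \<odot>\<^bsub>M\<^esub> x" "w' = u' \<oplus>\<^bsub>E\<^esub> r' \<odot>\<^bsub>E\<^esub> e"
        by (rule KE)
      note c' = HD(1)[OF yur'(1)] HD(2)[OF yur'(1)]
      show "(z \<oplus>\<^bsub>M\<^esub> z', w \<oplus>\<^bsub>E\<^esub> w') \<in> K"
        using KI[OF HD(4)[OF yur(1) yur'(1)], of "r \<oplus>\<^bsub>R\<^esub> r'"] yur yur' c c' x e(1)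
        by (simp add: M.smult_l_distr E.smult_l_distr M.M.a_ac E.M.a_ac)
    next
      fix w assume "(\<zero>\<^bsub>M\<^esub>, w) \<in> K"
      then obtain y u r where yur: "(y, u) \<in> H" "r \<in> carrier R" "\<zero>\<^bsub>M\<^esub> = y \<oplus>\<^bsub>M\<^esub> r \<odot>\<^bsub>M\<^esub> x" "w = u \<oplus>\<^bsub>E\<^esub> r \<odot>\<^bsub>E\<^esub> e"
        by (rule KE)
      note c = HD(1)[OF yur(1)] HD(2)[OF yur(1)]
      \<comment> \<open>A relation between \<open>x\<close> and the old domain is exactly what B
        records, so the choice of \<open>e\<close> makes the new value vanish over zero.\<close>
      have "r \<odot>\<^bsub>M\<^esub> x = \<ominus>\<^bsub>M\<^esub> y"
        using yur(2,3) c x by (metis M.M.a_comm M.M.minus_equality M.smult_closed)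
      moreover have "(\<ominus>\<^bsub>M\<^esub> y, \<ominus>\<^bsub>E\<^esub> u) \<in> H"
        using HD(5)[OF _ yur(1), of "\<ominus>\<^bsub>R\<^esub> \<one>\<^bsub>R\<^esub>"] c
        by (simp add: M.neg_eq_smult[symmetric] E.neg_eq_smult[symmetric])
      ultimately have "\<ominus>\<^bsub>E\<^esub> u = r \<odot>\<^bsub>E\<^esub> e"
        using eB yur(2) by (simp add: B_def)
      then show "w = \<zero>\<^bsub>E\<^esub>"
        using yur(4) c by (metis E.M.r_neg)
    qed
    moreover have "H \<subseteq> K"
    proof (clarify)
      fix y u assume "(y, u) \<in> H"
      then show "(y, u) \<in> K"
        using KI[OF _ M.R.zero_closed, of y u] HD(1,2) x e(1) by simp
    qed
    ultimately have "K = H"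
      by (rule max)
    moreover have "(x, e) \<in> K"
      using KI[OF HD(3) M.R.one_closed] x e(1) by simp
    ultimately show "x \<in> Domain H"
      by blast
  qed
  then obtain g where "mod_hom R M E g" "\<forall>(x, u)\<in>H. g x = u"
    using lin_graph_hom[OF assms(1) modE H(1)] by blast
  then show ?thesis
    using H(2) by (intro that[of g]) auto
qed

lemma baer_imp_injective:
  fixes E :: "('a, 'i) module"
  assumes "baer_module R E"
  shows "injective_module R E"
  unfolding injective_module_def
proof (intro conjI allI impI)
  show modE: "module R E"
    using assms by (simp add: baer_module_def)
  fix L N :: "('a, 'i) module" and u f
  assume "module R L \<and> module R N \<and> mod_hom R L N u \<and> inj_on u (carrier L) \<and> mod_hom R L E f"
  then have L: "module R L" and N: "module R N" and u: "mod_hom R L N u" "inj_on u (carrier L)"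
    and f: "mod_hom R L E f"
    by auto
  interpret L: plain_module R L by (rule plain_moduleI) fact
  \<comment> \<open>The graph of \<open>f\<close> after the inverse of \<open>u\<close>, defined on
    the image of \<open>u\<close>; it is single-valued because \<open>u\<close> is
    injective.\<close>
  define G where "G = (\<lambda>x. (u x, f x)) ` carrier L"
  have "lin_graph R N E G"
  proof (rule lin_graphI)
    show "(\<zero>\<^bsub>N\<^esub>, \<zero>\<^bsub>E\<^esub>) \<in> G"
      using mod_hom_zero[OF L N u(1)] mod_hom_zero[OF L modE f] L.M.zero_closed
      unfolding G_def by (metis (no_types, lifting) imageI)
    show "v = \<zero>\<^bsub>E\<^esub>" if v: "(\<zero>\<^bsub>N\<^esub>, v) \<in> G" for v
    proof -
      obtain x where x: "x \<in> carrier L" "\<zero>\<^bsub>N\<^esub> = u x" "v = f x"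
        using v by (auto simp: G_def)
      then have "x = \<zero>\<^bsub>L\<^esub>"
        using u(2) mod_hom_zero[OF L N u(1)] by (metis L.M.zero_closed inj_onD)
      then show ?thesis
        using x mod_hom_zero[OF L modE f] by simp
    qed
  qed (auto simp: G_def mod_hom_closed[OF u(1)] mod_hom_closed[OF f] mod_hom_add[OF u(1), symmetric]
      mod_hom_add[OF f, symmetric] mod_hom_smult[OF u(1), symmetric] mod_hom_smult[OF f, symmetric])
  then obtain g where "mod_hom R N E g" "\<forall>(x, v)\<in>G. g x = v"
    by (rule baer_extend[OF N assms])
  then show "\<exists>g. mod_hom R N E g \<and> (\<forall>x\<in>carrier L. g (u x) = f x)"
    by (auto simp: G_def)
qed

text \<open>The converse needs a copy of \<open>R\<close> in the carrier type of \<open>E\<close>, so that ideals of \<open>R\<close> occur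
  among the test modules of \<^const>\<open>injective_module\<close>.\<close>

lemma injective_imp_baer:
  fixes E :: "('a, 'i) module" and \<iota> :: "'a \<Rightarrow> 'i"
  assumes "cring R" "injective_module R E" "inj \<iota>"
  shows "baer_module R E"
  unfolding baer_module_def
proof (intro conjI allI impI)
  interpret R: cring R by fact
  show modE: "module R E"
    using assms by (simp add: injective_module_def)
  interpret E: plain_module R E by (rule plain_moduleI) fact
  fix G assume G: "lin_graph R (ring_module R) E G"
  note GD = lin_graphD[OF G, unfolded ring_module_simps]
  let ?A = "ring_module R"
  interpret A: plain_module R ?A by (rule plain_moduleI) (rule R.ring_module_is_module)
  have inj: "inj_on \<iota> S" for S
    using assms(3) inj_on_subset by blast
  have uniq: "u = v" if "(x, u) \<in> G" "(x, v) \<in> G" for x u v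
    using lin_graph_unique[OF A.module_axioms modE G] that .
  have sub: "submodule (Domain G) R ?A"
    by (rule lin_graph_domain[OF A.module_axioms G])
  have L0: "module R (?A\<lparr>carrier := Domain G\<rparr>)"
    by (rule submodule.submodule_is_module[OF sub A.module_axioms])
  \<comment> \<open>\<open>L\<close> and \<open>N\<close> are copies of the ideal
    \<open>Domain G\<close> and of R inside the carrier type of E, so that injectivity applies to
    the inclusion of one in the other.\<close>
  define L where "L = transport_module \<iota> (?A\<lparr>carrier := Domain G\<rparr>)"
  define N where "N = transport_module \<iota> ?A"
  have L: "module R L" and N: "module R N"
    unfolding L_def N_def by (rule transport_is_module inj L0 A.module_axioms)+
  have DG: "Domain G \<subseteq> carrier R"
    using GD(1) by blast
  have incl: "mod_hom R L N (\<lambda>x. x)"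
  proof (rule mod_homI)
    fix x assume "x \<in> carrier L"
    then obtain x' where x: "x' \<in> Domain G" "x = \<iota> x'" "x' \<in> carrier R"
      using DG by (auto simp: L_def)
    then show "x \<in> carrier N"
      using DG by (auto simp: N_def)
    show "r \<odot>\<^bsub>L\<^esub> x = r \<odot>\<^bsub>N\<^esub> x" for r
      using x DG transport_smult[OF inj, of x' "?A\<lparr>carrier := Domain G\<rparr>" r]
        transport_smult[OF inj, of x' ?A r]
      by (auto simp: L_def N_def)
    fix y assume "y \<in> carrier L"
    then obtain y' where y: "y' \<in> Domain G" "y = \<iota> y'" "y' \<in> carrier R"
      using DG by (auto simp: L_def)
    then show "x \<oplus>\<^bsub>L\<^esub> y = x \<oplus>\<^bsub>N\<^esub> y"
      using x DG transport_add[OF inj, of x' "?A\<lparr>carrier := Domain G\<rparr>" y']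
        transport_add[OF inj, of x' ?A y']
      by (auto simp: L_def N_def)
  qed
  define f where "f x = (THE u. (x, u) \<in> G)" for x
  have f: "f x = u" if "(x, u) \<in> G" for x u
    unfolding f_def using that uniq by blast
  have fD: "(x, f x) \<in> G" if "x \<in> Domain G" for x
    using that f by auto
  have "mod_hom R (?A\<lparr>carrier := Domain G\<rparr>) E f"
    by (rule mod_homI) (auto intro!: f GD(2,4,5) fD[OF DomainI])
  from mod_hom_comp[OF transport_inv_hom[OF L0 inj] this]
  have "mod_hom R L E (\<lambda>x. f (inv_into (Domain G) \<iota> x))"
    by (simp add: L_def)
  then have "\<exists>g. mod_hom R N E g \<and> (\<forall>x\<in>carrier L. g x = f (inv_into (Domain G) \<iota> x))"
    using assms(2)[unfolded injective_module_def, THEN conjunct2, rule_format,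
        of L N "\<lambda>x. x" "\<lambda>x. f (inv_into (Domain G) \<iota> x)"] L N incl
    by simp
  then obtain g where g: "mod_hom R N E g" "\<And>x. x \<in> carrier L \<Longrightarrow> g x = f (inv_into (Domain G) \<iota> x)"
    by blast
  have h: "mod_hom R ?A E (\<lambda>x. g (\<iota> x))"
    using mod_hom_comp[OF transport_hom[OF inj] g(1)[unfolded N_def]] .
  \<comment> \<open>A homomorphism on all of R is determined by its value at one, and that value is
    the element sought.\<close>
  have "u = r \<odot>\<^bsub>E\<^esub> g (\<iota> \<one>\<^bsub>R\<^esub>)" if "(r, u) \<in> G" for r u
  proof -
    have "g (\<iota> r) = u"
      using g(2)[of "\<iota> r"] f[OF that] DomainI[OF that] by (simp add: L_def inv_into_f_f[OF inj])
    moreover have "g (\<iota> r) = r \<odot>\<^bsub>E\<^esub> g (\<iota> \<one>\<^bsub>R\<^esub>)"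
      using mod_hom_smult[OF h, of r "\<one>\<^bsub>R\<^esub>"] GD(1)[OF that] by simp
    ultimately show ?thesis
      by simp
  qed
  moreover have "g (\<iota> \<one>\<^bsub>R\<^esub>) \<in> carrier E"
    using mod_hom_closed[OF h, of "\<one>\<^bsub>R\<^esub>"] by simp
  ultimately show "\<exists>e\<in>carrier E. \<forall>(r, u)\<in>G. u = r \<odot>\<^bsub>E\<^esub> e"
    by blast
qed

section \<open>Powers of ideals\<close>

lemma ideal_pow_0 [simp]: "ideal_pow R I 0 = carrier R"
  by (simp add: ideal_pow_def ideals_set_def)

lemma ideal_pow_Suc: "ideal_pow R I (Suc n) = ideal_prod R (ideal_pow R I n) I"
  by (simp add: ideal_pow_def ideals_set_def)

lemma ideal_prod_least:
  assumes "\<And>i j. i \<in> I \<Longrightarrow> j \<in> J \<Longrightarrow> i \<otimes>\<^bsub>R\<^esub> j \<in> K" "\<And>x y. x \<in> K \<Longrightarrow> y \<in> K \<Longrightarrow> x \<oplus>\<^bsub>R\<^esub> y \<in> K"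
  shows "ideal_prod R I J \<subseteq> K"
proof
  show "s \<in> K" if "s \<in> ideal_prod R I J" for s
    using that by (induct rule: ideal_prod.induct) (auto intro: assms)
qed

lemma (in ring) ideal_add_closed: "ideal I R \<Longrightarrow> x \<in> I \<Longrightarrow> y \<in> I \<Longrightarrow> x \<oplus> y \<in> I"
  by (meson additive_subgroup.a_closed ideal.axioms(1))

lemma (in ring) ideal_zero_closed: "ideal I R \<Longrightarrow> \<zero> \<in> I"
  by (meson additive_subgroup.zero_closed ideal.axioms(1))

lemma (in ring) ideal_neg_closed: "ideal I R \<Longrightarrow> x \<in> I \<Longrightarrow> \<ominus> x \<in> I"
  by (meson additive_subgroup.a_inv_closed ideal.axioms(1))

lemma (in cring) ideal_pow_ideal: "ideal I R \<Longrightarrow> ideal (ideal_pow R I n) R"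
  by (induct n) (simp_all add: ideal_pow_Suc oneideal ideal_prod_is_ideal)

lemma (in cring) ideal_pow_carrier: "ideal I R \<Longrightarrow> x \<in> ideal_pow R I n \<Longrightarrow> x \<in> carrier R"
  using ideal.Icarr[OF ideal_pow_ideal] .

lemma (in cring) ideal_pow_antimono:
  assumes "ideal I R" "m \<le> n"
  shows "ideal_pow R I n \<subseteq> ideal_pow R I m"
  using assms(2)
proof (induct rule: dec_induct)
  case (step k)
  have "ideal_pow R I (Suc k) \<subseteq> ideal_pow R I k"
    using ideal_prod_inter[OF ideal_pow_ideal[OF assms(1)] assms(1), of k]
    by (simp add: ideal_pow_Suc)
  then show ?case
    using step by simp
qed simp

lemma ideal_pow_mono:
  assumes "I \<subseteq> J"
  shows "ideal_pow R I n \<subseteq> ideal_pow R J n"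
proof (induct n)
  case (Suc n)
  show ?case
    unfolding ideal_pow_Suc
    by (rule ideal_prod_least) (use assms Suc in \<open>auto intro: ideal_prod.intros\<close>)
qed simp

lemma (in cring) ideal_pow_pow:
  assumes "ideal I R"
  shows "ideal_pow R (ideal_pow R I m) n = ideal_pow R I (m * n)"
proof -
  interpret S: comm_monoid "ideals_set R"
    by (rule ideals_set_is_comm_monoid)
  show ?thesis
    unfolding ideal_pow_def
    by (rule S.nat_pow_pow) (use assms in \<open>simp add: ideals_set_def\<close>)
qed

lemma (in cring) ideal_pow_1: "ideal I R \<Longrightarrow> ideal_pow R I 1 = I"
  using ideal_prod_commute[OF oneideal, of I] ideal_prod_one by (simp add: ideal_pow_Suc)

lemma set_add_memI: "x \<in> I \<Longrightarrow> y \<in> J \<Longrightarrow> x \<oplus>\<^bsub>R\<^esub> y \<in> I <+>\<^bsub>R\<^esub> J"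
  by (auto simp: set_add_def')

lemma set_add_memE:
  assumes "z \<in> I <+>\<^bsub>R\<^esub> J"
  obtains x y where "x \<in> I" "y \<in> J" "z = x \<oplus>\<^bsub>R\<^esub> y"
  using assms by (auto simp: set_add_def')

text \<open>On expanding a product of \<open>n\<close> sums, every term with a factor from I lies in
  I; only the product of the n factors from J remains.\<close>

lemma (in cring) ideal_pow_add_subset:
  assumes I: "ideal I R" and J: "ideal J R"
  shows "ideal_pow R (I <+>\<^bsub>R\<^esub> J) n \<subseteq> I <+>\<^bsub>R\<^esub> ideal_pow R J n"
proof (induct n)
  case 0
  have "x \<in> I <+>\<^bsub>R\<^esub> carrier R" if "x \<in> carrier R" for x
    using set_add_memI[OF ideal_zero_closed[OF I] that, of R] that by simp
  then show ?case
    by auto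
next
  case (Suc n)
  have Jn: "ideal (ideal_pow R J n) R" "ideal (ideal_pow R J (Suc n)) R"
    using ideal_pow_ideal[OF J] by blast+
  have K: "ideal (I <+>\<^bsub>R\<^esub> ideal_pow R J (Suc n)) R"
    by (rule add_ideals[OF I Jn(2)])
  show ?case
    unfolding ideal_pow_Suc[of R "I <+>\<^bsub>R\<^esub> J"]
  proof (rule ideal_prod_least)
    fix s t assume "s \<in> ideal_pow R (I <+>\<^bsub>R\<^esub> J) n" "t \<in> I <+>\<^bsub>R\<^esub> J"
    then obtain x y x' y' where s: "x \<in> I" "y \<in> ideal_pow R J n" "s = x \<oplus> y"
      and t: "x' \<in> I" "y' \<in> J" "t = x' \<oplus> y'"
      using Suc by (auto elim!: set_add_memE)
    have c: "x \<in> carrier R" "y \<in> carrier R" "x' \<in> carrier R" "y' \<in> carrier R"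
      using s t ideal.Icarr[OF I] ideal.Icarr[OF J] ideal.Icarr[OF Jn(1)] by auto
    have "s \<otimes> t = (x \<otimes> t \<oplus> y \<otimes> x') \<oplus> y \<otimes> y'"
      using c s t by (simp add: l_distr r_distr a_ac)
    moreover have "x \<otimes> t \<oplus> y \<otimes> x' \<in> I"
      using s t c by (intro ideal_add_closed[OF I] ideal.I_r_closed[OF I] ideal.I_l_closed[OF I]) auto
    moreover have "y \<otimes> y' \<in> ideal_pow R J (Suc n)"
      unfolding ideal_pow_Suc by (rule ideal_prod.prod[OF s(2) t(2)])
    ultimately show "s \<otimes> t \<in> I <+>\<^bsub>R\<^esub> ideal_pow R J (Suc n)"
      by (simp add: set_add_memI)
  qed (rule ideal_add_closed[OF K])
qed

lemma (in cring) PIdl_pow_subset: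
  assumes "r \<in> carrier R"
  shows "ideal_pow R (PIdl r) n \<subseteq> PIdl (r [^] n)"
proof (induct n)
  case 0
  have "x \<in> PIdl \<one>" if "x \<in> carrier R" for x
    using that unfolding cgenideal_def by (auto intro!: exI[of _ x])
  then show ?case
    by auto
next
  case (Suc n)
  show ?case
    unfolding ideal_pow_Suc
  proof (rule ideal_prod_least)
    fix s t assume "s \<in> ideal_pow R (PIdl r) n" "t \<in> PIdl r"
    then obtain a b where "a \<in> carrier R" "s = a \<otimes> r [^] n" "b \<in> carrier R" "t = b \<otimes> r"
      using Suc by (auto simp: cgenideal_def)
    moreover from this have "s \<otimes> t = (a \<otimes> b) \<otimes> r [^] Suc n"
      using assms by (simp add: m_ac)
    ultimately show "s \<otimes> t \<in> PIdl (r [^] Suc n)"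
      unfolding cgenideal_def by blast
  qed (rule ideal_add_closed[OF cgenideal_ideal], use assms in auto)
qed

lemma (in cring) set_add_least:
  assumes "ideal K R" "I \<subseteq> K" "J \<subseteq> K"
  shows "I <+>\<^bsub>R\<^esub> J \<subseteq> K"
  using ideal_add_closed[OF assms(1)] assms(2,3) by (auto elim!: set_add_memE)

text \<open>The preceding inclusion is used twice: the m-th power of (r) + J lies in (r) + K, and
  the n-th power of that lies in K + (r^n), which is K. This is the enlargement of J by one
  element.\<close>

lemma (in cring) ideal_pow_PIdl_add_subset:
  assumes J: "ideal J R" and K: "ideal K R" and r: "r \<in> carrier R" "r [^] n \<in> K"
    and m: "ideal_pow R J m \<subseteq> K"
  shows "ideal_pow R (PIdl r <+>\<^bsub>R\<^esub> J) (m * n) \<subseteq> K"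
proof -
  have P: "ideal (PIdl r) R"
    by (rule cgenideal_ideal[OF r(1)])
  have "ideal_pow R (PIdl r <+>\<^bsub>R\<^esub> J) m \<subseteq> PIdl r <+>\<^bsub>R\<^esub> ideal_pow R J m"
    by (rule ideal_pow_add_subset[OF P J])
  also have "\<dots> \<subseteq> PIdl r <+>\<^bsub>R\<^esub> K"
    using m by (auto simp: set_add_def')
  also have "\<dots> = K <+>\<^bsub>R\<^esub> PIdl r"
    by (rule set_add_comm) (use ideal.Icarr[OF P] ideal.Icarr[OF K] in auto)
  finally have "ideal_pow R (ideal_pow R (PIdl r <+>\<^bsub>R\<^esub> J) m) n \<subseteq> ideal_pow R (K <+>\<^bsub>R\<^esub> PIdl r) n"
    by (rule ideal_pow_mono)
  also have "\<dots> \<subseteq> K <+>\<^bsub>R\<^esub> ideal_pow R (PIdl r) n"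
    by (rule ideal_pow_add_subset[OF K P])
  also have "\<dots> \<subseteq> K"
    using PIdl_pow_subset[OF r(1), of n] cgenideal_minimal[OF K r(2)]
    by (intro set_add_least[OF K]) auto
  finally show ?thesis
    by (simp add: ideal_pow_pow[OF add_ideals[OF P J]])
qed

text \<open>In a Noetherian ring the union of a nonempty chain of ideals is a member of the chain,
  so Zorn's lemma applies to any set of ideals whatever its closure properties.\<close>

lemma (in noetherian_ring) exists_maximal_ideal_in:
  assumes "S \<noteq> {}" "S \<subseteq> {I. ideal I R}"
  obtains M where "M \<in> S" "\<And>I. I \<in> S \<Longrightarrow> M \<subseteq> I \<Longrightarrow> I = M"
proof -
  have "\<exists>M\<in>S. \<forall>I\<in>S. M \<subseteq> I \<longrightarrow> I = M"
  proof (rule subset_Zorn_nonempty[OF assms(1)])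
    fix C assume C: "C \<noteq> {}" "subset.chain S C"
    then have "subset.chain {I. ideal I R} C"
      using assms(2) by (auto simp: subset.chain_def)
    then show "\<Union>C \<in> S"
      using ideal_chain_is_trivial[OF C(1)] C(2) by (auto simp: subset.chain_def)
  qed
  then obtain M where "M \<in> S" "\<forall>I\<in>S. M \<subseteq> I \<longrightarrow> I = M" ..
  then show thesis
    by (intro that[of M]) auto
qed

text \<open>Among the ideals inside I that have a power in K, take a maximal one. Adjoining any
  \<open>r\<close> from I keeps a power in K, so the maximal ideal already contains all of
  I.\<close>

lemma (in noetherian_ring) ideal_pow_subset_of_radical:
  assumes "cring R" and I: "ideal I R" and K: "ideal K R"
    and rad: "\<And>r. r \<in> I \<Longrightarrow> \<exists>n::nat. r [^] n \<in> K"
  obtains m where "ideal_pow R I m \<subseteq> K"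
proof -
  interpret cring R by fact
  define S where "S = {J. ideal J R \<and> J \<subseteq> I \<and> (\<exists>m. ideal_pow R J m \<subseteq> K)}"
  \<comment> \<open>The exponent is 1, since the zeroth power of any ideal is all of R.\<close>
  have "ideal_pow R {\<zero>} 1 \<subseteq> K"
    using ideal_pow_1[OF zeroideal] ideal_zero_closed[OF K] by simp
  then have "{\<zero>} \<in> S"
    using zeroideal ideal_zero_closed[OF I] by (auto simp: S_def)
  then have "S \<noteq> {}" "S \<subseteq> {J. ideal J R}"
    by (auto simp: S_def)
  then obtain J where J: "J \<in> S" and max: "\<And>L. L \<in> S \<Longrightarrow> J \<subseteq> L \<Longrightarrow> L = J"
    by (rule exists_maximal_ideal_in) blast
  then obtain m where m: "ideal J R" "J \<subseteq> I" "ideal_pow R J m \<subseteq> K"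
    by (auto simp: S_def)
  have "I \<subseteq> J"
  proof
    fix r assume r: "r \<in> I"
    then have rc: "r \<in> carrier R"
      using ideal.Icarr[OF I] by auto
    obtain n :: nat where n: "r [^] n \<in> K"
      using rad[OF r] by blast
    have L: "ideal (PIdl r <+>\<^bsub>R\<^esub> J) R"
      by (rule add_ideals[OF cgenideal_ideal[OF rc] m(1)])
    have sub: "PIdl r <+>\<^bsub>R\<^esub> J \<subseteq> I"
      using cgenideal_minimal[OF I r] m(2) by (rule set_add_least[OF I])
    have "PIdl r <+>\<^bsub>R\<^esub> J \<in> S"
      using L sub ideal_pow_PIdl_add_subset[OF m(1) K rc n m(3)] by (auto simp: S_def)
    moreover have "J \<subseteq> PIdl r <+>\<^bsub>R\<^esub> J"
    proof
      fix x assume "x \<in> J"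
      then show "x \<in> PIdl r <+>\<^bsub>R\<^esub> J"
        using set_add_memI[OF ideal_zero_closed[OF cgenideal_ideal[OF rc]], of x J R]
          ideal.Icarr[OF m(1)] by simp
    qed
    ultimately have "PIdl r <+>\<^bsub>R\<^esub> J = J"
      by (rule max)
    then show "r \<in> J"
      using set_add_memI[OF cgenideal_self[OF rc] ideal_zero_closed[OF m(1)], of R] rc by simp
  qed
  with m(2) have "I = J"
    by auto
  with m(3) show thesis
    using that[of m] by simp
qed

section \<open>Torsion submodules\<close>

lemma (in cring) ideal_of_submodule:
  assumes "submodule I R (ring_module R)"
  shows "ideal I R"
proof (rule idealI)
  interpret A: plain_module R "ring_module R"
    by (rule plain_moduleI) (rule ring_module_is_module)
  note sub = A.submoduleE[OF assms]
  show "ring R"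
    by (rule ring_axioms)
  show "subgroup I (add_monoid R)"
  proof (rule add.subgroupI)
    show "\<ominus> a \<in> I" if "a \<in> I" for a
      using sub(4)[of "\<ominus> \<one>" a] sub(1) that by (auto simp: l_minus)
  qed (use sub(1,2,5) in auto)
  fix a x assume "a \<in> I" "x \<in> carrier R"
  then show "x \<otimes> a \<in> I" "a \<otimes> x \<in> I"
    using sub(1) sub(4)[of x a] by (auto simp: m_comm)
qed

lemma (in plain_module) annihilator_ideal:
  assumes "ideal I R"
  shows "submodule {x \<in> carrier M. \<forall>r\<in>I. r \<odot>\<^bsub>M\<^esub> x = \<zero>\<^bsub>M\<^esub>} R M"
proof (rule submodule_minusI)
  have c: "\<And>r. r \<in> I \<Longrightarrow> r \<in> carrier R"
    using ideal.Icarr[OF assms] .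
  fix a x assume ax: "a \<in> carrier R" "x \<in> {x \<in> carrier M. \<forall>r\<in>I. r \<odot>\<^bsub>M\<^esub> x = \<zero>\<^bsub>M\<^esub>}"
  have "r \<odot>\<^bsub>M\<^esub> (a \<odot>\<^bsub>M\<^esub> x) = \<zero>\<^bsub>M\<^esub>" if r: "r \<in> I" for r
  proof -
    have "r \<odot>\<^bsub>M\<^esub> (a \<odot>\<^bsub>M\<^esub> x) = (r \<otimes> a) \<odot>\<^bsub>M\<^esub> x"
      using ax c[OF r] by (simp add: smult_assoc1)
    also have "\<dots> = a \<odot>\<^bsub>M\<^esub> (r \<odot>\<^bsub>M\<^esub> x)"
      using ax c[OF r] by (simp add: R.m_comm smult_assoc1)
    finally show ?thesis
      using ax r by simp
  qed
  with ax show "a \<odot>\<^bsub>M\<^esub> x \<in> {x \<in> carrier M. \<forall>r\<in>I. r \<odot>\<^bsub>M\<^esub> x = \<zero>\<^bsub>M\<^esub>}"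
    by simp
qed (use ideal.Icarr[OF assms] in \<open>auto simp: smult_r_distr\<close>)

lemma torsion_module_simps [simp]:
  "\<zero>\<^bsub>torsion_module R I M\<^esub> = \<zero>\<^bsub>M\<^esub>" "add (torsion_module R I M) = add M"
  "smult (torsion_module R I M) = smult M"
  by (simp_all add: torsion_module_def)

lemma torsion_carrier:
  "carrier (torsion_module R I M) =
    {x \<in> carrier M. \<exists>n. \<forall>r\<in>ideal_pow R I n. r \<odot>\<^bsub>M\<^esub> x = \<zero>\<^bsub>M\<^esub>}"
  by (simp add: torsion_module_def)

text \<open>The torsion part is the increasing union of the annihilators of the powers of I, each of
  which is a submodule.\<close>

lemma (in plain_module) torsion_submodule:
  assumes "ideal I R"
  shows "submodule (carrier (torsion_module R I M)) R M"
proof (rule submodule_minusI)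
  let ?T = "\<lambda>n. {x \<in> carrier M. \<forall>r\<in>ideal_pow R I n. r \<odot>\<^bsub>M\<^esub> x = \<zero>\<^bsub>M\<^esub>}"
  note T = annihilator_ideal[OF R.ideal_pow_ideal[OF assms]]
  have eq: "carrier (torsion_module R I M) = (\<Union>n. ?T n)"
    by (auto simp: torsion_carrier)
  have mono: "?T m \<subseteq> ?T n" if "m \<le> n" for m n
    using R.ideal_pow_antimono[OF assms that] by blast
  show "a \<oplus>\<^bsub>M\<^esub> b \<in> carrier (torsion_module R I M)"
    if ab: "a \<in> carrier (torsion_module R I M)" "b \<in> carrier (torsion_module R I M)" for a b
  proof -
    obtain m n where "a \<in> ?T m" "b \<in> ?T n"
      using ab by (auto simp: eq)
    then have "a \<in> ?T (max m n)" "b \<in> ?T (max m n)"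
      using mono[of m "max m n"] mono[of n "max m n"] by auto
    then have "a \<oplus>\<^bsub>M\<^esub> b \<in> ?T (max m n)"
      by (rule submoduleE(5)[OF T])
    then show ?thesis
      unfolding eq by blast
  qed
  show "a \<odot>\<^bsub>M\<^esub> x \<in> carrier (torsion_module R I M)"
    if a: "a \<in> carrier R" and x: "x \<in> carrier (torsion_module R I M)" for a x
  proof -
    obtain n where "x \<in> ?T n"
      using x by (auto simp: eq)
    then have "a \<odot>\<^bsub>M\<^esub> x \<in> ?T n"
      by (rule submoduleE(4)[OF T a])
    then show ?thesis
      unfolding eq by blast
  qed
  show "\<zero>\<^bsub>M\<^esub> \<in> carrier (torsion_module R I M)"
    using submodule_zero[OF T, of 0] unfolding eq by blast
qed (auto simp: torsion_carrier)

lemma torsion_module_eq: "torsion_module R I M = M\<lparr>carrier := carrier (torsion_module R I M)\<rparr>"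
  by (simp add: torsion_module_def)

lemma torsion_is_module:
  assumes "module R M" "ideal I R"
  shows "module R (torsion_module R I M)"
proof -
  interpret M: plain_module R M by (rule plain_moduleI) fact
  show ?thesis
    by (subst torsion_module_eq)
      (rule submodule.submodule_is_module[OF M.torsion_submodule[OF assms(2)] assms(1)])
qed

lemma mod_hom_torsion:
  assumes "module R M" "module R N" "ideal I R" "mod_hom R M N f"
  shows "mod_hom R (torsion_module R I M) (torsion_module R I N) f"
proof (rule mod_homI)
  interpret M: plain_module R M by (rule plain_moduleI) fact
  fix x assume "x \<in> carrier (torsion_module R I M)"
  then obtain n where x: "x \<in> carrier M" "\<forall>r\<in>ideal_pow R I n. r \<odot>\<^bsub>M\<^esub> x = \<zero>\<^bsub>M\<^esub>"
    by (auto simp: torsion_carrier)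
  have "r \<odot>\<^bsub>N\<^esub> f x = \<zero>\<^bsub>N\<^esub>" if "r \<in> ideal_pow R I n" for r
    using mod_hom_smult[OF assms(4) M.R.ideal_pow_carrier[OF assms(3) that] x(1)] x(2) that
      mod_hom_zero[OF assms(1,2,4)] by simp
  then show "f x \<in> carrier (torsion_module R I N)"
    using mod_hom_closed[OF assms(4) x(1)] by (auto simp: torsion_carrier)
qed (use mod_hom_add[OF assms(4)] mod_hom_smult[OF assms(4)] in \<open>auto simp: torsion_carrier\<close>)

text \<open>The form in which finite generation enters: separate exponents or stages for the
  generators are replaced by a common one.\<close>

lemma finite_subset_of_chain:
  fixes S :: "nat \<Rightarrow> 'b set"
  assumes "finite A" "\<And>a. a \<in> A \<Longrightarrow> \<exists>n. a \<in> S n" "\<And>m n. m \<le> n \<Longrightarrow> S m \<subseteq> S n"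
  shows "\<exists>n. A \<subseteq> S n"
  using assms(1,2)
proof (induct A)
  case (insert a A)
  obtain m where "A \<subseteq> S m"
    using insert by auto
  moreover obtain n where "a \<in> S n"
    using insert by auto
  ultimately have "insert a A \<subseteq> S (max m n)"
    using assms(3)[of m "max m n"] assms(3)[of n "max m n"] by auto
  then show ?case ..
qed simp

section \<open>A weak Artin-Rees lemma and the injectivity of torsion submodules\<close>

lemma (in cring) pow_mem_ideal_pow:
  "ideal I R \<Longrightarrow> r \<in> I \<Longrightarrow> r [^] (n::nat) \<in> ideal_pow R I n"
  by (induct n) (auto simp: ideal_pow_Suc intro: ideal_prod.prod)

lemma (in cring) colon_ideal:
  assumes "ideal K R" "q \<in> carrier R"
  shows "ideal {s \<in> carrier R. q \<otimes> s \<in> K} R"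
proof (rule ideal_of_submodule)
  interpret A: plain_module R "ring_module R"
    by (rule plain_moduleI) (rule ring_module_is_module)
  show "submodule {s \<in> carrier R. q \<otimes> s \<in> K} R (ring_module R)"
  proof (rule A.submodule_minusI)
    fix a x assume ax: "a \<in> carrier R" "x \<in> {s \<in> carrier R. q \<otimes> s \<in> K}"
    then have "a \<otimes> (q \<otimes> x) \<in> K"
      using ideal.I_l_closed[OF assms(1)] by auto
    then show "a \<odot>\<^bsub>ring_module R\<^esub> x \<in> {s \<in> carrier R. q \<otimes> s \<in> K}"
      using ax assms(2) by (simp add: m_lcomm)
  qed (use assms ideal_zero_closed ideal_add_closed in \<open>auto simp: r_distr\<close>)
qed

text \<open>A weak form of the Artin-Rees lemma. If \<open>K\<close> is maximal among the ideals with
  \<open>C \<subseteq> K\<close> and \<open>K \<inter> B \<subseteq> C\<close>, then every \<open>r \<in> I\<close> has a power in \<open>K\<close>: the ideals \<open>(K : r\<^sup>n)\<close>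
  stabilise, which forces \<open>(K + (r\<^sup>n)) \<inter> B \<subseteq> C\<close> for large \<open>n\<close>.\<close>

lemma (in noetherian_ring) ideal_pow_inter_subset:
  assumes "cring R" and I: "ideal I R" and B: "ideal B R" and C: "ideal C R"
    and kill: "\<And>r y. r \<in> ideal_pow R I k \<Longrightarrow> y \<in> B \<Longrightarrow> r \<otimes> y \<in> C"
  obtains m where "ideal_pow R I m \<inter> B \<subseteq> C"
proof -
  interpret cring R by fact
  define S where "S = {K. ideal K R \<and> C \<subseteq> K \<and> K \<inter> B \<subseteq> C}"
  have "S \<noteq> {}" "S \<subseteq> {K. ideal K R}"
    using C by (auto simp: S_def)
  then obtain K where K: "K \<in> S" and max: "\<And>L. L \<in> S \<Longrightarrow> K \<subseteq> L \<Longrightarrow> L = K"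
    by (rule exists_maximal_ideal_in) blast
  then have KI: "ideal K R" and CK: "C \<subseteq> K" and KB: "K \<inter> B \<subseteq> C"
    by (auto simp: S_def)
  have rad: "\<exists>n::nat. r [^] n \<in> K" if r: "r \<in> I" for r
  proof -
    have rc: "r \<in> carrier R"
      using ideal.Icarr[OF I r] .
    define Q where "Q n = {s \<in> carrier R. r [^] n \<otimes> s \<in> K}" for n :: nat
    have Q: "ideal (Q n) R" for n
      unfolding Q_def by (rule colon_ideal[OF KI]) (simp add: rc)
    have "Q n \<subseteq> Q (Suc n)" for n
    proof
      fix s assume s: "s \<in> Q n"
      then have "r \<otimes> (r [^] n \<otimes> s) \<in> K"
        using ideal.I_l_closed[OF KI _ rc] by (auto simp: Q_def)
      then show "s \<in> Q (Suc n)"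
        using s rc by (auto simp: Q_def m_ac)
    qed
    then have Qmono: "Q m \<subseteq> Q n" if "m \<le> n" for m n
      using lift_Suc_mono_le that by blast
    have "\<Union>(range Q) \<in> range Q"
    proof (rule ideal_chain_is_trivial)
      show "subset.chain {I. ideal I R} (range Q)"
        using Q Qmono by (auto simp: subset_chain_def) (meson linear subsetD)
    qed simp
    then obtain n0 where n0: "\<And>m. Q m \<subseteq> Q n0"
      by auto
    \<comment> \<open>The exponent does two things: from \<open>n0\<close> on the colon ideals are
      constant, and from \<open>k\<close> on \<open>r [^] N\<close> lies in the power of I that
      multiplies B into C.\<close>
    define N where "N = max n0 k"
    have QN: "Q (N + N) \<subseteq> Q N"
      using n0 Qmono[of n0 N] by (auto simp: N_def)
    let ?p = "r [^] N"
    have p: "?p \<in> carrier R" "?p \<in> ideal_pow R I k"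
      using pow_mem_ideal_pow[OF I r, of N] ideal_pow_antimono[OF I, of k N] rc by (auto simp: N_def)
    have PI: "ideal (PIdl ?p) R"
      by (rule cgenideal_ideal[OF p(1)])
    have "K <+>\<^bsub>R\<^esub> PIdl ?p \<in> S"
    proof -
      have "y \<in> C" if y: "y \<in> K <+>\<^bsub>R\<^esub> PIdl ?p" "y \<in> B" for y
      proof -
        obtain \<kappa> s where \<kappa>: "\<kappa> \<in> K" "s \<in> carrier R" "y = \<kappa> \<oplus> s \<otimes> ?p"
          using y(1) by (auto elim!: set_add_memE simp: cgenideal_def)
        have kc: "\<kappa> \<in> carrier R"
          using ideal.Icarr[OF KI \<kappa>(1)] .
        \<comment> \<open>Multiplying \<open>y\<close> by \<open>?p\<close> lands in C and hence in
          K, so K contains \<open>s\<close> times the square of \<open>?p\<close>. Stationarity of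
          the colon ideals removes one factor \<open>?p\<close>; thus \<open>y\<close> lies in K and
          in B, hence in C.\<close>
        have "?p \<otimes> y \<in> K"
          using kill[OF p(2) y(2)] CK by auto
        moreover have "?p \<otimes> (\<ominus> \<kappa>) \<in> K"
          by (rule ideal.I_l_closed[OF KI ideal_neg_closed[OF KI \<kappa>(1)] p(1)])
        ultimately have "?p \<otimes> y \<oplus> ?p \<otimes> (\<ominus> \<kappa>) \<in> K"
          by (rule ideal_add_closed[OF KI])
        also have "?p \<otimes> y \<oplus> ?p \<otimes> (\<ominus> \<kappa>) = ?p \<otimes> (y \<oplus> (\<ominus> \<kappa>))"
          using \<kappa> kc p(1) by (simp add: r_distr)
        also have "y \<oplus> (\<ominus> \<kappa>) = s \<otimes> ?p"
          using \<kappa> kc p(1) by (simp add: a_ac r_neg2)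
        also have "?p \<otimes> (s \<otimes> ?p) = r [^] (N + N) \<otimes> s"
          using \<kappa>(2) rc by (simp add: nat_pow_mult[symmetric] m_ac)
        finally have "s \<in> Q N"
          using QN \<kappa>(2) by (auto simp: Q_def)
        then have "s \<otimes> ?p \<in> K"
          using m_comm[OF p(1) \<kappa>(2)] by (simp add: Q_def)
        then have "y \<in> K"
          using \<kappa> ideal_add_closed[OF KI] by simp
        then show ?thesis
          using KB y(2) by auto
      qed
      moreover have "C \<subseteq> K <+>\<^bsub>R\<^esub> PIdl ?p"
      proof
        fix x assume "x \<in> C"
        then show "x \<in> K <+>\<^bsub>R\<^esub> PIdl ?p"
          using set_add_memI[of x K "\<zero>" "PIdl ?p" R] CK ideal_zero_closed[OF PI] ideal.Icarr[OF C]
          by auto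
      qed
      ultimately show ?thesis
        using add_ideals[OF KI PI] by (auto simp: S_def)
    qed
    moreover have "K \<subseteq> K <+>\<^bsub>R\<^esub> PIdl ?p"
    proof
      fix x assume "x \<in> K"
      then show "x \<in> K <+>\<^bsub>R\<^esub> PIdl ?p"
        using set_add_memI[of x K "\<zero>" "PIdl ?p" R] ideal_zero_closed[OF PI] ideal.Icarr[OF KI]
        by auto
    qed
    ultimately have "K <+>\<^bsub>R\<^esub> PIdl ?p = K"
      by (rule max)
    then have "?p \<in> K"
      using set_add_memI[OF ideal_zero_closed[OF KI] cgenideal_self[OF p(1)], of R] p(1) by simp
    then show ?thesis ..
  qed
  then obtain m where "ideal_pow R I m \<subseteq> K"
    by (rule ideal_pow_subset_of_radical[OF assms(1) I KI])
  then show thesis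
    using KB by (intro that[of m]) auto
qed

text \<open>Let a homomorphism go from an ideal B to the torsion part. As B is finitely generated,
  some power of I kills all values, that is, multiplies B into the kernel C. By the Artin-Rees
  argument a higher power meets B inside C, so the map extends by zero to the sum of B and this
  power. The element that Baer's condition for E gives for the extension is killed by that power,
  hence is torsion.\<close>

theorem baer_torsion:
  assumes "cring R" "noetherian_ring R" and I: "ideal I R" and E: "baer_module R E"
  shows "baer_module R (torsion_module R I E)"
  unfolding baer_module_def
proof (intro conjI allI impI)
  interpret R: noetherian_ring R by fact
  interpret C: cring R by fact
  let ?T = "torsion_module R I E" and ?A = "ring_module R" and ?P = "ideal_pow R I"
  have modE: "module R E"
    using E by (simp add: baer_module_def)
  interpret E: plain_module R E by (rule plain_moduleI) fact
  interpret A: plain_module R ?A by (rule plain_moduleI) (rule C.ring_module_is_module)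
  show modT: "module R ?T"
    by (rule torsion_is_module[OF modE I])
  fix G assume G: "lin_graph R ?A ?T G"
  note GD = lin_graphD[OF G, unfolded ring_module_simps torsion_module_simps]
  have GE: "u \<in> carrier E" if "(x, u) \<in> G" for x u
    using GD(2)[OF that] by (simp add: torsion_carrier)
  note uniq = lin_graph_unique[OF A.module_axioms modT G]
  let ?B = "Domain G" and ?C = "{x. (x, \<zero>\<^bsub>E\<^esub>) \<in> G}"
  have B: "ideal ?B R"
    by (rule C.ideal_of_submodule[OF lin_graph_domain[OF A.module_axioms G]])
  have C: "ideal ?C R"
  proof (rule C.ideal_of_submodule, rule A.submodule_minusI)
    fix a b assume ab: "a \<in> ?C" "b \<in> ?C"
    then show "a \<oplus>\<^bsub>?A\<^esub> b \<in> ?C"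
      using GD(4)[of a "\<zero>\<^bsub>E\<^esub>" b "\<zero>\<^bsub>E\<^esub>"] by simp
  next
    fix r x assume "r \<in> carrier R" "x \<in> ?C"
    then show "r \<odot>\<^bsub>?A\<^esub> x \<in> ?C"
      using GD(5)[of r x "\<zero>\<^bsub>E\<^esub>"] by simp
  qed (use GD(1,3) in auto)
  obtain F where F: "F \<subseteq> carrier R" "finite F" "?B = Idl\<^bsub>R\<^esub> F"
    using R.finetely_gen[OF B] by auto
  \<comment> \<open>The elements of the source whose value is killed by the n-th power, expressed
    through the kernel \<open>?C\<close> of the graph so that it fits the Artin-Rees lemma.\<close>
  define S where "S n = {x \<in> ?B. \<forall>r\<in>?P n. r \<otimes>\<^bsub>R\<^esub> x \<in> ?C}" for n
  have Skill: "x \<in> S n \<longleftrightarrow> (\<forall>r\<in>?P n. r \<odot>\<^bsub>E\<^esub> u = \<zero>\<^bsub>E\<^esub>)" if xu: "(x, u) \<in> G" for x u n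
  proof -
    have "r \<otimes>\<^bsub>R\<^esub> x \<in> ?C \<longleftrightarrow> r \<odot>\<^bsub>E\<^esub> u = \<zero>\<^bsub>E\<^esub>" if "r \<in> ?P n" for r
      using GD(5)[OF C.ideal_pow_carrier[OF I that] xu] uniq by auto
    then show ?thesis
      using xu by (auto simp: S_def)
  qed
  have "\<exists>n. F \<subseteq> S n"
  proof (rule finite_subset_of_chain[OF F(2)])
    fix a assume "a \<in> F"
    then have "a \<in> ?B"
      using R.genideal_self[OF F(1)] F(3) by auto
    then obtain u where u: "(a, u) \<in> G"
      by auto
    then obtain n where "\<forall>r\<in>?P n. r \<odot>\<^bsub>E\<^esub> u = \<zero>\<^bsub>E\<^esub>"
      using GD(2)[OF u] by (auto simp: torsion_carrier)
    then show "\<exists>n. a \<in> S n"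
      using Skill[OF u] by blast
  next
    show "S m \<subseteq> S n" if "m \<le> n" for m n
      using C.ideal_pow_antimono[OF I that] by (auto simp: S_def)
  qed
  then obtain k where k: "F \<subseteq> S k" ..
  have "ideal (S k) R"
  proof (rule C.ideal_of_submodule, rule A.submodule_minusI)
    show "S k \<subseteq> carrier ?A"
      using GD(1) by (auto simp: S_def)
    show "\<zero>\<^bsub>?A\<^esub> \<in> S k"
      using Skill[OF GD(3), of k] C.ideal_pow_carrier[OF I, of _ k] by simp
    fix x assume x: "x \<in> S k"
    then obtain u where u: "(x, u) \<in> G"
      by (auto simp: S_def)
    have ann: "submodule {x \<in> carrier E. \<forall>r\<in>?P k. r \<odot>\<^bsub>E\<^esub> x = \<zero>\<^bsub>E\<^esub>} R E"
      by (rule E.annihilator_ideal[OF C.ideal_pow_ideal[OF I]])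
    have um: "u \<in> {x \<in> carrier E. \<forall>r\<in>?P k. r \<odot>\<^bsub>E\<^esub> x = \<zero>\<^bsub>E\<^esub>}"
      using Skill[OF u] x GE[OF u] by simp
    show "r \<odot>\<^bsub>?A\<^esub> x \<in> S k" if "r \<in> carrier R" for r
      using Skill[OF GD(5)[OF that u]] E.submoduleE(4)[OF ann that um] by simp
    fix y assume y: "y \<in> S k"
    then obtain v where v: "(y, v) \<in> G"
      by (auto simp: S_def)
    have vm: "v \<in> {x \<in> carrier E. \<forall>r\<in>?P k. r \<odot>\<^bsub>E\<^esub> x = \<zero>\<^bsub>E\<^esub>}"
      using Skill[OF v] y GE[OF v] by simp
    show "x \<oplus>\<^bsub>?A\<^esub> y \<in> S k"
      using Skill[OF GD(4)[OF u v]] E.submoduleE(5)[OF ann um vm] by simp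
  qed
  then have "?B \<subseteq> S k"
    unfolding F(3) using k by (rule R.genideal_minimal)
  then have kill: "r \<otimes>\<^bsub>R\<^esub> y \<in> ?C" if "r \<in> ?P k" "y \<in> ?B" for r y
    using that by (auto simp: S_def)
  obtain m where m: "?P m \<inter> ?B \<subseteq> ?C"
    by (rule R.ideal_pow_inter_subset[OF assms(1) I B C kill])
  \<comment> \<open>The extension of G by zero on \<open>?P m\<close>; it is single-valued because
    \<open>?P m\<close> meets the domain only in the kernel.\<close>
  define H where "H = {(y \<oplus>\<^bsub>R\<^esub> z, u) | y z u. (y, u) \<in> G \<and> z \<in> ?P m}"
  have HI: "(y \<oplus>\<^bsub>R\<^esub> z, u) \<in> H" if "(y, u) \<in> G" "z \<in> ?P m" for y z u
    using that by (auto simp: H_def)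
  note Pm = C.ideal_pow_ideal[OF I, of m]
  note Pc = C.ideal_pow_carrier[OF I, of _ m]
  have "lin_graph R ?A E H"
  proof (rule lin_graphI)
    show "(\<zero>\<^bsub>?A\<^esub>, \<zero>\<^bsub>E\<^esub>) \<in> H"
      using HI[OF GD(3) R.ideal_zero_closed[OF Pm]] by simp
    fix x u assume "(x, u) \<in> H"
    then obtain y z where yz: "(y, u) \<in> G" "z \<in> ?P m" "x = y \<oplus>\<^bsub>R\<^esub> z"
      by (auto simp: H_def)
    show "x \<in> carrier ?A" "u \<in> carrier E"
      using yz GD(1) GE Pc by auto
    show "(r \<odot>\<^bsub>?A\<^esub> x, r \<odot>\<^bsub>E\<^esub> u) \<in> H" if r: "r \<in> carrier R" for r
      using HI[OF GD(5)[OF r yz(1)] ideal.I_l_closed[OF Pm yz(2) r]] yz r GD(1)[OF yz(1)] Pc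
      by (simp add: R.r_distr)
    fix x' u' assume "(x', u') \<in> H"
    then obtain y' z' where yz': "(y', u') \<in> G" "z' \<in> ?P m" "x' = y' \<oplus>\<^bsub>R\<^esub> z'"
      by (auto simp: H_def)
    show "(x \<oplus>\<^bsub>?A\<^esub> x', u \<oplus>\<^bsub>E\<^esub> u') \<in> H"
      using HI[OF GD(4)[OF yz(1) yz'(1)] R.ideal_add_closed[OF Pm yz(2) yz'(2)]] yz yz'
        GD(1)[OF yz(1)] GD(1)[OF yz'(1)] Pc
      by (simp add: R.a_ac)
  next
    fix u assume "(\<zero>\<^bsub>?A\<^esub>, u) \<in> H"
    then obtain y z where yz: "(y, u) \<in> G" "z \<in> ?P m" "\<zero>\<^bsub>R\<^esub> = y \<oplus>\<^bsub>R\<^esub> z"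
      by (auto simp: H_def)
    then have "y = \<ominus>\<^bsub>R\<^esub> z"
      using GD(1) Pc by (metis R.minus_equality)
    then have "y \<in> ?P m \<inter> ?B"
      using R.ideal_neg_closed[OF Pm yz(2)] yz(1) by auto
    then have "(y, \<zero>\<^bsub>E\<^esub>) \<in> G"
      using m by auto
    then show "u = \<zero>\<^bsub>E\<^esub>"
      using uniq[OF yz(1)] by simp
  qed
  then obtain e where e: "e \<in> carrier E" and eH: "\<forall>(r, u)\<in>H. u = r \<odot>\<^bsub>E\<^esub> e"
    using E unfolding baer_module_def by meson
  have "r \<odot>\<^bsub>E\<^esub> e = \<zero>\<^bsub>E\<^esub>" if "r \<in> ?P m" for r
    using HI[OF GD(3) that] eH Pc[OF that] by auto
  then have "e \<in> carrier ?T"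
    using e by (auto simp: torsion_carrier)
  moreover have "u = r \<odot>\<^bsub>E\<^esub> e" if "(r, u) \<in> G" for r u
    using HI[OF that R.ideal_zero_closed[OF Pm]] eH GD(1)[OF that] by auto
  ultimately show "\<exists>e\<in>carrier ?T. \<forall>(r, u)\<in>G. u = r \<odot>\<^bsub>?T\<^esub> e"
    by auto
qed

section \<open>Characters of abelian groups\<close>

text \<open>Group homomorphisms become module homomorphisms over the integers, so that
  \<open>baer_extend\<close> also extends characters.\<close>

definition int_module :: "('a, 'm) module \<Rightarrow> (int, 'm) module"
  where "int_module M =
    \<lparr>carrier = carrier M, monoid.mult = undefined, one = undefined,
     zero = \<zero>\<^bsub>M\<^esub>, add = add M, smult = (\<lambda>n x. add_pow M n x)\<rparr>"

text \<open>The multiplicative group of nonzero complex numbers, written as a module whose zero is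
  1. It stands in for the rationals modulo the integers: it is divisible and has elements of every
  finite order.\<close>

definition cunits_module :: "(int, complex) module"
  where "cunits_module =
    \<lparr>carrier = - {0}, monoid.mult = undefined, one = undefined,
     zero = 1, add = (*), smult = (\<lambda>n z. z powi n)\<rparr>"

lemma int_module_simps [simp]:
  "carrier (int_module M) = carrier M" "\<zero>\<^bsub>int_module M\<^esub> = \<zero>\<^bsub>M\<^esub>"
  "x \<oplus>\<^bsub>int_module M\<^esub> y = x \<oplus>\<^bsub>M\<^esub> y" "n \<odot>\<^bsub>int_module M\<^esub> x = add_pow M n x"
  by (simp_all add: int_module_def)

lemma cunits_module_simps [simp]:
  "carrier cunits_module = - {0}" "\<zero>\<^bsub>cunits_module\<^esub> = 1"
  "z \<oplus>\<^bsub>cunits_module\<^esub> w = z * w" "n \<odot>\<^bsub>cunits_module\<^esub> z = z powi n"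
  by (simp_all add: cunits_module_def)

lemma (in plain_module) int_module_is_module: "module \<Z> (int_module M)"
proof (intro moduleI abelian_groupI)
  show "cring \<Z>"
    by (rule int_is_cring)
  show "(a \<otimes>\<^bsub>\<Z>\<^esub> b) \<odot>\<^bsub>int_module M\<^esub> x = a \<odot>\<^bsub>int_module M\<^esub> (b \<odot>\<^bsub>int_module M\<^esub> x)"
    if "x \<in> carrier (int_module M)" for a b x
    using M.add.int_pow_pow[of x a b] that by (simp add: mult.commute)
qed (auto simp: M.a_ac M.add.int_pow_mult M.add.int_pow_distrib
    intro!: bexI[of _ "\<ominus>\<^bsub>M\<^esub> _"] M.l_neg)

lemma cunits_is_module: "module \<Z> cunits_module"
proof (intro moduleI abelian_groupI)
  show "cring \<Z>"
    by (rule int_is_cring)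
  show "\<exists>y\<in>carrier cunits_module. y \<oplus>\<^bsub>cunits_module\<^esub> x = \<zero>\<^bsub>cunits_module\<^esub>"
    if "x \<in> carrier cunits_module" for x
    using that by (intro bexI[of _ "inverse x"]) auto
qed (auto simp: power_int_add power_int_mult_distrib power_int_mult[symmetric] mult.commute)

text \<open>Division with remainder by the least positive member. The zero subgroup is covered by
  \<open>m = 0\<close>, since 0 divides only 0.\<close>

lemma int_subgroup_principal:
  fixes I :: "int set"
  assumes "0 \<in> I" "\<And>a b. a \<in> I \<Longrightarrow> b \<in> I \<Longrightarrow> a + b \<in> I" "\<And>k a. a \<in> I \<Longrightarrow> k * a \<in> I"
  obtains m :: nat where "\<And>n. n \<in> I \<longleftrightarrow> int m dvd n"
proof (cases "I \<subseteq> {0}")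
  case True
  then show ?thesis
    using that[of 0] assms(1) by auto
next
  case False
  then obtain a where a: "a \<in> I" "a \<noteq> 0"
    by auto
  define P where "P m \<longleftrightarrow> 0 < m \<and> int m \<in> I" for m
  have "\<bar>a\<bar> \<in> I"
    using assms(3)[OF a(1), of "sgn a"] by (simp add: abs_sgn mult.commute)
  then have "P (nat \<bar>a\<bar>)"
    using a(2) by (simp add: P_def)
  then have P: "P (LEAST m. P m)"
    by (rule LeastI)
  let ?m = "LEAST m. P m"
  have "n \<in> I \<longleftrightarrow> int ?m dvd n" for n
  proof
    assume n: "n \<in> I"
    have "n + (- (n div int ?m)) * int ?m \<in> I"
      using P by (intro assms n) (simp add: P_def)
    then have "n mod int ?m \<in> I"
      by (simp add: minus_div_mult_eq_mod[symmetric])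
    moreover have "0 \<le> n mod int ?m" "n mod int ?m < int ?m"
      using P by (simp_all add: P_def)
    ultimately have "n mod int ?m = 0"
      using not_less_Least[of "nat (n mod int ?m)" P] by (auto simp: P_def nat_less_iff)
    then show "int ?m dvd n"
      by (simp add: dvd_eq_mod_eq_0)
  next
    assume "int ?m dvd n"
    then show "n \<in> I"
      using assms(3)[of "int ?m"] P by (auto simp: P_def dvd_def mult.commute)
  qed
  then show ?thesis
    by (rule that)
qed

lemma complex_root_exists:
  assumes "0 < m"
  shows "\<exists>z::complex. z ^ m = w"
proof -
  obtain r a where "w = rcis r a" "0 \<le> r"
    by (metis rcis_cmod_Arg norm_ge_zero)
  then have "rcis (root m r) (a / real m) ^ m = w"
    using assms by (simp add: DeMoivre2 real_root_pow_pos2)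
  then show ?thesis ..
qed

text \<open>The domain of the graph consists of the multiples of some \<open>m\<close>, and the
  graph is determined by the value \<open>w\<close> at \<open>m\<close>. An m-th root of
  \<open>w\<close> solves the system; for \<open>m = 0\<close> the value is forced to be 1.\<close>

lemma baer_cunits: "baer_module \<Z> cunits_module"
  unfolding baer_module_def
proof (intro conjI allI impI)
  show mod: "module \<Z> cunits_module"
    by (rule cunits_is_module)
  fix G assume G: "lin_graph \<Z> (ring_module \<Z>) cunits_module G"
  note GD = lin_graphD[OF G, simplified]
  have Z: "module \<Z> (ring_module \<Z>)"
    by (rule cring.ring_module_is_module[OF int_is_cring])
  note uniq = lin_graph_unique[OF Z mod G]
  obtain m where m: "\<And>n. n \<in> Domain G \<longleftrightarrow> int m dvd n"
  proof (rule int_subgroup_principal[of "Domain G"])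
    show "0 \<in> Domain G"
      using GD(3) by (rule DomainI)
    show "a + b \<in> Domain G" if ab: "a \<in> Domain G" "b \<in> Domain G" for a b
    proof -
      obtain u v where "(a, u) \<in> G" "(b, v) \<in> G"
        using ab by auto
      from GD(4)[OF this] show ?thesis
        by (rule DomainI)
    qed
    show "k * a \<in> Domain G" if a: "a \<in> Domain G" for a k
    proof -
      obtain u where "(a, u) \<in> G"
        using a by auto
      from GD(5)[OF this] show ?thesis
        by (rule DomainI)
    qed
  qed (rule that)
  then obtain w where w: "(int m, w) \<in> G"
    by (metis DomainE dvd_refl)
  have w0: "w \<noteq> 0"
    using GD(2)[OF w] by simp
  obtain e where e: "e \<noteq> 0" "e ^ m = w"
  proof (cases "m = 0")
    case True
    then show ?thesis
      using GD(6) w that[of 1] by simp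
  next
    case False
    then obtain e where "e ^ m = w"
      using complex_root_exists by auto
    then show ?thesis
      using that[of e] w0 False by auto
  qed
  have "u = e powi n" if nu: "(n, u) \<in> G" for n u
  proof -
    have "int m dvd n"
      using DomainI[OF nu] m by simp
    then obtain k where k: "n = k * int m"
      by (metis dvd_def mult.commute)
    have "(n, w powi k) \<in> G"
      using GD(5)[OF w, of k] k by simp
    then have "u = w powi k"
      using uniq nu by simp
    then show ?thesis
      using e(2) k by (metis mult.commute power_int_mult power_int_of_nat)
  qed
  then show "\<exists>e\<in>carrier cunits_module. \<forall>(n, u)\<in>G. u = n \<odot>\<^bsub>cunits_module\<^esub> e"
    using e(1) by (intro bexI[of _ e]) auto
qed

context plain_module
begin

definition group_char :: "('m \<Rightarrow> complex) \<Rightarrow> bool"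
  where "group_char \<chi> \<longleftrightarrow>
    (\<forall>x\<in>carrier M. \<chi> x \<noteq> 0) \<and> (\<forall>x\<in>carrier M. \<forall>y\<in>carrier M. \<chi> (x \<oplus>\<^bsub>M\<^esub> y) = \<chi> x * \<chi> y)"

text \<open>Closure under integer multiples follows from sums and negatives, so a subgroup of pairs
  is already a linear graph over the integers; Baer's condition for the complex units extends
  it.\<close>

lemma group_char_extend:
  assumes G: "\<And>x u. (x, u) \<in> G \<Longrightarrow> x \<in> carrier M" "\<And>x u. (x, u) \<in> G \<Longrightarrow> u \<noteq> 0"
    and G0: "(\<zero>\<^bsub>M\<^esub>, 1) \<in> G"
    and Gadd: "\<And>x u y v. (x, u) \<in> G \<Longrightarrow> (y, v) \<in> G \<Longrightarrow> (x \<oplus>\<^bsub>M\<^esub> y, u * v) \<in> G"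
    and Gneg: "\<And>x u. (x, u) \<in> G \<Longrightarrow> (\<ominus>\<^bsub>M\<^esub> x, inverse u) \<in> G"
    and single: "\<And>u. (\<zero>\<^bsub>M\<^esub>, u) \<in> G \<Longrightarrow> u = 1"
  obtains \<chi> where "group_char \<chi>" "\<And>x u. (x, u) \<in> G \<Longrightarrow> \<chi> x = u"
proof -
  have nat: "(add_pow M (int n) x, u ^ n) \<in> G" if xu: "(x, u) \<in> G" for x u n
  proof (induct n)
    case (Suc n)
    have "add_pow M (int (Suc n)) x = x \<oplus>\<^bsub>M\<^esub> add_pow M (int n) x"
      using M.add.int_pow_mult[of x 1 "int n"] G(1)[OF xu] by simp
    then show ?case
      using Gadd[OF xu Suc] by simp
  qed (simp add: G0 add_pow_def)
  have "lin_graph \<Z> (int_module M) cunits_module G"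
  proof (rule lin_graphI)
    show "(n \<odot>\<^bsub>int_module M\<^esub> x, n \<odot>\<^bsub>cunits_module\<^esub> u) \<in> G" if xu: "(x, u) \<in> G" for n x u
    proof (cases n rule: int_cases2)
      case (nonneg k)
      then show ?thesis
        using nat[OF xu, of k] by simp
    next
      case (nonpos k)
      then show ?thesis
        using Gneg[OF nat[OF xu, of k]] G(1)[OF xu]
        by (simp add: M.add.int_pow_neg power_int_minus)
    qed
  qed (use assms in auto)
  then obtain \<chi> where \<chi>: "mod_hom \<Z> (int_module M) cunits_module \<chi>" "\<forall>(x, u)\<in>G. \<chi> x = u"
    by (rule baer_extend[OF int_module_is_module baer_cunits])
  have "group_char \<chi>"
    using mod_hom_closed[OF \<chi>(1)] mod_hom_add[OF \<chi>(1)] by (auto simp: group_char_def)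
  then show thesis
    using \<chi>(2) by (intro that[of \<chi>]) auto
qed

text \<open>On the cyclic group generated by \<open>y\<close> a character may send \<open>y\<close>
  to any root of unity whose order divides that of \<open>y\<close>, in particular to one other than
  1; it then extends to the whole group.\<close>

lemma group_char_separates:
  assumes "y \<in> carrier M" "y \<noteq> \<zero>\<^bsub>M\<^esub>"
  obtains \<chi> where "group_char \<chi>" "\<chi> y \<noteq> 1"
proof -
  define I where "I = {n::int. add_pow M n y = \<zero>\<^bsub>M\<^esub>}"
  obtain m where m: "\<And>n. n \<in> I \<longleftrightarrow> int m dvd n"
  proof (rule int_subgroup_principal[of I])
    show "k * a \<in> I" if "a \<in> I" for k a
      using that M.add.int_pow_pow[OF assms(1), of k a] by (simp add: I_def mult.commute)
    show "0 \<in> I"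
      by (simp add: I_def add_pow_def)
    show "a + b \<in> I" if "a \<in> I" "b \<in> I" for a b
      using that assms(1) by (simp add: I_def M.add.int_pow_mult)
  qed (rule that)
  have "m \<noteq> 1"
    using m[of 1] assms by (auto simp: I_def)
  \<comment> \<open>Here \<open>m\<close> is the order of \<open>y\<close>, with 0 for infinite
    order. In the latter case the last condition is void and 2 will do.\<close>
  obtain \<zeta> :: complex where \<zeta>: "\<zeta> \<noteq> 0" "\<zeta> \<noteq> 1" "\<zeta> ^ m = 1"
  proof (cases "m = 0")
    case True
    then show ?thesis
      using that[of 2] by simp
  next
    case False
    define z where "z = cis (2 * pi / real m)"
    have "z ^ m = 1"
      using False by (simp add: z_def DeMoivre)
    moreover have "z \<noteq> 1"
    proof
      assume "z = 1"
      then have "cos (2 * pi / real m) = 1"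
        by (simp add: z_def cis.ctr complex_eq_iff)
      then obtain n :: int where "2 * pi / real m = n * 2 * pi"
        by (auto simp: cos_one_2pi_int)
      then have "real_of_int (n * int m) = 1"
        using False by (simp add: field_simps)
      then have "n * int m = 1"
        by linarith
      then show False
        using \<open>m \<noteq> 1\<close> by (simp add: zmult_eq_1_iff)
    qed
    ultimately show ?thesis
      using that[of z] by (simp add: z_def)
  qed
  have powi: "\<zeta> powi n = 1" if "add_pow M n y = \<zero>\<^bsub>M\<^esub>" for n :: int
  proof -
    have "int m dvd n"
      using that m by (simp add: I_def)
    then obtain k where "n = int m * k"
      by (auto simp: dvd_def)
    then show ?thesis
      using \<zeta>(3) by (simp add: power_int_mult)
  qed
  obtain \<chi> where \<chi>: "group_char \<chi>" "\<And>x u. (x, u) \<in> range (\<lambda>n::int. (add_pow M n y, \<zeta> powi n)) \<Longrightarrow> \<chi> x = u"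
  proof (rule group_char_extend[of "range (\<lambda>n::int. (add_pow M n y, \<zeta> powi n))"])
    show "(\<zero>\<^bsub>M\<^esub>, 1) \<in> range (\<lambda>n::int. (add_pow M n y, \<zeta> powi n))"
      by (rule range_eqI[of _ _ 0]) (simp add: add_pow_def)
    fix x u assume "(x, u) \<in> range (\<lambda>n::int. (add_pow M n y, \<zeta> powi n))"
    then obtain n where n: "x = add_pow M n y" "u = \<zeta> powi n"
      by auto
    show "x \<in> carrier M" "u \<noteq> 0"
      using n assms(1) \<zeta>(1) by auto
    show "(\<ominus>\<^bsub>M\<^esub> x, inverse u) \<in> range (\<lambda>n::int. (add_pow M n y, \<zeta> powi n))"
      by (rule range_eqI[of _ _ "- n"]) (use n assms(1) in \<open>simp add: M.add.int_pow_neg power_int_minus\<close>)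
    fix x' u' assume "(x', u') \<in> range (\<lambda>n::int. (add_pow M n y, \<zeta> powi n))"
    then obtain n' where n': "x' = add_pow M n' y" "u' = \<zeta> powi n'"
      by auto
    show "(x \<oplus>\<^bsub>M\<^esub> x', u * u') \<in> range (\<lambda>n::int. (add_pow M n y, \<zeta> powi n))"
      by (rule range_eqI[of _ _ "n + n'"])
        (use n n' assms(1) \<zeta>(1) in \<open>simp add: M.add.int_pow_mult power_int_add\<close>)
  next
    show "u = 1" if "(\<zero>\<^bsub>M\<^esub>, u) \<in> range (\<lambda>n::int. (add_pow M n y, \<zeta> powi n))" for u
      using that powi by auto
  qed (rule that)
  have "(y, \<zeta>) \<in> range (\<lambda>n::int. (add_pow M n y, \<zeta> powi n))"
    by (rule range_eqI[of _ _ 1]) (simp add: assms(1))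
  from \<chi>(2)[OF this] show thesis
    using \<chi>(1) \<zeta>(2) by (intro that[of \<chi>]) auto
qed

end

section \<open>Embedding into Baer modules\<close>

text \<open>A product, indexed by the type \<open>'y\<close>, of copies of the character group of R
  with values in the nonzero complex numbers. A scalar acts by multiplication in the argument.
  Outside the carrier of R the value is fixed to 1, so that equality of functions is equality in the
  module.\<close>

definition char_module :: "('a, 'r) ring_scheme \<Rightarrow> ('a, 'y \<Rightarrow> 'a \<Rightarrow> complex) module"
  where "char_module R =
    \<lparr>carrier = {h. \<forall>y. (\<forall>r\<in>carrier R. h y r \<noteq> 0) \<and> (\<forall>r. r \<notin> carrier R \<longrightarrow> h y r = 1) \<and>
        (\<forall>r\<in>carrier R. \<forall>s\<in>carrier R. h y (r \<oplus>\<^bsub>R\<^esub> s) = h y r * h y s)},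
     monoid.mult = undefined, one = undefined,
     zero = (\<lambda>_ _. 1), add = (\<lambda>h k y r. h y r * k y r),
     smult = (\<lambda>c h y r. if r \<in> carrier R then h y (r \<otimes>\<^bsub>R\<^esub> c) else 1)\<rparr>"

context cring
begin

lemma char_moduleI:
  assumes "\<And>y r. r \<in> carrier R \<Longrightarrow> h y r \<noteq> 0" "\<And>y r. r \<notin> carrier R \<Longrightarrow> h y r = 1"
    and "\<And>y r s. r \<in> carrier R \<Longrightarrow> s \<in> carrier R \<Longrightarrow> h y (r \<oplus> s) = h y r * h y s"
  shows "h \<in> carrier (char_module R)"
  using assms by (simp add: char_module_def)

lemma char_moduleD:
  assumes "h \<in> carrier (char_module R)"
  shows "\<And>y r. r \<in> carrier R \<Longrightarrow> h y r \<noteq> 0" "\<And>y r. r \<notin> carrier R \<Longrightarrow> h y r = 1"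
    "\<And>y r s. r \<in> carrier R \<Longrightarrow> s \<in> carrier R \<Longrightarrow> h y (r \<oplus> s) = h y r * h y s"
  using assms by (simp_all add: char_module_def)

lemma char_module_zero_arg:
  assumes "h \<in> carrier (char_module R)"
  shows "h y \<zero> = 1"
  using char_moduleD(3)[OF assms zero_closed zero_closed, of y] char_moduleD(1)[OF assms zero_closed, of y]
  by simp

lemma char_module_ops:
  "\<zero>\<^bsub>char_module R\<^esub> = (\<lambda>_ _. 1)" "h \<oplus>\<^bsub>char_module R\<^esub> k = (\<lambda>y r. h y r * k y r)"
  "c \<odot>\<^bsub>char_module R\<^esub> h = (\<lambda>y r. if r \<in> carrier R then h y (r \<otimes> c) else 1)"
  by (simp_all add: char_module_def)

lemma char_module_is_module: "module R (char_module R)"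
proof (intro moduleI abelian_groupI)
  show "cring R"
    by (rule is_cring)
  fix h assume h: "h \<in> carrier (char_module R :: ('a, 'y \<Rightarrow> 'a \<Rightarrow> complex) module)"
  note hD = char_moduleD[OF h]
  show "\<exists>k\<in>carrier (char_module R). k \<oplus>\<^bsub>char_module R\<^esub> h = \<zero>\<^bsub>char_module R\<^esub>"
  proof
    show "(\<lambda>y r. inverse (h y r)) \<in> carrier (char_module R)"
      by (rule char_moduleI) (auto simp: hD)
    show "(\<lambda>y r. inverse (h y r)) \<oplus>\<^bsub>char_module R\<^esub> h = \<zero>\<^bsub>char_module R\<^esub>"
    proof (intro ext)
      show "((\<lambda>y r. inverse (h y r)) \<oplus>\<^bsub>char_module R\<^esub> h) y r = \<zero>\<^bsub>char_module R\<^esub> y r" for y r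
        using hD(1,2)[of r y] by (cases "r \<in> carrier R") (auto simp: char_module_ops)
    qed
  qed
  show "\<zero>\<^bsub>char_module R\<^esub> \<oplus>\<^bsub>char_module R\<^esub> h = h"
    by (simp add: char_module_ops)
  show "\<one> \<odot>\<^bsub>char_module R\<^esub> h = h"
    by (intro ext) (auto simp: char_module_ops hD)
  fix a assume a: "a \<in> carrier R"
  show "a \<odot>\<^bsub>char_module R\<^esub> h \<in> carrier (char_module R)"
    by (rule char_moduleI) (auto simp: char_module_ops hD a l_distr)
  fix b assume b: "b \<in> carrier R"
  show "(a \<oplus> b) \<odot>\<^bsub>char_module R\<^esub> h = a \<odot>\<^bsub>char_module R\<^esub> h \<oplus>\<^bsub>char_module R\<^esub> b \<odot>\<^bsub>char_module R\<^esub> h"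
    by (intro ext) (auto simp: char_module_ops hD a b r_distr)
  show "a \<otimes> b \<odot>\<^bsub>char_module R\<^esub> h = a \<odot>\<^bsub>char_module R\<^esub> (b \<odot>\<^bsub>char_module R\<^esub> h)"
    by (intro ext) (auto simp: char_module_ops hD a b m_assoc)
next
  fix h k assume hk: "h \<in> carrier (char_module R :: ('a, 'y \<Rightarrow> 'a \<Rightarrow> complex) module)"
    "k \<in> carrier (char_module R :: ('a, 'y \<Rightarrow> 'a \<Rightarrow> complex) module)"
  show "h \<oplus>\<^bsub>char_module R\<^esub> k \<in> carrier (char_module R)"
    by (rule char_moduleI) (auto simp: char_module_ops char_moduleD[OF hk(1)] char_moduleD[OF hk(2)])
  show "a \<odot>\<^bsub>char_module R\<^esub> (h \<oplus>\<^bsub>char_module R\<^esub> k) =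
      a \<odot>\<^bsub>char_module R\<^esub> h \<oplus>\<^bsub>char_module R\<^esub> a \<odot>\<^bsub>char_module R\<^esub> k" for a
    by (intro ext) (auto simp: char_module_ops)
qed (auto simp: char_module_ops mult_ac intro!: char_moduleI)

text \<open>The adjunction for coinduced modules: evaluation at one turns a linear map from an ideal
  into the characters of R into a plain character of the ideal. That extends to R by divisibility,
  separately for each index \<open>y\<close>.\<close>

lemma baer_char_module: "baer_module R (char_module R :: ('a, 'y \<Rightarrow> 'a \<Rightarrow> complex) module)"
  unfolding baer_module_def
proof (intro conjI allI impI)
  let ?C = "char_module R :: ('a, 'y \<Rightarrow> 'a \<Rightarrow> complex) module"
  show C: "module R ?C"
    by (rule char_module_is_module)
  fix G assume G: "lin_graph R (ring_module R) ?C G"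
  note GD = lin_graphD[OF G, unfolded ring_module_simps]
  interpret A: plain_module R "ring_module R"
    by (rule plain_moduleI) (rule ring_module_is_module)
  have Aneg: "\<ominus>\<^bsub>ring_module R\<^esub> r = \<ominus> r" if "r \<in> carrier R" for r
    using A.neg_eq_smult[of r] that by (simp add: l_minus)
  have ex: "\<exists>\<chi>. A.group_char \<chi> \<and> (\<forall>(r, h)\<in>G. \<chi> r = h y \<one>)" for y
  proof -
    obtain \<chi> where \<chi>: "A.group_char \<chi>" "\<And>r u. (r, u) \<in> (\<lambda>(r, h). (r, h y \<one>)) ` G \<Longrightarrow> \<chi> r = u"
    proof (rule A.group_char_extend[of "(\<lambda>(r, h). (r, h y \<one>)) ` G"])
      show "(\<zero>\<^bsub>ring_module R\<^esub>, 1) \<in> (\<lambda>(r, h). (r, h y \<one>)) ` G"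
        by (rule image_eqI[OF _ GD(3)]) (simp add: char_module_ops)
      fix r u assume "(r, u) \<in> (\<lambda>(r, h). (r, h y \<one>)) ` G"
      then obtain h where h: "(r, h) \<in> G" "u = h y \<one>"
        by auto
      note hC = GD(2)[OF h(1)] and rR = GD(1)[OF h(1)]
      show "r \<in> carrier (ring_module R)" "u \<noteq> 0"
        using rR char_moduleD(1)[OF hC] h by auto
      have "h y (\<ominus> \<one>) * h y \<one> = 1"
        using char_moduleD(3)[OF hC, of "\<ominus> \<one>" \<one> y] char_module_zero_arg[OF hC] by (simp add: l_neg)
      then have "inverse u = ((\<ominus> \<one>) \<odot>\<^bsub>?C\<^esub> h) y \<one>"
        using h(2) by (simp add: char_module_ops inverse_unique mult.commute)
      then show "(\<ominus>\<^bsub>ring_module R\<^esub> r, inverse u) \<in> (\<lambda>(r, h). (r, h y \<one>)) ` G"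
        using GD(5)[OF _ h(1), of "\<ominus> \<one>"] rR
        by (intro image_eqI[of _ _ "(\<ominus> r, (\<ominus> \<one>) \<odot>\<^bsub>?C\<^esub> h)"]) (auto simp: Aneg l_minus)
      fix r' u' assume "(r', u') \<in> (\<lambda>(r, h). (r, h y \<one>)) ` G"
      then obtain h' where h': "(r', h') \<in> G" "u' = h' y \<one>"
        by auto
      show "(r \<oplus>\<^bsub>ring_module R\<^esub> r', u * u') \<in> (\<lambda>(r, h). (r, h y \<one>)) ` G"
        using GD(4)[OF h(1) h'(1)] h(2) h'(2)
        by (intro image_eqI[of _ _ "(r \<oplus> r', h \<oplus>\<^bsub>?C\<^esub> h')"]) (auto simp: char_module_ops)
    next
      show "u = 1" if "(\<zero>\<^bsub>ring_module R\<^esub>, u) \<in> (\<lambda>(r, h). (r, h y \<one>)) ` G" for u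
        using that GD(6) by (auto simp: char_module_ops)
    qed (rule that)
    have "\<chi> r = h y \<one>" if "(r, h) \<in> G" for r h
      by (rule \<chi>(2)) (rule image_eqI[OF _ that], simp)
    then show ?thesis
      using \<chi>(1) by auto
  qed
  define \<chi> where "\<chi> y = (SOME \<chi>. A.group_char \<chi> \<and> (\<forall>(r, h)\<in>G. \<chi> r = h y \<one>))" for y
  have \<chi>: "A.group_char (\<chi> y)" "(r, h) \<in> G \<Longrightarrow> \<chi> y r = h y \<one>" for y r h
    using someI_ex[OF ex[of y]] unfolding \<chi>_def[symmetric] by auto
  define e where "e y r = (if r \<in> carrier R then \<chi> y r else 1)" for y r
  have e: "e \<in> carrier ?C"
    by (rule char_moduleI) (use \<chi>(1) in \<open>auto simp: e_def A.group_char_def\<close>)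
  have "h = r \<odot>\<^bsub>?C\<^esub> e" if rh: "(r, h) \<in> G" for r h
  proof (intro ext)
    fix y s
    show "h y s = (r \<odot>\<^bsub>?C\<^esub> e) y s"
    proof (cases "s \<in> carrier R")
      case True
      \<comment> \<open>The value of \<open>h\<close> at \<open>s\<close> is the value of its
        multiple by \<open>s\<close> at one. So the values at one, known for all pairs of the graph,
        determine \<open>h\<close> completely.\<close>
      have "\<chi> y (s \<otimes> r) = (s \<odot>\<^bsub>?C\<^esub> h) y \<one>"
        by (rule \<chi>(2)[OF GD(5)[OF True rh]])
      then show ?thesis
        using True GD(1)[OF rh] by (simp add: char_module_ops e_def)
    next
      case False
      then show ?thesis
        using char_moduleD(2)[OF GD(2)[OF rh]] by (simp add: char_module_ops)
    qed
  qed
  then show "\<exists>e\<in>carrier ?C. \<forall>(r, h)\<in>G. h = r \<odot>\<^bsub>?C\<^esub> e"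
    using e by (intro bexI[of _ e]) auto
qed

text \<open>The index set is the carrier type of Y itself: the component with index \<open>y\<close>
  uses a character that is nontrivial at \<open>y\<close>. Two elements with equal images are then
  not separated at the index given by their difference, which must be zero.\<close>

lemma embed_char_module:
  fixes Y :: "('a, 'y) module"
  assumes "module R Y"
  obtains \<theta> where "mod_hom R Y (char_module R :: ('a, 'y \<Rightarrow> 'a \<Rightarrow> complex) module) \<theta>"
    "inj_on \<theta> (carrier Y)"
proof -
  interpret Y: plain_module R Y by (rule plain_moduleI) fact
  let ?C = "char_module R :: ('a, 'y \<Rightarrow> 'a \<Rightarrow> complex) module"
  have ex: "\<exists>\<chi>. Y.group_char \<chi> \<and> (y \<in> carrier Y \<longrightarrow> y \<noteq> \<zero>\<^bsub>Y\<^esub> \<longrightarrow> \<chi> y \<noteq> 1)" for y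
  proof (cases "y \<in> carrier Y \<and> y \<noteq> \<zero>\<^bsub>Y\<^esub>")
    case True
    then show ?thesis
      using Y.group_char_separates by metis
  next
    case False
    then show ?thesis
      by (intro exI[of _ "\<lambda>_. 1"]) (auto simp: Y.group_char_def)
  qed
  define \<chi> where "\<chi> y = (SOME \<chi>. Y.group_char \<chi> \<and> (y \<in> carrier Y \<longrightarrow> y \<noteq> \<zero>\<^bsub>Y\<^esub> \<longrightarrow> \<chi> y \<noteq> 1))" for y
  have \<chi>: "Y.group_char (\<chi> y)" "y \<in> carrier Y \<Longrightarrow> y \<noteq> \<zero>\<^bsub>Y\<^esub> \<Longrightarrow> \<chi> y y \<noteq> 1" for y
    using someI_ex[OF ex[of y]] unfolding \<chi>_def[symmetric] by auto
  have mult: "\<chi> y (x \<oplus>\<^bsub>Y\<^esub> z) = \<chi> y x * \<chi> y z" if "x \<in> carrier Y" "z \<in> carrier Y" for x y z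
    using \<chi>(1) that by (auto simp: Y.group_char_def)
  define \<theta> where "\<theta> z = (\<lambda>y r. if r \<in> carrier R then \<chi> y (r \<odot>\<^bsub>Y\<^esub> z) else 1)" for z
  have hom: "mod_hom R Y ?C \<theta>"
  proof (rule mod_homI)
    show "\<theta> z \<in> carrier ?C" if "z \<in> carrier Y" for z
      by (rule char_moduleI) (use \<chi>(1) that in \<open>auto simp: \<theta>_def Y.group_char_def Y.smult_l_distr\<close>)
    show "\<theta> (z \<oplus>\<^bsub>Y\<^esub> w) = \<theta> z \<oplus>\<^bsub>?C\<^esub> \<theta> w" if "z \<in> carrier Y" "w \<in> carrier Y" for z w
      using that by (intro ext) (auto simp: \<theta>_def char_module_ops mult Y.smult_r_distr)
    show "\<theta> (c \<odot>\<^bsub>Y\<^esub> z) = c \<odot>\<^bsub>?C\<^esub> \<theta> z" if "c \<in> carrier R" "z \<in> carrier Y" for c z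
      using that by (intro ext) (auto simp: \<theta>_def char_module_ops Y.smult_assoc1)
  qed
  have "inj_on \<theta> (carrier Y)"
  proof (rule inj_onI)
    fix z w assume zw: "z \<in> carrier Y" "w \<in> carrier Y" "\<theta> z = \<theta> w"
    have d: "z \<ominus>\<^bsub>Y\<^esub> w \<in> carrier Y"
      using zw by simp
    have "\<chi> y z = \<chi> y w" for y
      using fun_cong[OF fun_cong[OF zw(3)], of y \<one>] zw by (simp add: \<theta>_def)
    moreover have "\<chi> y ((z \<ominus>\<^bsub>Y\<^esub> w) \<oplus>\<^bsub>Y\<^esub> w) = \<chi> y (z \<ominus>\<^bsub>Y\<^esub> w) * \<chi> y w" for y
      by (rule mult[OF d zw(2)])
    ultimately have "\<chi> y (z \<ominus>\<^bsub>Y\<^esub> w) * \<chi> y w = \<chi> y w" for y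
      using Y.diff_add_cancel_left[OF zw(1,2)] by simp
    moreover have "\<chi> y w \<noteq> 0" for y
      using \<chi>(1) zw(2) by (auto simp: Y.group_char_def)
    ultimately have "\<chi> y (z \<ominus>\<^bsub>Y\<^esub> w) = 1" for y
      by simp
    then have "z \<ominus>\<^bsub>Y\<^esub> w = \<zero>\<^bsub>Y\<^esub>"
      using \<chi>(2)[OF d] by blast
    then show "z = w"
      using Y.minus_eq_zero_iff zw by blast
  qed
  with hom show thesis
    by (rule that)
qed

end

text \<open>Graphs are pulled back to E along the inverse of \<open>\<phi>\<close>, and the element
  found there is carried forward.\<close>

lemma baer_transport:
  assumes "cring R" "baer_module R E" and inj: "inj_on \<phi> (carrier E)"
  shows "baer_module R (transport_module \<phi> E)"
  unfolding baer_module_def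
proof (intro conjI allI impI)
  interpret R: cring R by fact
  have E: "module R E"
    using assms(2) by (simp add: baer_module_def)
  let ?T = "transport_module \<phi> E" and ?i = "inv_into (carrier E) \<phi>"
  show T: "module R ?T"
    by (rule transport_is_module[OF E inj])
  have i: "mod_hom R ?T E ?i"
    by (rule transport_inv_hom[OF E inj])
  fix G assume G: "lin_graph R (ring_module R) ?T G"
  note GD = lin_graphD[OF G]
  let ?G = "(\<lambda>(r, u). (r, ?i u)) ` G"
  have memI: "(r, ?i u) \<in> ?G" if "(r, u) \<in> G" for r u
    by (rule image_eqI[OF _ that]) simp
  have "lin_graph R (ring_module R) E ?G"
  proof (rule lin_graphI)
    show "(\<zero>\<^bsub>ring_module R\<^esub>, \<zero>\<^bsub>E\<^esub>) \<in> ?G"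
      using memI[OF GD(3)] mod_hom_zero[OF T E i] by simp
    fix r u assume "(r, u) \<in> ?G"
    then obtain v where v: "(r, v) \<in> G" "u = ?i v"
      by auto
    show "r \<in> carrier (ring_module R)" "u \<in> carrier E"
      using GD(1)[OF v(1)] mod_hom_closed[OF i GD(2)[OF v(1)]] v by auto
    show "(s \<odot>\<^bsub>ring_module R\<^esub> r, s \<odot>\<^bsub>E\<^esub> u) \<in> ?G" if "s \<in> carrier R" for s
      using memI[OF GD(5)[OF that v(1)]] mod_hom_smult[OF i that GD(2)[OF v(1)]] v(2) by simp
    fix r' u' assume "(r', u') \<in> ?G"
    then obtain v' where v': "(r', v') \<in> G" "u' = ?i v'"
      by auto
    show "(r \<oplus>\<^bsub>ring_module R\<^esub> r', u \<oplus>\<^bsub>E\<^esub> u') \<in> ?G"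
      using memI[OF GD(4)[OF v(1) v'(1)]] mod_hom_add[OF i GD(2)[OF v(1)] GD(2)[OF v'(1)]] v(2) v'(2)
      by simp
  next
    fix u assume "(\<zero>\<^bsub>ring_module R\<^esub>, u) \<in> ?G"
    then show "u = \<zero>\<^bsub>E\<^esub>"
      using GD(6) mod_hom_zero[OF T E i] by auto
  qed
  then obtain e where e: "e \<in> carrier E" "\<forall>(r, u)\<in>?G. u = r \<odot>\<^bsub>E\<^esub> e"
    using assms(2) unfolding baer_module_def by meson
  have "u = r \<odot>\<^bsub>?T\<^esub> \<phi> e" if ru: "(r, u) \<in> G" for r u
  proof -
    have "?i u = r \<odot>\<^bsub>E\<^esub> e"
      using e(2) memI[OF ru] by auto
    moreover have "\<phi> (?i u) = u"
      using GD(2)[OF ru] by (auto intro: f_inv_into_f)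
    ultimately show ?thesis
      using transport_smult[OF inj e(1)] by metis
  qed
  then show "\<exists>e\<in>carrier ?T. \<forall>(r, u)\<in>G. u = r \<odot>\<^bsub>?T\<^esub> e"
    using e(1) by (intro bexI[of _ "\<phi> e"]) auto
qed

section \<open>A small Baer submodule\<close>

text \<open>Reading a set of words letter by letter identifies \<open>'c list set\<close>, up to the empty word, with
  the functions \<open>'c \<Rightarrow> 'c list set\<close>; this replaces the cardinal arithmetic.\<close>

definition component :: "'c list set \<Rightarrow> 'c \<Rightarrow> 'c list set"
  where "component s c = {w. c # w \<in> s}"

lemma component_surj: "\<exists>s. component s = F"
  by (rule exI[of _ "{c # w | c w. w \<in> F c}"]) (auto simp: component_def)

text \<open>A Skolem function for linear systems in one unknown. The implication under
  \<open>SOME\<close> makes it total: the result lies in the carrier in any case, and it is a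
  solution whenever there is one.\<close>

definition solve :: "('a, 'e) module \<Rightarrow> 'a set \<Rightarrow> ('a \<Rightarrow> 'e) \<Rightarrow> 'e"
  where "solve E B g = (SOME e. e \<in> carrier E \<and>
    ((\<exists>e\<in>carrier E. \<forall>r\<in>B. g r = r \<odot>\<^bsub>E\<^esub> e) \<longrightarrow> (\<forall>r\<in>B. g r = r \<odot>\<^bsub>E\<^esub> e)))"

lemma solve:
  assumes "carrier E \<noteq> {}"
  shows "solve E B g \<in> carrier E"
    "(\<exists>e\<in>carrier E. \<forall>r\<in>B. g r = r \<odot>\<^bsub>E\<^esub> e) \<Longrightarrow> r \<in> B \<Longrightarrow> g r = r \<odot>\<^bsub>E\<^esub> solve E B g"
proof -
  have "\<exists>e. e \<in> carrier E \<and> ((\<exists>e\<in>carrier E. \<forall>r\<in>B. g r = r \<odot>\<^bsub>E\<^esub> e) \<longrightarrow> (\<forall>r\<in>B. g r = r \<odot>\<^bsub>E\<^esub> e))"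
    using assms by blast
  from someI_ex[OF this]
  show "solve E B g \<in> carrier E"
    "(\<exists>e\<in>carrier E. \<forall>r\<in>B. g r = r \<odot>\<^bsub>E\<^esub> e) \<Longrightarrow> r \<in> B \<Longrightarrow> g r = r \<odot>\<^bsub>E\<^esub> solve E B g"
    unfolding solve_def[symmetric] by blast+
qed

lemma solve_cong: "(\<And>r. r \<in> B \<Longrightarrow> g r = h r) \<Longrightarrow> solve E B g = solve E B h"
  unfolding solve_def by (simp cong: ball_cong)

abbreviation letter :: "nat \<Rightarrow> 'a + 'x + nat"
  where "letter n \<equiv> Inr (Inr n)"

text \<open>Each code is read as a family of codes, one per letter. Letter 2 selects the operation:
  empty for addition, just the empty word (with scalars present) for scalar multiplication, and
  every other case for a linear system. Letters 0 and 1 hold operands, letter 3 the scalars or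
  coefficients, and the letters \<open>Inl r\<close> the prescribed values. All stages are thus
  indexed by one type, which bounds their size.\<close>

primrec stage ::
  "('a, 'r) ring_scheme \<Rightarrow> ('a, 'e) module \<Rightarrow> (('a, 'x) res \<Rightarrow> 'e) \<Rightarrow> nat \<Rightarrow> ('a, 'x) res \<Rightarrow> 'e"
  where
    "stage R E \<pi> 0 = \<pi>"
  | "stage R E \<pi> (Suc n) = (\<lambda>s.
      let F = component s; x = stage R E \<pi> n (F (letter 0)); y = stage R E \<pi> n (F (letter 1));
        B = {r \<in> carrier R. [Inl r] \<in> F (letter 3)}
      in if F (letter 2) = {} then x \<oplus>\<^bsub>E\<^esub> y
        else if F (letter 2) = {[]} \<and> B \<noteq> {} then (SOME r. r \<in> B) \<odot>\<^bsub>E\<^esub> x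
        else solve E B (\<lambda>r. stage R E \<pi> n (F (Inl r))))"

context plain_module
begin

lemma stage_closed:
  assumes "range \<pi> \<subseteq> carrier M"
  shows "stage R M \<pi> n s \<in> carrier M"
proof (induct n arbitrary: s)
  case (Suc n)
  let ?B = "{r \<in> carrier R. [Inl r] \<in> component s (letter 3)}"
  have B: "(SOME r. r \<in> ?B) \<in> carrier R" if "?B \<noteq> {}"
  proof -
    have "(SOME r. r \<in> ?B) \<in> ?B"
      using that by (rule some_in_eq[THEN iffD2])
    then show ?thesis
      by blast
  qed
  have "carrier M \<noteq> {}"
    by auto
  then show ?case
    unfolding stage.simps Let_def using Suc B by (simp only: split: if_split) (simp add: solve(1))
qed (use assms in auto)

lemma stage_add:
  "\<exists>s. stage R M \<pi> (Suc n) s = stage R M \<pi> n s1 \<oplus>\<^bsub>M\<^esub> stage R M \<pi> n s2"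
proof -
  obtain s where s: "component s = (\<lambda>_. {})(letter 0 := s1, letter 1 := s2)"
    using component_surj by blast
  show ?thesis
    by (rule exI[of _ s]) (simp add: Let_def s)
qed

lemma stage_smult:
  assumes "r \<in> carrier R"
  shows "\<exists>s. stage R M \<pi> (Suc n) s = r \<odot>\<^bsub>M\<^esub> stage R M \<pi> n s1"
proof -
  obtain s where s: "component s = (\<lambda>_. {})(letter 0 := s1, letter 2 := {[]}, letter 3 := {[Inl r]})"
    using component_surj by blast
  have "{q \<in> carrier R. [Inl q] \<in> component s (letter 3)} = {r}"
    using assms by (auto simp: s)
  then show ?thesis
    by (intro exI[of _ s]) (simp add: Let_def s)
qed

lemma stage_solve:
  assumes "\<And>r. r \<in> B \<Longrightarrow> g r \<in> range (stage R M \<pi> n)" "B \<subseteq> carrier R"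
  shows "\<exists>s. stage R M \<pi> (Suc n) s = solve M B g"
proof -
  define h where "h r = inv_into UNIV (stage R M \<pi> n) (g r)" for r
  have h: "stage R M \<pi> n (h r) = g r" if "r \<in> B" for r
    unfolding h_def using assms(1)[OF that] by (rule f_inv_into_f)
  \<comment> \<open>At letter 2 any set other than \<open>{}\<close> and \<open>{[]}\<close> selects
    the linear system.\<close>
  obtain s where s: "component s = (case_sum h (\<lambda>_. {}))
      (letter 2 := {[letter 0]}, letter 3 := {[Inl r] | r. r \<in> B})"
    using component_surj by blast
  have B: "{q \<in> carrier R. [Inl q] \<in> component s (letter 3)} = B"
    using assms(2) by (auto simp: s)
  have "solve M B (\<lambda>r. stage R M \<pi> n (component s (Inl r))) = solve M B g"
    by (rule solve_cong) (simp add: s h)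
  then have "stage R M \<pi> (Suc n) s = solve M B g"
    unfolding stage.simps Let_def B by (simp add: s)
  then show ?thesis ..
qed

text \<open>A downward Loewenheim-Skolem argument: the closure of the range of \<open>\<pi>\<close> under the module
  operations and under chosen solutions of solvable systems \<open>r \<odot> e = g r\<close> is reached after \<open>\<omega>\<close>
  stages because ideals are finitely generated.\<close>

theorem small_baer_submodule:
  fixes \<pi> :: "('a, 'x) res \<Rightarrow> 'm"
  assumes "noetherian_ring R" and baer: "baer_module R M" and \<pi>: "range \<pi> \<subseteq> carrier M"
  obtains S and \<psi> :: "('a, 'x) res \<Rightarrow> 'm" where
    "submodule S R M" "range \<pi> \<subseteq> S" "baer_module R (M\<lparr>carrier := S\<rparr>)" "S \<subseteq> range \<psi>"
proof -
  interpret N: noetherian_ring R by fact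
  let ?st = "stage R M \<pi>"
  define S where "S = (\<Union>n. range (?st n))"
  have SI: "x \<in> S" if "\<exists>s. ?st n s = x" for n x
    using that by (auto simp: S_def)
  have mono: "range (?st m) \<subseteq> range (?st n)" if "m \<le> n" for m n
  proof (rule lift_Suc_mono_le[OF _ that])
    fix n
    show "range (?st n) \<subseteq> range (?st (Suc n))"
    proof
      fix x assume "x \<in> range (?st n)"
      then obtain s where s: "x = ?st n s"
        by auto
      \<comment> \<open>Multiplication by one repeats every element at the next stage, so the stages
        increase.\<close>
      then have "\<exists>s'. ?st (Suc n) s' = x"
        using stage_smult[OF R.one_closed, of \<pi> n s] stage_closed[OF \<pi>, of n s] by simp
      then show "x \<in> range (?st (Suc n))"
        by (metis rangeI)
    qed
  qed
  have sub: "submodule S R M"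
  proof (rule submodule_minusI)
    show SM: "S \<subseteq> carrier M"
      using stage_closed[OF \<pi>] by (auto simp: S_def)
    show smult: "a \<odot>\<^bsub>M\<^esub> x \<in> S" if a: "a \<in> carrier R" and x: "x \<in> S" for a x
    proof -
      obtain n s where "x = ?st n s"
        using x by (auto simp: S_def)
      then show ?thesis
        using SI[OF stage_smult[OF a]] by metis
    qed
    have "?st 0 {} \<in> S"
      using SI by blast
    from smult[OF R.zero_closed this] show "\<zero>\<^bsub>M\<^esub> \<in> S"
      using stage_closed[OF \<pi>, of 0 "{}"] by simp
    show "x \<oplus>\<^bsub>M\<^esub> y \<in> S" if xy: "x \<in> S" "y \<in> S" for x y
    proof -
      obtain m n where "x \<in> range (?st m)" "y \<in> range (?st n)"
        using xy by (auto simp: S_def)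
      then have "x \<in> range (?st (max m n))" "y \<in> range (?st (max m n))"
        using mono[of m "max m n"] mono[of n "max m n"] by auto
      then obtain s1 s2 where "x = ?st (max m n) s1" "y = ?st (max m n) s2"
        by auto
      then show ?thesis
        using SI[OF stage_add] by metis
    qed
  qed
  let ?S = "M\<lparr>carrier := S\<rparr>" and ?A = "ring_module R"
  interpret A: plain_module R ?A by (rule plain_moduleI) (rule R.ring_module_is_module)
  have S: "module R ?S"
    by (rule submodule.submodule_is_module[OF sub module_axioms])
  have "baer_module R ?S"
    unfolding baer_module_def
  proof (intro conjI allI impI)
    fix G assume G: "lin_graph R ?A ?S G"
    note GD = lin_graphD[OF G, simplified]
    have SM: "S \<subseteq> carrier M"
      by (rule submoduleE(1)[OF sub])
    have GM: "lin_graph R ?A M G"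
      by (rule lin_graphI) (auto intro: GD(1,3,4,5,6) subsetD[OF SM GD(2)])
    note uniq = lin_graph_unique[OF A.module_axioms module_axioms GM]
    have D: "ideal (Domain G) R"
      by (rule R.ideal_of_submodule[OF lin_graph_domain[OF A.module_axioms GM]])
    obtain B where B: "B \<subseteq> carrier R" "finite B" "Domain G = Idl B"
      using N.finetely_gen[OF D] by auto
    have BD: "B \<subseteq> Domain G"
      using R.genideal_self[OF B(1)] B(3) by simp
    define g where "g r = (THE u. (r, u) \<in> G)" for r
    have g: "g r = u" if "(r, u) \<in> G" for r u
      unfolding g_def using that uniq by blast
    have gG: "(r, g r) \<in> G" if "r \<in> Domain G" for r
      using that g by auto
    \<comment> \<open>The finitely many values at the generators occur at one common stage, so the
      system they define is solved at the next.\<close>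
    have "\<exists>n. g ` B \<subseteq> range (?st n)"
    proof (rule finite_subset_of_chain)
      fix a assume "a \<in> g ` B"
      then have "a \<in> S"
        using GD(2)[OF gG] BD by blast
      then show "\<exists>n. a \<in> range (?st n)"
        unfolding S_def by blast
    next
    qed (use B(2) mono in auto)
    then obtain n where n: "g ` B \<subseteq> range (?st n)" ..
    let ?e = "solve M B g"
    obtain e where e: "e \<in> carrier M" "\<forall>(r, u)\<in>G. u = r \<odot>\<^bsub>M\<^esub> e"
      using baer GM unfolding baer_module_def by meson
    have ne: "carrier M \<noteq> {}"
      by auto
    have "\<exists>e\<in>carrier M. \<forall>r\<in>B. g r = r \<odot>\<^bsub>M\<^esub> e"
    proof (intro bexI[OF _ e(1)] ballI)
      fix r assume "r \<in> B"
      then have "(r, g r) \<in> G"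
        using gG BD by blast
      then show "g r = r \<odot>\<^bsub>M\<^esub> e"
        using e(2) by blast
    qed
    note solv = solve(2)[OF ne this]
    have eS: "?e \<in> S"
      by (rule SI[OF stage_solve]) (use n B(1) in auto)
    have eM: "?e \<in> carrier M"
      by (rule solve(1)[OF ne])
    \<comment> \<open>The chosen solution is known to work only on the generators B. The elements on
      which it works form an ideal, which therefore is the whole domain.\<close>
    have "ideal {r \<in> Domain G. g r = r \<odot>\<^bsub>M\<^esub> ?e} R"
    proof (rule R.ideal_of_submodule, rule A.submodule_minusI)
      show "{r \<in> Domain G. g r = r \<odot>\<^bsub>M\<^esub> ?e} \<subseteq> carrier ?A"
        using GD(1) by auto
      show "\<zero>\<^bsub>?A\<^esub> \<in> {r \<in> Domain G. g r = r \<odot>\<^bsub>M\<^esub> ?e}"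
        using GD(3) g[OF GD(3)] eM by auto
      fix x assume x: "x \<in> {r \<in> Domain G. g r = r \<odot>\<^bsub>M\<^esub> ?e}"
      then have xG: "(x, g x) \<in> G"
        using gG[of x] by blast
      then have xR: "x \<in> carrier R"
        by (rule GD(1))
      show "r \<odot>\<^bsub>?A\<^esub> x \<in> {r \<in> Domain G. g r = r \<odot>\<^bsub>M\<^esub> ?e}" if r: "r \<in> carrier R" for r
      proof -
        have rx: "(r \<otimes> x, r \<odot>\<^bsub>M\<^esub> g x) \<in> G"
          by (rule GD(5)[OF r xG])
        show ?thesis
          using DomainI[OF rx] g[OF rx] x r xR eM by (simp add: smult_assoc1)
      qed
      fix y assume y: "y \<in> {r \<in> Domain G. g r = r \<odot>\<^bsub>M\<^esub> ?e}"
      then have yG: "(y, g y) \<in> G"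
        using gG[of y] by blast
      then have yR: "y \<in> carrier R"
        by (rule GD(1))
      have xy: "(x \<oplus> y, g x \<oplus>\<^bsub>M\<^esub> g y) \<in> G"
        by (rule GD(4)[OF xG yG])
      show "x \<oplus>\<^bsub>?A\<^esub> y \<in> {r \<in> Domain G. g r = r \<odot>\<^bsub>M\<^esub> ?e}"
        using DomainI[OF xy] g[OF xy] x y xR yR eM by (simp add: smult_l_distr)
    qed
    moreover have "B \<subseteq> {r \<in> Domain G. g r = r \<odot>\<^bsub>M\<^esub> ?e}"
      using BD solv by auto
    ultimately have "Domain G \<subseteq> {r \<in> Domain G. g r = r \<odot>\<^bsub>M\<^esub> ?e}"
      unfolding B(3) by (rule R.genideal_minimal)
    then have "u = r \<odot>\<^bsub>M\<^esub> ?e" if "(r, u) \<in> G" for r u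
      using that g[OF that] by auto
    then show "\<exists>e\<in>carrier ?S. \<forall>(r, u)\<in>G. u = r \<odot>\<^bsub>?S\<^esub> e"
      using eS by (intro bexI[of _ ?e]) auto
  qed (rule S)
  moreover have "range \<pi> \<subseteq> S"
    using SI[of 0] by auto
  \<comment> \<open>One code holds both the number of a stage and a code for that stage, so the
    countable union of stages is still indexed by the same type.\<close>
  moreover define \<psi> where "\<psi> s = ?st (SOME n. [letter n] \<in> component s (letter 1)) (component s (letter 0))"
    for s :: "('a, 'x) res"
  have "S \<subseteq> range \<psi>"
  proof
    fix x assume "x \<in> S"
    then obtain n t where x: "x = ?st n t"
      by (auto simp: S_def)
    obtain s where s: "component s = (\<lambda>_. {})(letter 0 := t, letter 1 := {[letter n]})"
      using component_surj by blast
    have "\<psi> s = x"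
      by (simp add: \<psi>_def s x)
    then show "x \<in> range \<psi>"
      by auto
  qed
  ultimately show thesis
    using sub by (intro that)
qed

end

section \<open>Existence of injective resolutions\<close>

text \<open>The character module over Y is too large for the type. A small Baer submodule containing
  the image of Y is the image of a set of codes, so a right inverse of the enumeration moves it
  back.\<close>

lemma embed_baer_res:
  fixes Y :: "('a, ('a, 'x) res) module"
  assumes "noetherian_ring R" "module R Y"
  shows "\<exists>(E :: ('a, ('a, 'x) res) module) \<epsilon>.
    baer_module R E \<and> mod_hom R Y E \<epsilon> \<and> inj_on \<epsilon> (carrier Y)"
proof -
  interpret Y: plain_module R Y by (rule plain_moduleI) fact
  let ?C = "char_module R :: ('a, ('a, 'x) res \<Rightarrow> 'a \<Rightarrow> complex) module"
  interpret C: plain_module R ?C by (rule plain_moduleI) (rule Y.R.char_module_is_module)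
  obtain \<theta> where \<theta>: "mod_hom R Y ?C \<theta>" "inj_on \<theta> (carrier Y)"
    by (rule Y.R.embed_char_module[OF assms(2)])
  \<comment> \<open>The embedding of Y, extended by zero to all codes so that it can start the
    stages.\<close>
  define \<pi> where "\<pi> s = (if s \<in> carrier Y then \<theta> s else \<zero>\<^bsub>?C\<^esub>)" for s
  have "range \<pi> \<subseteq> carrier ?C"
    using mod_hom_closed[OF \<theta>(1)] C.M.zero_closed by (auto simp: \<pi>_def)
  then obtain S and \<psi> :: "('a, 'x) res \<Rightarrow> _" where S: "submodule S R ?C" "range \<pi> \<subseteq> S"
    "baer_module R (?C\<lparr>carrier := S\<rparr>)" "S \<subseteq> range \<psi>"
    by (rule C.small_baer_submodule[OF assms(1) Y.R.baer_char_module])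
  let ?S = "?C\<lparr>carrier := S\<rparr>"
  have inj: "inj_on (inv_into UNIV \<psi>) (carrier ?S)"
    using inj_on_inv_into[OF S(4)] by simp
  have "\<theta> y \<in> S" if "y \<in> carrier Y" for y
    using S(2) that by (auto simp: \<pi>_def dest!: subsetD[OF _ rangeI[of _ y]])
  then have hom: "mod_hom R Y ?S \<theta>"
    using \<theta>(1) by (auto simp: mod_hom_def)
  have "mod_hom R Y (transport_module (inv_into UNIV \<psi>) ?S) (\<lambda>y. inv_into UNIV \<psi> (\<theta> y))"
    by (rule mod_hom_comp[OF hom transport_hom[OF inj]])
  moreover have "inj_on (\<lambda>y. inv_into UNIV \<psi> (\<theta> y)) (carrier Y)"
  proof (rule inj_onI)
    fix y z assume yz: "y \<in> carrier Y" "z \<in> carrier Y" "inv_into UNIV \<psi> (\<theta> y) = inv_into UNIV \<psi> (\<theta> z)"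
    then have "\<theta> y = \<theta> z"
      using inj_onD[OF inj] mod_hom_closed[OF hom] by blast
    then show "y = z"
      using inj_onD[OF \<theta>(2)] yz by blast
  qed
  moreover have "baer_module R (transport_module (inv_into UNIV \<psi>) ?S)"
    by (rule baer_transport[OF Y.R.is_cring S(3) inj])
  ultimately show ?thesis
    by blast
qed

lemma (in plain_module) diff_zero: "x \<in> carrier M \<Longrightarrow> x \<ominus>\<^bsub>M\<^esub> \<zero>\<^bsub>M\<^esub> = x"
  using diff_diff_left[of x x] minus_eq_zero_iff[of x x] by simp

text \<open>Replacing each coset by a chosen representative keeps the quotient on the type
  \<open>'i\<close> instead of \<open>'i set\<close>. Otherwise the types would grow along the
  resolution.\<close>

lemma cokernel_in_type:
  fixes E :: "('a, 'i) module"
  assumes "module R E" "submodule N R E"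
  shows "\<exists>(Z :: ('a, 'i) module) \<kappa>. module R Z \<and> mod_hom R E Z \<kappa> \<and> \<kappa> ` carrier E = carrier Z \<and>
    {x \<in> carrier E. \<kappa> x = \<zero>\<^bsub>Z\<^esub>} = N"
proof -
  interpret E: plain_module R E by (rule plain_moduleI) fact
  let ?Q = "quot_module E N"
  interpret Q: plain_module R ?Q by (rule plain_moduleI) (rule E.quot_module_is_module[OF assms(2)])
  define \<tau> :: "'i set \<Rightarrow> 'i" where "\<tau> A = (SOME x. x \<in> A)" for A
  have "N +>\<^bsub>E\<^esub> \<tau> (N +>\<^bsub>E\<^esub> x) = N +>\<^bsub>E\<^esub> x" if "x \<in> carrier E" for x
    unfolding \<tau>_def by (rule E.coset_memD(2)[OF assms(2) that])
      (rule someI[of "\<lambda>x. x \<in> _", OF E.self_in_coset[OF assms(2) that]])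
  then have "N +>\<^bsub>E\<^esub> \<tau> A = A" if "A \<in> carrier ?Q" for A
    using that by (auto simp: E.quot_carrier)
  then have inj: "inj_on \<tau> (carrier ?Q)"
    by (rule inj_on_inverseI)
  let ?Z = "transport_module \<tau> ?Q" and ?\<kappa> = "\<lambda>x. \<tau> (N +>\<^bsub>E\<^esub> x)"
  have "module R ?Z"
    by (rule transport_is_module[OF Q.module_axioms inj])
  moreover have "mod_hom R E ?Z ?\<kappa>"
    by (rule mod_hom_comp[OF E.quot_proj_hom[OF assms(2)] transport_hom[OF inj]])
  moreover have "?\<kappa> ` carrier E = carrier ?Z"
    by (simp add: E.quot_carrier image_image)
  moreover have "?\<kappa> x = \<zero>\<^bsub>?Z\<^esub> \<longleftrightarrow> x \<in> N" if x: "x \<in> carrier E" for x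
  proof -
    have "?\<kappa> x = \<zero>\<^bsub>?Z\<^esub> \<longleftrightarrow> N +>\<^bsub>E\<^esub> x = \<zero>\<^bsub>?Q\<^esub>"
      using inj_on_eq_iff[OF inj _ Q.M.zero_closed, of "N +>\<^bsub>E\<^esub> x"] x
      by (simp add: transport_zero E.quot_carrier)
    also have "\<dots> \<longleftrightarrow> N +>\<^bsub>E\<^esub> x = N +>\<^bsub>E\<^esub> \<zero>\<^bsub>E\<^esub>"
      by (simp only: E.quot_zero[OF assms(2)])
    also have "\<dots> \<longleftrightarrow> x \<in> N"
      using E.coset_eq_iff[OF assms(2) x E.M.zero_closed] x by (simp add: E.diff_zero)
    finally show ?thesis .
  qed
  then have "{x \<in> carrier E. ?\<kappa> x = \<zero>\<^bsub>?Z\<^esub>} = N"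
    using E.submoduleE(1)[OF assms(2)] by auto
  ultimately show ?thesis
    by (intro exI[of _ ?Z] exI[of _ ?\<kappa>]) simp
qed

theorem injective_resolution_exists:
  fixes X :: "('a, 'x) module"
  assumes "noetherian_ring R" "module R X"
  shows "\<exists>(E :: nat \<Rightarrow> ('a, ('a, 'x) res) module) d \<epsilon>. injective_resolution R X E d \<epsilon>"
proof -
  \<comment> \<open>The condition on Y stands inside the existential quantifiers, so that the axiom
    of choice yields functions defined on all records of this type.\<close>
  have step: "\<forall>Y :: ('a, ('a, 'x) res) module. \<exists>(E :: ('a, ('a, 'x) res) module) \<epsilon> (Z :: ('a, ('a, 'x) res) module) \<kappa>.
      module R Y \<longrightarrow> baer_module R E \<and> mod_hom R Y E \<epsilon> \<and> inj_on \<epsilon> (carrier Y) \<and> module R Z \<and>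
        mod_hom R E Z \<kappa> \<and> \<kappa> ` carrier E = carrier Z \<and>
        {x \<in> carrier E. \<kappa> x = \<zero>\<^bsub>Z\<^esub>} = \<epsilon> ` carrier Y"
  proof
    fix Y :: "('a, ('a, 'x) res) module"
    show "\<exists>(E :: ('a, ('a, 'x) res) module) \<epsilon> (Z :: ('a, ('a, 'x) res) module) \<kappa>.
      module R Y \<longrightarrow> baer_module R E \<and> mod_hom R Y E \<epsilon> \<and> inj_on \<epsilon> (carrier Y) \<and> module R Z \<and>
        mod_hom R E Z \<kappa> \<and> \<kappa> ` carrier E = carrier Z \<and>
        {x \<in> carrier E. \<kappa> x = \<zero>\<^bsub>Z\<^esub>} = \<epsilon> ` carrier Y"
    proof (cases "module R Y")
      case True
      obtain E :: "('a, ('a, 'x) res) module" and \<epsilon> where E: "baer_module R E" "mod_hom R Y E \<epsilon>"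
        "inj_on \<epsilon> (carrier Y)"
        using embed_baer_res[OF assms(1) True] by blast
      have modE: "module R E"
        using E(1) by (simp add: baer_module_def)
      from cokernel_in_type[OF modE submodule_image[OF True modE E(2)]]
      obtain Z :: "('a, ('a, 'x) res) module" and \<kappa> where "module R Z \<and> mod_hom R E Z \<kappa> \<and>
        \<kappa> ` carrier E = carrier Z \<and> {x \<in> carrier E. \<kappa> x = \<zero>\<^bsub>Z\<^esub>} = \<epsilon> ` carrier Y"
        by (elim exE) (rule that)
      with E show ?thesis
        by (intro exI[of _ E] exI[of _ \<epsilon>] exI[of _ Z] exI[of _ \<kappa>]) simp
    qed simp
  qed
  obtain Q :: "('a, ('a, 'x) res) module \<Rightarrow> ('a, ('a, 'x) res) module" and \<epsilon>
    and Z :: "('a, ('a, 'x) res) module \<Rightarrow> ('a, ('a, 'x) res) module" and \<kappa> where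
    step: "\<And>Y. module R Y \<Longrightarrow> baer_module R (Q Y) \<and> mod_hom R Y (Q Y) (\<epsilon> Y) \<and>
        inj_on (\<epsilon> Y) (carrier Y) \<and> module R (Z Y) \<and> mod_hom R (Q Y) (Z Y) (\<kappa> Y) \<and>
        \<kappa> Y ` carrier (Q Y) = carrier (Z Y) \<and>
        {x \<in> carrier (Q Y). \<kappa> Y x = \<zero>\<^bsub>Z Y\<^esub>} = \<epsilon> Y ` carrier Y"
    using choice[OF step] by (elim exE) (drule choice, elim exE, drule choice, elim exE,
      drule choice, elim exE, rule that, drule spec, erule mp)
  \<comment> \<open>X starts on its own type \<open>'x\<close>; singleton sets of one-letter words
    place it among the codes, where the iteration runs.\<close>
  define \<iota> :: "'x \<Rightarrow> ('a, 'x) res" where "\<iota> x = {[Inr (Inl x)]}" for x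
  have inj: "inj_on \<iota> (carrier X)"
    by (auto simp: \<iota>_def inj_on_def)
  define Y where "Y = rec_nat (transport_module \<iota> X) (\<lambda>_. Z)"
  have Y_simps: "Y 0 = transport_module \<iota> X" "Y (Suc n) = Z (Y n)" for n
    by (simp_all add: Y_def)
  have modY: "module R (Y n)" for n
    by (induct n) (use step in \<open>auto simp: Y_simps transport_is_module[OF assms(2) inj]\<close>)
  note st = step[OF modY]
  have baer: "baer_module R (Q (Y n))"
    and \<epsilon>: "mod_hom R (Y n) (Q (Y n)) (\<epsilon> (Y n))" "inj_on (\<epsilon> (Y n)) (carrier (Y n))"
    and \<kappa>: "mod_hom R (Q (Y n)) (Y (Suc n)) (\<kappa> (Y n))"
      "\<kappa> (Y n) ` carrier (Q (Y n)) = carrier (Y (Suc n))"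
      "{x \<in> carrier (Q (Y n)). \<kappa> (Y n) x = \<zero>\<^bsub>Y (Suc n)\<^esub>} = \<epsilon> (Y n) ` carrier (Y n)" for n
    using st[of n] by (simp_all add: Y_simps)
  have modE: "module R (Q (Y n))" for n
    using baer by (simp add: baer_module_def)
  \<comment> \<open>Projection onto the cokernel followed by its embedding in the next module. The
    image is therefore the embedded cokernel, and this is also the next kernel.\<close>
  define d where "d n x = \<epsilon> (Y (Suc n)) (\<kappa> (Y n) x)" for n x
  have d: "mod_hom R (Q (Y n)) (Q (Y (Suc n))) (d n)" for n
    unfolding d_def by (rule mod_hom_comp[OF \<kappa>(1) \<epsilon>(1)])
  have ker: "a_kernel (Q (Y n)) (Q (Y (Suc n))) (d n) = \<epsilon> (Y n) ` carrier (Y n)" for n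
  proof -
    interpret Z: plain_module R "Y (Suc n)" by (rule plain_moduleI) (rule modY)
    have "d n x = \<zero>\<^bsub>Q (Y (Suc n))\<^esub> \<longleftrightarrow> \<kappa> (Y n) x = \<zero>\<^bsub>Y (Suc n)\<^esub>" if "x \<in> carrier (Q (Y n))" for x
      using inj_on_eq_iff[OF \<epsilon>(2) mod_hom_closed[OF \<kappa>(1) that] Z.M.zero_closed]
        mod_hom_zero[OF modY modE \<epsilon>(1), of "Suc n"]
      by (simp add: d_def)
    then show ?thesis
      unfolding a_kernel_eq \<kappa>(3)[symmetric] by auto
  qed
  have im: "d n ` carrier (Q (Y n)) = \<epsilon> (Y (Suc n)) ` carrier (Y (Suc n))" for n
    unfolding d_def \<kappa>(2)[symmetric] by (simp add: image_image)
  have "injective_resolution R X (\<lambda>n. Q (Y n)) d (\<lambda>x. \<epsilon> (Y 0) (\<iota> x))"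
    unfolding injective_resolution_def
  proof (intro conjI allI)
    show "injective_module R (Q (Y n))" for n
      by (rule baer_imp_injective[OF baer])
    show "mod_hom R X (Q (Y 0)) (\<lambda>x. \<epsilon> (Y 0) (\<iota> x))"
      using mod_hom_comp[OF transport_hom[OF inj] \<epsilon>(1)[of 0, unfolded Y_simps]]
      by (simp add: Y_simps)
    show "inj_on (\<lambda>x. \<epsilon> (Y 0) (\<iota> x)) (carrier X)"
      using comp_inj_on[OF inj, of "\<epsilon> (Y 0)"] \<epsilon>(2)[of 0] by (simp add: Y_simps comp_def)
    show "(\<lambda>x. \<epsilon> (Y 0) (\<iota> x)) ` carrier X = a_kernel (Q (Y 0)) (Q (Y 1)) (d 0)"
      using ker[of 0] by (simp add: Y_simps image_image)
    show "d n ` carrier (Q (Y n)) = a_kernel (Q (Y (Suc n))) (Q (Y (Suc (Suc n)))) (d (Suc n))" for n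
      by (simp only: ker im)
  qed (rule d)
  then show ?thesis
    by blast
qed

lemma inj_res_baer:
  fixes X :: "('a, 'x) module"
  assumes "cring R" "noetherian_ring R" "module R X"
  shows "baer_module R (fst (inj_res R X) n)"
    "mod_hom R (fst (inj_res R X) n) (fst (inj_res R X) (Suc n)) (snd (inj_res R X) n)"
    "x \<in> carrier (fst (inj_res R X) n) \<Longrightarrow>
      snd (inj_res R X) (Suc n) (snd (inj_res R X) n x) = \<zero>\<^bsub>fst (inj_res R X) (Suc (Suc n))\<^esub>"
proof -
  have "\<exists>p :: (nat \<Rightarrow> ('a, ('a, 'x) res) module) \<times> _. \<exists>\<epsilon>. injective_resolution R X (fst p) (snd p) \<epsilon>"
    using injective_resolution_exists[OF assms(2,3)] by auto
  from someI_ex[OF this] obtain \<epsilon> where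
    "injective_resolution R X (fst (inj_res R X)) (snd (inj_res R X)) \<epsilon>"
    unfolding inj_res_def[symmetric] by blast
  then have res: "injective_module R (fst (inj_res R X) n)"
      "mod_hom R (fst (inj_res R X) n) (fst (inj_res R X) (Suc n)) (snd (inj_res R X) n)"
      "snd (inj_res R X) n ` carrier (fst (inj_res R X) n) =
        a_kernel (fst (inj_res R X) (Suc n)) (fst (inj_res R X) (Suc (Suc n))) (snd (inj_res R X) (Suc n))" for n
    unfolding injective_resolution_def by auto
  show "mod_hom R (fst (inj_res R X) n) (fst (inj_res R X) (Suc n)) (snd (inj_res R X) n)"
    by (rule res(2))
  \<comment> \<open>The copy of R in the type of codes, by which injectivity on this type yields
    Baer's condition.\<close>
  have "inj (\<lambda>a::'a. {[Inl a]} :: ('a, 'x) res)"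
    by (auto simp: inj_def)
  then show "baer_module R (fst (inj_res R X) n)"
    by (rule injective_imp_baer[OF assms(1) res(1)])
  show "snd (inj_res R X) (Suc n) (snd (inj_res R X) n x) = \<zero>\<^bsub>fst (inj_res R X) (Suc (Suc n))\<^esub>"
    if "x \<in> carrier (fst (inj_res R X) n)"
    using imageI[OF that, of "snd (inj_res R X) n"] unfolding res(3) a_kernel_eq by simp
qed

section \<open>Cohomology of a complex\<close>

locale cochain_complex =
  fixes R :: "('a, 'r) ring_scheme" and C :: "nat \<Rightarrow> ('a, 'c) module" and d :: "nat \<Rightarrow> 'c \<Rightarrow> 'c"
  assumes mod: "module R (C i)"
    and d_hom: "mod_hom R (C i) (C (Suc i)) (d i)"
    and dd: "x \<in> carrier (C i) \<Longrightarrow> d (Suc i) (d i x) = \<zero>\<^bsub>C (Suc (Suc i))\<^esub>"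
begin

sublocale C: plain_module R "C i" for i
  by (rule plain_moduleI) (rule mod)

definition cocycles :: "nat \<Rightarrow> 'c set"
  where "cocycles i = {x \<in> carrier (C i). d i x = \<zero>\<^bsub>C (Suc i)\<^esub>}"

text \<open>The coset is taken in all of \<open>C i\<close> rather than in the module of cocycles,
  which is the form in which \<open>Ext_map\<close> writes its values.\<close>

definition cls :: "nat \<Rightarrow> 'c \<Rightarrow> 'c set"
  where "cls i x = coboundaries C d i +>\<^bsub>C i\<^esub> x"

lemma cocyclesI: "x \<in> carrier (C i) \<Longrightarrow> d i x = \<zero>\<^bsub>C (Suc i)\<^esub> \<Longrightarrow> x \<in> cocycles i"
  by (simp add: cocycles_def)

lemma cocyclesD: "x \<in> cocycles i \<Longrightarrow> x \<in> carrier (C i)" "x \<in> cocycles i \<Longrightarrow> d i x = \<zero>\<^bsub>C (Suc i)\<^esub>"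
  by (simp_all add: cocycles_def)

lemma d_zero: "d i \<zero>\<^bsub>C i\<^esub> = \<zero>\<^bsub>C (Suc i)\<^esub>"
  by (rule mod_hom_zero[OF mod mod d_hom])

lemma submodule_cocycles: "submodule (cocycles i) R (C i)"
  unfolding cocycles_def by (rule submodule_kernel[OF mod mod d_hom])

lemma submodule_coboundaries: "submodule (coboundaries C d i) R (C i)"
proof (cases i)
  case 0
  then show ?thesis
    using C.submodule_minusI[of "{\<zero>\<^bsub>C 0\<^esub>}" 0] by (simp add: coboundaries_def)
next
  case (Suc j)
  then show ?thesis
    using submodule_image[OF mod mod d_hom, of j] by (simp add: coboundaries_def)
qed

lemma coboundaries_subset: "coboundaries C d i \<subseteq> cocycles i"
proof (cases i)
  case 0
  then show ?thesis
    by (simp add: coboundaries_def cocycles_def d_zero)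
next
  case (Suc j)
  then show ?thesis
    using dd mod_hom_closed[OF d_hom] by (auto simp: coboundaries_def cocycles_def)
qed

definition cocycle_module :: "nat \<Rightarrow> ('a, 'c) module"
  where "cocycle_module i = (C i)\<lparr>carrier := cocycles i\<rparr>"

sublocale Z: plain_module R "cocycle_module i" for i
  unfolding cocycle_module_def
  by (rule plain_moduleI) (rule submodule.submodule_is_module[OF submodule_cocycles mod])

lemma cocycle_module_simps [simp]:
  "carrier (cocycle_module i) = cocycles i" "add (cocycle_module i) = add (C i)"
  "smult (cocycle_module i) = smult (C i)" "\<zero>\<^bsub>cocycle_module i\<^esub> = \<zero>\<^bsub>C i\<^esub>"
  "a_r_coset (cocycle_module i) = a_r_coset (C i)"
  by (simp_all add: cocycle_module_def)

lemma cohomology_eq: "cohomology C d i = quot_module (cocycle_module i) (coboundaries C d i)"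
  by (simp add: cohomology_def cocycle_module_def cocycles_def a_kernel_eq)

lemma submodule_coboundaries': "submodule (coboundaries C d i) R (cocycle_module i)"
  unfolding cocycle_module_def
  by (rule C.submodule_restrict[OF submodule_coboundaries submodule_cocycles coboundaries_subset])

lemma cohomology_is_module: "module R (cohomology C d i)"
  unfolding cohomology_eq by (rule Z.quot_module_is_module[OF submodule_coboundaries'])

lemma cohomology_carrier: "carrier (cohomology C d i) = cls i ` cocycles i"
  by (simp add: cohomology_eq Z.quot_carrier cls_def)

lemma cohomology_add:
  assumes "x \<in> cocycles i" "y \<in> cocycles i"
  shows "cls i x \<oplus>\<^bsub>cohomology C d i\<^esub> cls i y = cls i (x \<oplus>\<^bsub>C i\<^esub> y)"
  using Z.quot_add[OF submodule_coboundaries', of x i y] assms by (simp add: cohomology_eq cls_def)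

lemma cohomology_smult:
  assumes "r \<in> carrier R" "x \<in> cocycles i"
  shows "r \<odot>\<^bsub>cohomology C d i\<^esub> cls i x = cls i (r \<odot>\<^bsub>C i\<^esub> x)"
  using Z.quot_smult[OF submodule_coboundaries', of r x i] assms by (simp add: cohomology_eq cls_def)

lemma cohomology_zero: "\<zero>\<^bsub>cohomology C d i\<^esub> = cls i \<zero>\<^bsub>C i\<^esub>"
  using Z.quot_zero[OF submodule_coboundaries', of i] by (simp add: cohomology_eq cls_def)

lemma cls_eq_iff:
  assumes "x \<in> carrier (C i)" "y \<in> carrier (C i)"
  shows "cls i x = cls i y \<longleftrightarrow> x \<ominus>\<^bsub>C i\<^esub> y \<in> coboundaries C d i"
  unfolding cls_def by (rule C.coset_eq_iff[OF submodule_coboundaries assms])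

lemma cls_eq_zero_iff:
  assumes "x \<in> carrier (C i)"
  shows "cls i x = \<zero>\<^bsub>cohomology C d i\<^esub> \<longleftrightarrow> x \<in> coboundaries C d i"
  using cls_eq_iff[OF assms C.M.zero_closed] assms by (simp add: cohomology_zero C.diff_zero)

lemma cls_memD:
  assumes "x \<in> cocycles i" "y \<in> cls i x"
  shows "y \<in> cocycles i" "cls i y = cls i x"
proof -
  show "y \<in> cocycles i"
    using Z.coset_memD(1)[OF submodule_coboundaries', of x i y] assms by (simp add: cls_def)
  show "cls i y = cls i x"
    using C.coset_memD(2)[OF submodule_coboundaries, of x i y] assms cocyclesD by (simp add: cls_def)
qed

lemma self_in_cls: "x \<in> carrier (C i) \<Longrightarrow> x \<in> cls i x"
  unfolding cls_def by (rule C.self_in_coset[OF submodule_coboundaries])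

lemma zero_cohomology_iff:
  "zero_module (cohomology C d i) \<longleftrightarrow> cocycles i \<subseteq> coboundaries C d i"
proof
  assume z: "zero_module (cohomology C d i)"
  show "cocycles i \<subseteq> coboundaries C d i"
  proof
    fix x assume x: "x \<in> cocycles i"
    then have "cls i x \<in> carrier (cohomology C d i)"
      by (simp add: cohomology_carrier)
    with z have "cls i x = \<zero>\<^bsub>cohomology C d i\<^esub>"
      by (simp add: zero_module_def)
    then show "x \<in> coboundaries C d i"
      using cls_eq_zero_iff[OF cocyclesD(1)[OF x]] by simp
  qed
next
  assume "cocycles i \<subseteq> coboundaries C d i"
  then have "cls i x = \<zero>\<^bsub>cohomology C d i\<^esub>" if "x \<in> cocycles i" for x
    using cls_eq_zero_iff[OF cocyclesD(1)[OF that]] that by auto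
  moreover have "\<zero>\<^bsub>C i\<^esub> \<in> cocycles i"
    by (rule C.submodule_zero[OF submodule_cocycles])
  ultimately show "zero_module (cohomology C d i)"
    unfolding zero_module_def cohomology_carrier by auto
qed

end

section \<open>Hom modules\<close>

lemma Hom_module_simps:
  "carrier (Hom_module R N E) = {f \<in> extensional (carrier N). mod_hom R N E f}"
  "\<zero>\<^bsub>Hom_module R N E\<^esub> = (\<lambda>x\<in>carrier N. \<zero>\<^bsub>E\<^esub>)"
  "f \<oplus>\<^bsub>Hom_module R N E\<^esub> g = (\<lambda>x\<in>carrier N. f x \<oplus>\<^bsub>E\<^esub> g x)"
  "r \<odot>\<^bsub>Hom_module R N E\<^esub> f = (\<lambda>x\<in>carrier N. r \<odot>\<^bsub>E\<^esub> f x)"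
  by (simp_all add: Hom_module_def)

lemma Hom_module_memD:
  "f \<in> carrier (Hom_module R N E) \<Longrightarrow> f \<in> extensional (carrier N)"
  "f \<in> carrier (Hom_module R N E) \<Longrightarrow> mod_hom R N E f"
  by (simp_all add: Hom_module_simps)

lemma Hom_module_memI:
  "f \<in> extensional (carrier N) \<Longrightarrow> mod_hom R N E f \<Longrightarrow> f \<in> carrier (Hom_module R N E)"
  by (simp add: Hom_module_simps)

lemma Hom_module_is_module:
  assumes "module R N" "module R E"
  shows "module R (Hom_module R N E)"
proof -
  interpret N: plain_module R N by (rule plain_moduleI) fact
  interpret E: plain_module R E by (rule plain_moduleI) fact
  let ?H = "Hom_module R N E"
  have val: "f x \<in> carrier E" if "f \<in> carrier ?H" "x \<in> carrier N" for f x
    using mod_hom_closed[OF Hom_module_memD(2)[OF that(1)] that(2)] .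
  have mem: "restrict f (carrier N) \<in> carrier ?H" if "mod_hom R N E f" for f
    using that by (simp add: Hom_module_simps)
  have eqI: "f = g" if "f \<in> extensional (carrier N)" "g \<in> extensional (carrier N)"
      "\<And>x. x \<in> carrier N \<Longrightarrow> f x = g x" for f g :: "'c \<Rightarrow> 'd"
    using that by (rule extensionalityI)
  show ?thesis
  proof (rule moduleI)
    show "cring R"
      by (rule N.R.is_cring)
    show "abelian_group ?H"
    proof (rule abelian_groupI)
      show "\<zero>\<^bsub>?H\<^esub> \<in> carrier ?H"
        unfolding Hom_module_simps(2) by (rule mem) (rule mod_homI, auto)
      fix f assume f: "f \<in> carrier ?H"
      note fh = Hom_module_memD(2)[OF f] and fe = Hom_module_memD(1)[OF f]
      show "\<zero>\<^bsub>?H\<^esub> \<oplus>\<^bsub>?H\<^esub> f = f"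
        by (rule eqI[OF _ fe]) (auto simp: Hom_module_simps val[OF f])
      have "mod_hom R N E (\<lambda>x. \<ominus>\<^bsub>E\<^esub> f x)"
        by (rule mod_homI) (auto simp: mod_hom_add[OF fh] mod_hom_smult[OF fh] val[OF f]
            E.M.minus_add E.smult_r_minus)
      then show "\<exists>g\<in>carrier ?H. g \<oplus>\<^bsub>?H\<^esub> f = \<zero>\<^bsub>?H\<^esub>"
        by (intro bexI[OF _ mem]) (auto simp: Hom_module_simps(2,3) val[OF f] E.M.l_neg)
      fix g assume g: "g \<in> carrier ?H"
      note gh = Hom_module_memD(2)[OF g]
      show "f \<oplus>\<^bsub>?H\<^esub> g \<in> carrier ?H"
        unfolding Hom_module_simps(3)
        by (rule mem) (rule mod_homI, auto simp: mod_hom_add[OF fh] mod_hom_smult[OF fh]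
            mod_hom_add[OF gh] mod_hom_smult[OF gh] val[OF f] val[OF g] E.M.a_ac E.smult_r_distr)
      show "f \<oplus>\<^bsub>?H\<^esub> g = g \<oplus>\<^bsub>?H\<^esub> f"
        by (rule eqI) (auto simp: Hom_module_simps(3) val[OF f] val[OF g] E.M.a_comm)
      fix h assume h: "h \<in> carrier ?H"
      show "f \<oplus>\<^bsub>?H\<^esub> g \<oplus>\<^bsub>?H\<^esub> h = f \<oplus>\<^bsub>?H\<^esub> (g \<oplus>\<^bsub>?H\<^esub> h)"
        by (rule eqI) (auto simp: Hom_module_simps(3) val[OF f] val[OF g] val[OF h] E.M.a_assoc)
    qed
    fix a f assume a: "a \<in> carrier R" and f: "f \<in> carrier ?H"
    note fh = Hom_module_memD(2)[OF f] and fe = Hom_module_memD(1)[OF f]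
    show "a \<odot>\<^bsub>?H\<^esub> f \<in> carrier ?H"
      unfolding Hom_module_simps(4)
    proof (rule mem, rule mod_homI)
      show "a \<odot>\<^bsub>E\<^esub> f (r \<odot>\<^bsub>N\<^esub> x) = r \<odot>\<^bsub>E\<^esub> (a \<odot>\<^bsub>E\<^esub> f x)" if "r \<in> carrier R" "x \<in> carrier N" for r x
        using that a val[OF f that(2)]
        by (simp add: mod_hom_smult[OF fh] E.smult_assoc1[symmetric] N.R.m_comm)
    qed (use a in \<open>auto simp: mod_hom_add[OF fh] val[OF f] E.smult_r_distr\<close>)
    show "a \<odot>\<^bsub>?H\<^esub> (f \<oplus>\<^bsub>?H\<^esub> g) = a \<odot>\<^bsub>?H\<^esub> f \<oplus>\<^bsub>?H\<^esub> a \<odot>\<^bsub>?H\<^esub> g" if "g \<in> carrier ?H" for g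
      by (rule eqI) (auto simp: Hom_module_simps(3,4) val[OF f] val[OF that] a E.smult_r_distr)
    fix b assume b: "b \<in> carrier R"
    show "(a \<oplus>\<^bsub>R\<^esub> b) \<odot>\<^bsub>?H\<^esub> f = a \<odot>\<^bsub>?H\<^esub> f \<oplus>\<^bsub>?H\<^esub> b \<odot>\<^bsub>?H\<^esub> f"
      by (rule eqI) (auto simp: Hom_module_simps(3,4) val[OF f] a b E.smult_l_distr)
    show "(a \<otimes>\<^bsub>R\<^esub> b) \<odot>\<^bsub>?H\<^esub> f = a \<odot>\<^bsub>?H\<^esub> (b \<odot>\<^bsub>?H\<^esub> f)"
      by (rule eqI) (auto simp: Hom_module_simps(4) val[OF f] a b E.smult_assoc1)
  next
    fix f assume f: "f \<in> carrier ?H"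
    show "\<one>\<^bsub>R\<^esub> \<odot>\<^bsub>?H\<^esub> f = f"
      by (rule eqI[OF _ Hom_module_memD(1)[OF f]]) (auto simp: Hom_module_simps(4) val[OF f])
  qed
qed

text \<open>Negatives in the Hom module are given only by their defining property. The pointwise
  formula is recovered by adding \<open>g\<close> back.\<close>

lemma Hom_module_diff:
  assumes "module R N" "module R E" "f \<in> carrier (Hom_module R N E)" "g \<in> carrier (Hom_module R N E)"
    "x \<in> carrier N"
  shows "(f \<ominus>\<^bsub>Hom_module R N E\<^esub> g) x = f x \<ominus>\<^bsub>E\<^esub> g x"
proof -
  interpret E: plain_module R E by (rule plain_moduleI) fact
  interpret H: plain_module R "Hom_module R N E"
    by (rule plain_moduleI) (rule Hom_module_is_module[OF assms(1,2)])
  have "f \<ominus>\<^bsub>Hom_module R N E\<^esub> g \<in> carrier (Hom_module R N E)"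
    using assms by simp
  then have c: "(f \<ominus>\<^bsub>Hom_module R N E\<^esub> g) x \<in> carrier E" "f x \<in> carrier E" "g x \<in> carrier E"
    using assms(3,4) mod_hom_closed[OF Hom_module_memD(2) assms(5)] by blast+
  have "((f \<ominus>\<^bsub>Hom_module R N E\<^esub> g) \<oplus>\<^bsub>Hom_module R N E\<^esub> g) x = f x"
    using H.diff_add_cancel_left assms by simp
  then have "(f \<ominus>\<^bsub>Hom_module R N E\<^esub> g) x \<oplus>\<^bsub>E\<^esub> g x = f x"
    using assms(5) by (simp add: Hom_module_simps)
  then have "f x \<ominus>\<^bsub>E\<^esub> g x = ((f \<ominus>\<^bsub>Hom_module R N E\<^esub> g) x \<oplus>\<^bsub>E\<^esub> g x) \<ominus>\<^bsub>E\<^esub> (\<zero>\<^bsub>E\<^esub> \<oplus>\<^bsub>E\<^esub> g x)"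
    using c by simp
  also have "\<dots> = (f \<ominus>\<^bsub>Hom_module R N E\<^esub> g) x"
    using c by (subst E.diff_add_diff) (auto simp: E.diff_zero E.M.minus_eq E.M.r_neg)
  finally show ?thesis ..
qed

lemma (in cochain_complex) Hom_cochain_complex:
  assumes "module R N"
  shows "cochain_complex R (\<lambda>i. Hom_module R N (C i)) (\<lambda>i. compose (carrier N) (d i))"
proof (rule cochain_complex.intro)
  interpret N: plain_module R N by (rule plain_moduleI) fact
  have comp: "mod_hom R N (C (Suc i)) (compose (carrier N) (d i) f)" if "mod_hom R N (C i) f" for i f
    using mod_hom_comp[OF that d_hom] by (simp add: compose_def)
  show "module R (Hom_module R N (C i))" for i
    by (rule Hom_module_is_module[OF assms mod])
  show "mod_hom R (Hom_module R N (C i)) (Hom_module R N (C (Suc i))) (compose (carrier N) (d i))" for i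
  proof (rule mod_homI)
    fix f assume f: "f \<in> carrier (Hom_module R N (C i))"
    note fh = Hom_module_memD(2)[OF f]
    note val = mod_hom_closed[OF fh]
    show "compose (carrier N) (d i) f \<in> carrier (Hom_module R N (C (Suc i)))"
      by (rule Hom_module_memI[OF compose_extensional comp[OF fh]])
    show "compose (carrier N) (d i) (r \<odot>\<^bsub>Hom_module R N (C i)\<^esub> f) =
        r \<odot>\<^bsub>Hom_module R N (C (Suc i))\<^esub> compose (carrier N) (d i) f" if "r \<in> carrier R" for r
      by (rule extensionalityI[of _ "carrier N"])
        (auto simp: Hom_module_simps compose_def mod_hom_smult[OF d_hom that val])
    fix g assume g: "g \<in> carrier (Hom_module R N (C i))"
    note val' = mod_hom_closed[OF Hom_module_memD(2)[OF g]]
    show "compose (carrier N) (d i) (f \<oplus>\<^bsub>Hom_module R N (C i)\<^esub> g) =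
        compose (carrier N) (d i) f \<oplus>\<^bsub>Hom_module R N (C (Suc i))\<^esub> compose (carrier N) (d i) g"
      by (rule extensionalityI[of _ "carrier N"])
        (auto simp: Hom_module_simps compose_def mod_hom_add[OF d_hom val val'])
  qed
  show "compose (carrier N) (d (Suc i)) (compose (carrier N) (d i) f) = \<zero>\<^bsub>Hom_module R N (C (Suc (Suc i)))\<^esub>"
    if f: "f \<in> carrier (Hom_module R N (C i))" for f i
    using dd[OF mod_hom_closed[OF Hom_module_memD(2)[OF f]]]
    by (intro extensionalityI[of _ "carrier N"]) (auto simp: Hom_module_simps compose_def)
qed

section \<open>Complexes of Baer modules\<close>

locale baer_complex = cochain_complex R E d
  for R :: "('a, 'r) ring_scheme" and E :: "nat \<Rightarrow> ('a, 'i) module" and d :: "nat \<Rightarrow> 'i \<Rightarrow> 'i" +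
  fixes I :: "'a set"
  assumes R: "cring R" "noetherian_ring R" and I: "ideal I R" and baer: "baer_module R (E i)"
begin

abbreviation J :: "nat \<Rightarrow> ('a, 'i) module"
  where "J i \<equiv> torsion_module R I (E i)"

sublocale J: cochain_complex R J d
proof (rule cochain_complex.intro)
  show "module R (J i)" for i
    by (rule torsion_is_module[OF mod I])
  show "mod_hom R (J i) (J (Suc i)) (d i)" for i
    by (rule mod_hom_torsion[OF mod mod I d_hom])
  show "d (Suc i) (d i x) = \<zero>\<^bsub>J (Suc (Suc i))\<^esub>" if "x \<in> carrier (J i)" for x i
    using dd that by (simp add: torsion_carrier)
qed

lemma baer_J: "baer_module R (J i)"
  by (rule baer_torsion[OF R I baer])

text \<open>For a section \<sigma> of the differential on the coboundaries, the map taking x to x -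
  d(\<sigma> x) kills the coboundaries and changes an element only by a coboundary. In degree 0 the
  coboundaries vanish and the identity serves.\<close>

lemma projection_exists:
  assumes "i = 0 \<or> (\<exists>j \<sigma>. i = Suc j \<and> mod_hom R (J i) (J j) \<sigma> \<and>
    (\<forall>b\<in>coboundaries J d i. d j (\<sigma> b) = b))"
  obtains p where "mod_hom R (J i) (J i) p" "\<And>b. b \<in> coboundaries J d i \<Longrightarrow> p b = \<zero>\<^bsub>J i\<^esub>"
    "\<And>x. x \<in> carrier (J i) \<Longrightarrow> x \<ominus>\<^bsub>J i\<^esub> p x \<in> coboundaries J d i"
  using assms
proof (elim disjE exE conjE)
  assume i: "i = 0"
  show thesis
  proof (rule that[of "\<lambda>x. x"])
    show "x \<ominus>\<^bsub>J i\<^esub> x \<in> coboundaries J d i" if "x \<in> carrier (J i)" for x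
      using J.C.minus_eq_zero_iff[OF that that] J.C.submodule_zero[OF J.submodule_coboundaries] by metis
  qed (auto simp: i coboundaries_def mod_hom_def)
next
  fix j \<sigma> assume i: "i = Suc j" and \<sigma>: "mod_hom R (J i) (J j) \<sigma>"
    and b: "\<forall>b\<in>coboundaries J d i. d j (\<sigma> b) = b"
  have d\<sigma>: "mod_hom R (J i) (J i) (\<lambda>x. d j (\<sigma> x))"
    using mod_hom_comp[OF \<sigma> J.d_hom] i by simp
  note val = mod_hom_closed[OF d\<sigma>]
  show thesis
  proof (rule that[of "\<lambda>x. x \<ominus>\<^bsub>J i\<^esub> d j (\<sigma> x)"])
    show "mod_hom R (J i) (J i) (\<lambda>x. x \<ominus>\<^bsub>J i\<^esub> d j (\<sigma> x))"
    proof (rule mod_homI)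
      show "x \<ominus>\<^bsub>J i\<^esub> d j (\<sigma> x) \<in> carrier (J i)" if "x \<in> carrier (J i)" for x
        using that val by (intro J.C.M.minus_closed)
      show "(x \<oplus>\<^bsub>J i\<^esub> y) \<ominus>\<^bsub>J i\<^esub> d j (\<sigma> (x \<oplus>\<^bsub>J i\<^esub> y)) =
          (x \<ominus>\<^bsub>J i\<^esub> d j (\<sigma> x)) \<oplus>\<^bsub>J i\<^esub> (y \<ominus>\<^bsub>J i\<^esub> d j (\<sigma> y))"
        if "x \<in> carrier (J i)" "y \<in> carrier (J i)" for x y
        using J.C.diff_add_diff[OF that val[OF that(1)] val[OF that(2)]] mod_hom_add[OF d\<sigma> that] by metis
      show "(r \<odot>\<^bsub>J i\<^esub> x) \<ominus>\<^bsub>J i\<^esub> d j (\<sigma> (r \<odot>\<^bsub>J i\<^esub> x)) = r \<odot>\<^bsub>J i\<^esub> (x \<ominus>\<^bsub>J i\<^esub> d j (\<sigma> x))"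
        if "r \<in> carrier R" "x \<in> carrier (J i)" for r x
        using J.C.smult_diff[OF that val[OF that(2)]] mod_hom_smult[OF d\<sigma> that] by metis
    qed
    show "x \<ominus>\<^bsub>J i\<^esub> d j (\<sigma> x) = \<zero>\<^bsub>J i\<^esub>" if "x \<in> coboundaries J d i" for x
    proof -
      have x: "x \<in> carrier (J i)"
        using that J.C.submoduleE(1)[OF J.submodule_coboundaries] by blast
      have "d j (\<sigma> x) = x"
        using b that by blast
      then show ?thesis
        using J.C.minus_eq_zero_iff[OF x x] by metis
    qed
    show "x \<ominus>\<^bsub>J i\<^esub> (x \<ominus>\<^bsub>J i\<^esub> d j (\<sigma> x)) \<in> coboundaries J d i" if x: "x \<in> carrier (J i)" for x
    proof -
      have "d j (\<sigma> x) \<in> coboundaries J d i"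
        using mod_hom_closed[OF \<sigma> x] by (simp add: coboundaries_def i)
      then show ?thesis
        using J.C.diff_diff_left[OF x val[OF x]] by metis
    qed
  qed
qed

text \<open>Vanishing of \<open>H\<^sup>i(J)\<close> for \<open>i < t\<close> makes \<open>J\<close> split in degrees up to \<open>t\<close>, because the
  \<open>J i\<close> are injective.\<close>

lemma section_exists:
  assumes "\<And>i. i \<le> j \<Longrightarrow> J.cocycles i \<subseteq> coboundaries J d i"
  shows "\<exists>\<sigma>. mod_hom R (J (Suc j)) (J j) \<sigma> \<and> (\<forall>b\<in>coboundaries J d (Suc j). d j (\<sigma> b) = b)"
  using assms
proof (induct j rule: less_induct)
  case (less j)
  have "j = 0 \<or> (\<exists>k \<sigma>. j = Suc k \<and> mod_hom R (J j) (J k) \<sigma> \<and> (\<forall>b\<in>coboundaries J d j. d k (\<sigma> b) = b))"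
    using less(1) less(2) by (cases j) auto
  then obtain p where p: "mod_hom R (J j) (J j) p" "\<And>b. b \<in> coboundaries J d j \<Longrightarrow> p b = \<zero>\<^bsub>J j\<^esub>"
    "\<And>x. x \<in> carrier (J j) \<Longrightarrow> x \<ominus>\<^bsub>J j\<^esub> p x \<in> coboundaries J d j"
    by (rule projection_exists) blast
  note pc = mod_hom_closed[OF p(1)] and dc = mod_hom_closed[OF J.d_hom]
  \<comment> \<open>The partial map from d x to p x. It is well defined because a cocycle
    \<open>x\<close> is a coboundary by exactness and hence killed by \<open>p\<close>; injectivity
    of \<open>J j\<close> extends it to all of \<open>J (Suc j)\<close>.\<close>
  let ?G = "(\<lambda>x. (d j x, p x)) ` carrier (J j)"
  have "lin_graph R (J (Suc j)) (J j) ?G"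
  proof (rule lin_graphI)
    show "(\<zero>\<^bsub>J (Suc j)\<^esub>, \<zero>\<^bsub>J j\<^esub>) \<in> ?G"
      by (rule image_eqI[OF _ J.C.M.zero_closed])
        (simp only: J.d_zero mod_hom_zero[OF J.mod J.mod p(1)])
    fix y u assume "(y, u) \<in> ?G"
    then obtain x where x: "x \<in> carrier (J j)" "y = d j x" "u = p x"
      by auto
    show "y \<in> carrier (J (Suc j))" "u \<in> carrier (J j)"
      using x dc pc by auto
    show "(r \<odot>\<^bsub>J (Suc j)\<^esub> y, r \<odot>\<^bsub>J j\<^esub> u) \<in> ?G" if "r \<in> carrier R" for r
      by (rule image_eqI[OF _ J.C.smult_closed[OF that x(1)]])
        (simp only: x mod_hom_smult[OF J.d_hom that x(1)] mod_hom_smult[OF p(1) that x(1)])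
    fix y' u' assume "(y', u') \<in> ?G"
    then obtain x' where x': "x' \<in> carrier (J j)" "y' = d j x'" "u' = p x'"
      by auto
    show "(y \<oplus>\<^bsub>J (Suc j)\<^esub> y', u \<oplus>\<^bsub>J j\<^esub> u') \<in> ?G"
      by (rule image_eqI[OF _ J.C.M.add.m_closed[OF x(1) x'(1)]])
        (simp only: x x' mod_hom_add[OF J.d_hom x(1) x'(1)] mod_hom_add[OF p(1) x(1) x'(1)])
  next
    fix u assume "(\<zero>\<^bsub>J (Suc j)\<^esub>, u) \<in> ?G"
    then obtain x where x: "x \<in> carrier (J j)" "\<zero>\<^bsub>J (Suc j)\<^esub> = d j x" "u = p x"
      by auto
    then have "x \<in> coboundaries J d j"
      using J.cocyclesI[OF x(1) x(2)[symmetric]] less(2)[of j] by auto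
    then show "u = \<zero>\<^bsub>J j\<^esub>"
      using p(2) x(3) by simp
  qed
  then obtain \<sigma> where \<sigma>: "mod_hom R (J (Suc j)) (J j) \<sigma>" "\<forall>(y, u)\<in>?G. \<sigma> y = u"
    by (rule baer_extend[OF J.mod baer_J])
  have "d j (\<sigma> b) = b" if b: "b \<in> coboundaries J d (Suc j)" for b
  proof -
    obtain x where x: "x \<in> carrier (J j)" "b = d j x"
      using b by (auto simp: coboundaries_def)
    have "\<sigma> b = p x"
      using \<sigma>(2) x by auto
    \<comment> \<open>\<open>x\<close> and \<open>p x\<close> differ by a coboundary, so
      \<open>d j\<close> takes the same value on both.\<close>
    moreover have "d j (x \<ominus>\<^bsub>J j\<^esub> p x) = \<zero>\<^bsub>J (Suc j)\<^esub>"
      using p(3)[OF x(1)] J.coboundaries_subset J.cocyclesD(2) by blast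
    then have "d j x \<ominus>\<^bsub>J (Suc j)\<^esub> d j (p x) = \<zero>\<^bsub>J (Suc j)\<^esub>"
      using mod_hom_minus[OF J.mod J.mod J.d_hom x(1) pc[OF x(1)]] by metis
    then have "d j x = d j (p x)"
      using J.C.minus_eq_zero_iff[OF dc[OF x(1)] dc[OF pc[OF x(1)]]] by metis
    ultimately show ?thesis
      using x(2) by metis
  qed
  with \<sigma>(1) show ?case
    by blast
qed

lemma hom_into_torsion:
  assumes "module R N" and kill: "\<And>r x. r \<in> ideal_pow R I k \<Longrightarrow> x \<in> carrier N \<Longrightarrow> r \<odot>\<^bsub>N\<^esub> x = \<zero>\<^bsub>N\<^esub>"
    and "mod_hom R N (E i) f"
  shows "mod_hom R N (J i) f"
proof (rule mod_homI)
  fix x assume x: "x \<in> carrier N"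
  have "r \<odot>\<^bsub>E i\<^esub> f x = \<zero>\<^bsub>E i\<^esub>" if "r \<in> ideal_pow R I k" for r
    using mod_hom_smult[OF assms(3) C.R.ideal_pow_carrier[OF I that] x] kill[OF that x]
      mod_hom_zero[OF assms(1) mod assms(3)] by simp
  then show "f x \<in> carrier (J i)"
    using mod_hom_closed[OF assms(3) x] by (auto simp: torsion_carrier)
qed (use mod_hom_add[OF assms(3)] mod_hom_smult[OF assms(3)] in auto)

text \<open>Negatives are defined by a choice in the carrier, so the torsion part does not inherit
  them by definition; the inclusion is a homomorphism and preserves them.\<close>

lemma torsion_minus:
  assumes "x \<in> carrier (J i)" "y \<in> carrier (J i)"
  shows "x \<ominus>\<^bsub>J i\<^esub> y = x \<ominus>\<^bsub>E i\<^esub> y"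
proof -
  have "mod_hom R (J i) (E i) (\<lambda>x. x)"
    by (rule mod_homI) (auto simp: torsion_carrier)
  from mod_hom_minus[OF J.mod mod this assms] show ?thesis .
qed

lemma hom_from_torsion: "mod_hom R N (J i) f \<Longrightarrow> mod_hom R N (E i) f"
  by (auto simp: mod_hom_def torsion_carrier)

end

text \<open>The cochains are homomorphisms into \<open>E\<close>, as in the definition of Ext. Since
  a power of I kills N, all their values lie in \<open>J\<close>, where the splitting is
  available.\<close>

locale torsion_hom = baer_complex R E d I
  for R :: "('a, 'r) ring_scheme" and E :: "nat \<Rightarrow> ('a, 'i) module" and d I +
  fixes N :: "('a, 'n) module" and t :: nat
  assumes modN: "module R N"
    and kill: "\<exists>k. \<forall>r\<in>ideal_pow R I k. \<forall>x\<in>carrier N. r \<odot>\<^bsub>N\<^esub> x = \<zero>\<^bsub>N\<^esub>"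
    and exact: "i < t \<Longrightarrow> J.cocycles i \<subseteq> coboundaries J d i"
begin

abbreviation H :: "nat \<Rightarrow> ('a, 'n \<Rightarrow> 'i) module"
  where "H i \<equiv> Hom_module R N (E i)"

abbreviation dH :: "nat \<Rightarrow> ('n \<Rightarrow> 'i) \<Rightarrow> ('n \<Rightarrow> 'i)"
  where "dH i \<equiv> compose (carrier N) (d i)"

sublocale H: cochain_complex R H dH
  by (rule Hom_cochain_complex[OF modN])

interpretation N: plain_module R N
  by (rule plain_moduleI) (rule modN)

lemma hom_J: "mod_hom R N (E i) f \<Longrightarrow> mod_hom R N (J i) f"
  using hom_into_torsion[OF modN] kill by blast

lemma H_carrier_hom: "f \<in> carrier (H i) \<Longrightarrow> mod_hom R N (J i) f"
  by (rule hom_J) (rule Hom_module_memD(2))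

lemma H_cocycles_iff:
  "f \<in> H.cocycles i \<longleftrightarrow> f \<in> carrier (H i) \<and> (\<forall>x\<in>carrier N. f x \<in> J.cocycles i)"
proof (cases "f \<in> carrier (H i)")
  case True
  have "dH i f = \<zero>\<^bsub>H (Suc i)\<^esub> \<longleftrightarrow> (\<forall>x\<in>carrier N. d i (f x) = \<zero>\<^bsub>E (Suc i)\<^esub>)"
  proof
    assume eq: "dH i f = \<zero>\<^bsub>H (Suc i)\<^esub>"
    show "\<forall>x\<in>carrier N. d i (f x) = \<zero>\<^bsub>E (Suc i)\<^esub>"
    proof
      fix x assume "x \<in> carrier N"
      then show "d i (f x) = \<zero>\<^bsub>E (Suc i)\<^esub>"
        using fun_cong[OF eq, of x] by (simp add: compose_def Hom_module_simps)
    qed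
  next
    assume "\<forall>x\<in>carrier N. d i (f x) = \<zero>\<^bsub>E (Suc i)\<^esub>"
    then show "dH i f = \<zero>\<^bsub>H (Suc i)\<^esub>"
      unfolding compose_def Hom_module_simps by (intro restrict_ext) simp
  qed
  then show ?thesis
    using True mod_hom_closed[OF H_carrier_hom[OF True]]
    by (auto simp: H.cocycles_def J.cocycles_def)
qed (auto simp: H.cocycles_def)

text \<open>If all values of \<open>f\<close> are coboundaries, composing with the linear section
  gives one cochain whose differential is \<open>f\<close>. Degree \<open>t\<close> itself is
  included: the section out of \<open>J t\<close> uses exactness only below
  \<open>t\<close>.\<close>

lemma H_coboundaries_iff:
  assumes i: "i \<le> t" and f: "f \<in> carrier (H i)"
  shows "f \<in> coboundaries H dH i \<longleftrightarrow> (\<forall>x\<in>carrier N. f x \<in> coboundaries J d i)"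
proof (cases i)
  case 0
  have "f = \<zero>\<^bsub>H 0\<^esub> \<longleftrightarrow> (\<forall>x\<in>carrier N. f x = \<zero>\<^bsub>E 0\<^esub>)"
    using extensionalityI[OF Hom_module_memD(1)[OF f], of "\<zero>\<^bsub>H 0\<^esub>"]
    by (auto simp: Hom_module_simps(2))
  then show ?thesis
    by (simp add: 0 coboundaries_def)
next
  case (Suc j)
  show ?thesis
  proof
    assume "f \<in> coboundaries H dH i"
    then obtain h where h: "h \<in> carrier (H j)" "f = dH j h"
      by (auto simp: coboundaries_def Suc)
    then show "\<forall>x\<in>carrier N. f x \<in> coboundaries J d i"
      using mod_hom_closed[OF H_carrier_hom[OF h(1)]] by (simp add: coboundaries_def Suc compose_def)
  next
    assume fb: "\<forall>x\<in>carrier N. f x \<in> coboundaries J d i"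
    obtain \<sigma> where \<sigma>: "mod_hom R (J i) (J j) \<sigma>" "\<forall>b\<in>coboundaries J d i. d j (\<sigma> b) = b"
      using section_exists[of j] exact i Suc by auto
    let ?h = "restrict (\<lambda>x. \<sigma> (f x)) (carrier N)"
    have "mod_hom R N (E j) (\<lambda>x. \<sigma> (f x))"
      by (rule hom_from_torsion[OF mod_hom_comp[OF H_carrier_hom[OF f] \<sigma>(1)]])
    then have "?h \<in> carrier (H j)"
      by (simp add: Hom_module_simps)
    moreover have "f = dH j ?h"
      by (rule extensionalityI[OF Hom_module_memD(1)[OF f]]) (auto simp: compose_def \<sigma>(2) fb)
    ultimately show "f \<in> coboundaries H dH i"
      by (simp add: coboundaries_def Suc)
  qed
qed

theorem Hom_cohomology_zero:
  assumes "i < t"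
  shows "zero_module (cohomology H dH i)"
  unfolding H.zero_cohomology_iff
proof
  fix f assume "f \<in> H.cocycles i"
  then have f: "f \<in> carrier (H i)" "\<forall>x\<in>carrier N. f x \<in> J.cocycles i"
    by (auto simp: H_cocycles_iff)
  then show "f \<in> coboundaries H dH i"
    using exact[OF assms] H_coboundaries_iff[of i f] assms by auto
qed

text \<open>The natural map from the cohomology of the Hom complex to homomorphisms into the
  cohomology: the class of \<open>f\<close> goes to the map sending x to the class of
  \<open>f x\<close>.\<close>

definition psi :: "('n \<Rightarrow> 'i) set \<Rightarrow> 'n \<Rightarrow> 'i set"
  where "psi A = (\<lambda>x\<in>carrier N. \<Union>f\<in>A. J.cls t (f x))"

lemma psi_cls:
  assumes f: "f \<in> H.cocycles t"
  shows "psi (H.cls t f) = (\<lambda>x\<in>carrier N. J.cls t (f x))"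
  unfolding psi_def
proof (rule restrict_ext)
  fix x assume x: "x \<in> carrier N"
  have "J.cls t (g x) = J.cls t (f x)" if g: "g \<in> H.cls t f" for g
  proof -
    have gc: "g \<in> H.cocycles t" "H.cls t g = H.cls t f"
      using H.cls_memD[OF f g] .
    have c: "g \<in> carrier (H t)" "f \<in> carrier (H t)"
      using gc(1) f H.cocyclesD by blast+
    have "g \<ominus>\<^bsub>H t\<^esub> f \<in> coboundaries H dH t"
      using H.cls_eq_iff[OF c] gc(2) by simp
    then have "(g \<ominus>\<^bsub>H t\<^esub> f) x \<in> coboundaries J d t"
      using H_coboundaries_iff[OF le_refl H.C.M.minus_closed[OF c]] x by blast
    then have "g x \<ominus>\<^bsub>E t\<^esub> f x \<in> coboundaries J d t"
      using Hom_module_diff[OF modN mod c x] by simp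
    then show ?thesis
      using J.cls_eq_iff[OF mod_hom_closed[OF H_carrier_hom[OF c(1)] x] mod_hom_closed[OF H_carrier_hom[OF c(2)] x]]
        torsion_minus[OF mod_hom_closed[OF H_carrier_hom[OF c(1)] x] mod_hom_closed[OF H_carrier_hom[OF c(2)] x]]
      by simp
  qed
  then have "(\<Union>g\<in>H.cls t f. J.cls t (g x)) = (\<Union>g\<in>H.cls t f. J.cls t (f x))"
    by (rule SUP_cong[OF refl])
  moreover have "H.cls t f \<noteq> {}"
    using H.self_in_cls[OF H.cocyclesD(1)[OF f]] by blast
  ultimately show "(\<Union>g\<in>H.cls t f. J.cls t (g x)) = J.cls t (f x)"
    by simp
qed

lemma cls_hom: "mod_hom R (J.cocycle_module t) (cohomology J d t) (J.cls t)"
  by (rule mod_homI) (simp_all add: J.cohomology_carrier J.cohomology_add J.cohomology_smult)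

lemma psi_cls_carrier:
  assumes f: "f \<in> H.cocycles t"
  shows "psi (H.cls t f) \<in> carrier (Hom_module R N (cohomology J d t))"
proof -
  have f': "f \<in> carrier (H t)" "\<forall>x\<in>carrier N. f x \<in> J.cocycles t"
    using f by (auto simp: H_cocycles_iff)
  note fh = H_carrier_hom[OF f'(1)]
  have "mod_hom R N (J.cocycle_module t) f"
    by (rule mod_homI) (use f'(2) mod_hom_add[OF fh] mod_hom_smult[OF fh] in auto)
  then have "mod_hom R N (cohomology J d t) (\<lambda>x. J.cls t (f x))"
    by (rule mod_hom_comp[OF _ cls_hom])
  then show ?thesis
    unfolding psi_cls[OF f] by (simp add: Hom_module_simps)
qed

lemma psi_hom: "mod_hom R (cohomology H dH t) (Hom_module R N (cohomology J d t)) psi"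
proof (rule mod_homI)
  let ?HJ = "cohomology J d t"
  fix A assume "A \<in> carrier (cohomology H dH t)"
  then obtain f where f: "f \<in> H.cocycles t" "A = H.cls t f"
    by (auto simp: H.cohomology_carrier)
  have fx: "f x \<in> J.cocycles t" if "x \<in> carrier N" for x
    using f(1) that by (auto simp: H_cocycles_iff)
  show "psi A \<in> carrier (Hom_module R N ?HJ)"
    unfolding f(2) by (rule psi_cls_carrier[OF f(1)])
  show "psi (r \<odot>\<^bsub>cohomology H dH t\<^esub> A) = r \<odot>\<^bsub>Hom_module R N ?HJ\<^esub> psi A" if r: "r \<in> carrier R" for r
  proof -
    have c: "r \<odot>\<^bsub>H t\<^esub> f \<in> H.cocycles t"
      by (rule H.C.submoduleE(4)[OF H.submodule_cocycles r f(1)])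
    have "psi (r \<odot>\<^bsub>cohomology H dH t\<^esub> A) = (\<lambda>x\<in>carrier N. J.cls t ((r \<odot>\<^bsub>H t\<^esub> f) x))"
      unfolding f(2) H.cohomology_smult[OF r f(1)] by (rule psi_cls[OF c])
    also have "\<dots> = r \<odot>\<^bsub>Hom_module R N ?HJ\<^esub> psi A"
      unfolding f(2) psi_cls[OF f(1)] Hom_module_simps
      by (rule restrict_ext) (use J.cohomology_smult[OF r fx] in simp)
    finally show ?thesis .
  qed
  fix B assume "B \<in> carrier (cohomology H dH t)"
  then obtain g where g: "g \<in> H.cocycles t" "B = H.cls t g"
    by (auto simp: H.cohomology_carrier)
  have gx: "g x \<in> J.cocycles t" if "x \<in> carrier N" for x
    using g(1) that by (auto simp: H_cocycles_iff)
  have c: "f \<oplus>\<^bsub>H t\<^esub> g \<in> H.cocycles t"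
    by (rule H.C.submoduleE(5)[OF H.submodule_cocycles f(1) g(1)])
  have "psi (A \<oplus>\<^bsub>cohomology H dH t\<^esub> B) = (\<lambda>x\<in>carrier N. J.cls t ((f \<oplus>\<^bsub>H t\<^esub> g) x))"
    unfolding f(2) g(2) H.cohomology_add[OF f(1) g(1)] by (rule psi_cls[OF c])
  also have "\<dots> = psi A \<oplus>\<^bsub>Hom_module R N ?HJ\<^esub> psi B"
    unfolding f(2) g(2) psi_cls[OF f(1)] psi_cls[OF g(1)] Hom_module_simps
    by (rule restrict_ext) (use J.cohomology_add[OF fx gx] in simp)
  finally show "psi (A \<oplus>\<^bsub>cohomology H dH t\<^esub> B) = psi A \<oplus>\<^bsub>Hom_module R N ?HJ\<^esub> psi B" .
qed

text \<open>Equal images mean that the difference of two cocycles is pointwise a coboundary; by the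
  splitting in degree \<open>t\<close> it is then a coboundary of the Hom complex.\<close>

lemma psi_inj: "inj_on psi (carrier (cohomology H dH t))"
proof (rule inj_onI)
  fix A B assume "A \<in> carrier (cohomology H dH t)" "B \<in> carrier (cohomology H dH t)" and eq: "psi A = psi B"
  then obtain f g where f: "f \<in> H.cocycles t" "A = H.cls t f" and g: "g \<in> H.cocycles t" "B = H.cls t g"
    by (auto simp: H.cohomology_carrier)
  have c: "f \<in> carrier (H t)" "g \<in> carrier (H t)"
    using f g H.cocyclesD by blast+
  have "(f \<ominus>\<^bsub>H t\<^esub> g) x \<in> coboundaries J d t" if x: "x \<in> carrier N" for x
  proof -
    have fgx: "f x \<in> carrier (J t)" "g x \<in> carrier (J t)"
      using mod_hom_closed[OF H_carrier_hom x] c by blast+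
    have "J.cls t (f x) = J.cls t (g x)"
      using fun_cong[OF eq, of x] x unfolding f(2) g(2) psi_cls[OF f(1)] psi_cls[OF g(1)] by simp
    then have "f x \<ominus>\<^bsub>J t\<^esub> g x \<in> coboundaries J d t"
      using J.cls_eq_iff[OF fgx] by simp
    then show ?thesis
      using Hom_module_diff[OF modN mod c x] torsion_minus[OF fgx] by simp
  qed
  then have "f \<ominus>\<^bsub>H t\<^esub> g \<in> coboundaries H dH t"
    using H_coboundaries_iff[OF le_refl H.C.M.minus_closed[OF c]] by blast
  then show "A = B"
    using H.cls_eq_iff[OF c] f(2) g(2) by simp
qed

text \<open>Representatives of the classes \<open>\<phi> x\<close> chosen one by one are not linear
  in \<open>x\<close>. The projection \<open>p\<close> depends only on the class and stays in it, so
  applying \<open>p\<close> to them gives a linear lift.\<close>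

lemma psi_surj: "carrier (Hom_module R N (cohomology J d t)) \<subseteq> psi ` carrier (cohomology H dH t)"
proof
  fix \<phi> assume \<phi>: "\<phi> \<in> carrier (Hom_module R N (cohomology J d t))"
  note \<phi>h = Hom_module_memD(2)[OF \<phi>]
  have "t = 0 \<or> (\<exists>k \<sigma>. t = Suc k \<and> mod_hom R (J t) (J k) \<sigma> \<and> (\<forall>b\<in>coboundaries J d t. d k (\<sigma> b) = b))"
    using section_exists[of "t - 1"] exact by (cases t) auto
  then obtain p where p: "mod_hom R (J t) (J t) p" "\<And>b. b \<in> coboundaries J d t \<Longrightarrow> p b = \<zero>\<^bsub>J t\<^esub>"
    "\<And>x. x \<in> carrier (J t) \<Longrightarrow> x \<ominus>\<^bsub>J t\<^esub> p x \<in> coboundaries J d t"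
    by (rule projection_exists) blast
  note pc = mod_hom_closed[OF p(1)]
  have p_cong: "p y = p z" if "y \<in> J.cocycles t" "z \<in> J.cocycles t" "J.cls t y = J.cls t z" for y z
  proof -
    have c: "y \<in> carrier (J t)" "z \<in> carrier (J t)"
      using that J.cocyclesD by blast+
    have "y \<ominus>\<^bsub>J t\<^esub> z \<in> coboundaries J d t"
      using J.cls_eq_iff[OF c] that(3) by simp
    then have "p y \<ominus>\<^bsub>J t\<^esub> p z = \<zero>\<^bsub>J t\<^esub>"
      using p(2) mod_hom_minus[OF J.mod J.mod p(1) c] by metis
    then show ?thesis
      using J.C.minus_eq_zero_iff[OF pc[OF c(1)] pc[OF c(2)]] by metis
  qed
  have p_cls: "J.cls t (p z) = J.cls t z" "p z \<in> J.cocycles t" if z: "z \<in> J.cocycles t" for z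
  proof -
    have c: "z \<in> carrier (J t)"
      using z J.cocyclesD by blast
    show "J.cls t (p z) = J.cls t z"
      using J.cls_eq_iff[OF c pc[OF c]] p(3)[OF c] by simp
    have "z \<ominus>\<^bsub>J t\<^esub> (z \<ominus>\<^bsub>J t\<^esub> p z) \<in> J.cocycles t"
      by (rule J.C.submodule_diff[OF J.submodule_cocycles z subsetD[OF J.coboundaries_subset p(3)[OF c]]])
    then show "p z \<in> J.cocycles t"
      using J.C.diff_diff_left[OF c pc[OF c]] by metis
  qed
  define rep where "rep x = (SOME z. z \<in> J.cocycles t \<and> J.cls t z = \<phi> x)" for x
  have rep: "rep x \<in> J.cocycles t" "J.cls t (rep x) = \<phi> x" if "x \<in> carrier N" for x
  proof -
    have "\<exists>z. z \<in> J.cocycles t \<and> J.cls t z = \<phi> x"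
      using mod_hom_closed[OF \<phi>h that] by (auto simp: J.cohomology_carrier)
    from someI_ex[OF this] show "rep x \<in> J.cocycles t" "J.cls t (rep x) = \<phi> x"
      unfolding rep_def by blast+
  qed
  have repc: "rep x \<in> carrier (J t)" if "x \<in> carrier N" for x
    using J.cocyclesD(1)[OF rep(1)[OF that]] .
  have "mod_hom R N (J t) (\<lambda>x. p (rep x))"
  proof (rule mod_homI)
    fix x assume x: "x \<in> carrier N"
    show "p (rep x) \<in> carrier (J t)"
      by (rule pc[OF repc[OF x]])
    show "p (rep (r \<odot>\<^bsub>N\<^esub> x)) = r \<odot>\<^bsub>J t\<^esub> p (rep x)" if r: "r \<in> carrier R" for r
    proof -
      have "J.cls t (rep (r \<odot>\<^bsub>N\<^esub> x)) = J.cls t (r \<odot>\<^bsub>J t\<^esub> rep x)"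
        using rep(2) x r N.smult_closed[OF r x] mod_hom_smult[OF \<phi>h r x]
          J.cohomology_smult[OF r rep(1)[OF x]] by simp
      then have "p (rep (r \<odot>\<^bsub>N\<^esub> x)) = p (r \<odot>\<^bsub>J t\<^esub> rep x)"
        by (intro p_cong rep J.C.submoduleE(4)[OF J.submodule_cocycles] r x N.smult_closed)
      then show ?thesis
        using mod_hom_smult[OF p(1) r repc[OF x]] by metis
    qed
    show "p (rep (x \<oplus>\<^bsub>N\<^esub> y)) = p (rep x) \<oplus>\<^bsub>J t\<^esub> p (rep y)" if y: "y \<in> carrier N" for y
    proof -
      have "J.cls t (rep (x \<oplus>\<^bsub>N\<^esub> y)) = J.cls t (rep x \<oplus>\<^bsub>J t\<^esub> rep y)"
        using rep(2) x y N.M.add.m_closed[OF x y] mod_hom_add[OF \<phi>h x y]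
          J.cohomology_add[OF rep(1)[OF x] rep(1)[OF y]] by simp
      then have "p (rep (x \<oplus>\<^bsub>N\<^esub> y)) = p (rep x \<oplus>\<^bsub>J t\<^esub> rep y)"
        by (intro p_cong rep J.C.submoduleE(5)[OF J.submodule_cocycles] y x N.M.add.m_closed)
      then show ?thesis
        using mod_hom_add[OF p(1) repc[OF x] repc[OF y]] by metis
    qed
  qed
  then have "mod_hom R N (E t) (\<lambda>x. p (rep x))"
    by (rule hom_from_torsion)
  then have f: "restrict (\<lambda>x. p (rep x)) (carrier N) \<in> H.cocycles t" (is "?f \<in> _")
    using p_cls(2)[OF rep(1)] by (simp add: H_cocycles_iff Hom_module_simps)
  have "psi (H.cls t ?f) = \<phi>"
    unfolding psi_cls[OF f]
    by (rule extensionalityI[OF _ Hom_module_memD(1)[OF \<phi>]])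
      (auto simp: p_cls(1)[OF rep(1)] rep(2))
  then show "\<phi> \<in> psi ` carrier (cohomology H dH t)"
    using f by (auto simp: H.cohomology_carrier)
qed

theorem psi_bij: "bij_betw psi (carrier (cohomology H dH t)) (carrier (Hom_module R N (cohomology J d t)))"
  using psi_inj psi_surj mod_hom_closed[OF psi_hom] by (auto simp: bij_betw_def)

end

section \<open>Direct limits\<close>

text \<open>The maps \<open>\<theta> n\<close> present the limit as a union of submodules of
  \<open>H\<close>. The class of a pair is then the fibre over its image in \<open>H\<close>, and
  the operations of \<open>dirlim\<close>, unions over representatives, become those of
  \<open>H\<close>.\<close>

lemma dirlim_mod_iso:
  fixes E :: "nat \<Rightarrow> ('a, 'e) module"
  assumes mod: "\<And>n. module R (E n)" and H: "module R H"
    and hom: "\<And>n. mod_hom R (E n) H (\<theta> n)" and inj: "\<And>n. inj_on (\<theta> n) (carrier (E n))"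
    and \<phi>: "\<And>m n x. m \<le> n \<Longrightarrow> x \<in> carrier (E m) \<Longrightarrow> \<phi> m n x \<in> carrier (E n)"
    and compat: "\<And>m n x. m \<le> n \<Longrightarrow> x \<in> carrier (E m) \<Longrightarrow> \<theta> n (\<phi> m n x) = \<theta> m x"
    and surj: "\<And>h. h \<in> carrier H \<Longrightarrow> \<exists>n. h \<in> \<theta> n ` carrier (E n)"
  shows "mod_iso R (dirlim E \<phi>) H"
proof -
  interpret H: plain_module R H by (rule plain_moduleI) (rule H)
  interpret E: plain_module R "E n" for n by (rule plain_moduleI) (rule mod)
  define K where "K h = {(n, x). x \<in> carrier (E n) \<and> \<theta> n x = h}" for h
  have rel: "((m, x), (n, y)) \<in> dirlim_rel E \<phi> \<longleftrightarrow>
      x \<in> carrier (E m) \<and> y \<in> carrier (E n) \<and> \<theta> m x = \<theta> n y" for m x n y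
  proof
    assume "((m, x), (n, y)) \<in> dirlim_rel E \<phi>"
    then obtain k where "x \<in> carrier (E m)" "y \<in> carrier (E n)" "m \<le> k" "n \<le> k" "\<phi> m k x = \<phi> n k y"
      by (auto simp: dirlim_rel_def)
    then show "x \<in> carrier (E m) \<and> y \<in> carrier (E n) \<and> \<theta> m x = \<theta> n y"
      using compat[of m k x] compat[of n k y] by simp
  next
    assume xy: "x \<in> carrier (E m) \<and> y \<in> carrier (E n) \<and> \<theta> m x = \<theta> n y"
    let ?k = "max m n"
    \<comment> \<open>Elements with the same image in \<open>H\<close> already agree at level
      \<open>max m n\<close>, by injectivity of \<open>\<theta>\<close> there.\<close>
    have "\<phi> m ?k x = \<phi> n ?k y"
      by (rule inj_onD[OF inj[of ?k]]) (use xy \<phi> compat in auto)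
    then show "((m, x), (n, y)) \<in> dirlim_rel E \<phi>"
      using xy by (auto simp: dirlim_rel_def intro!: exI[of _ ?k])
  qed
  have cls: "dirlim_rel E \<phi> `` {(n, x)} = K (\<theta> n x)" if "x \<in> carrier (E n)" for n x
    using that by (auto simp: K_def rel)
  have car: "carrier (dirlim E \<phi>) = K ` carrier H"
  proof
    show "carrier (dirlim E \<phi>) \<subseteq> K ` carrier H"
      using mod_hom_closed[OF hom] by (auto simp: dirlim_def quotient_def cls)
    show "K ` carrier H \<subseteq> carrier (dirlim E \<phi>)"
    proof
      fix A assume "A \<in> K ` carrier H"
      then obtain h where "h \<in> carrier H" "A = K h"
        by auto
      moreover from this surj obtain n x where "x \<in> carrier (E n)" "h = \<theta> n x"
        by blast
      ultimately have "A = dirlim_rel E \<phi> `` {(n, x)}" "x \<in> carrier (E n)"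
        using cls by simp_all
      then show "A \<in> carrier (dirlim E \<phi>)"
        by (auto simp: dirlim_def intro!: quotientI)
    qed
  qed
  have ne: "\<exists>p. p \<in> K h" if "h \<in> carrier H" for h
    using surj[OF that] by (auto simp: K_def)
  have union: "(\<Union>p\<in>K h. F p) = c" if "h \<in> carrier H" "\<And>p. p \<in> K h \<Longrightarrow> F p = c" for h F and c :: "(nat \<times> 'e) set"
    using ne[OF that(1)] that(2) by auto
  have add: "K h \<oplus>\<^bsub>dirlim E \<phi>\<^esub> K h' = K (h \<oplus>\<^bsub>H\<^esub> h')" if hh': "h \<in> carrier H" "h' \<in> carrier H" for h h'
  proof -
    let ?F = "\<lambda>m x n y. dirlim_rel E \<phi> `` {(max m n, \<phi> m (max m n) x \<oplus>\<^bsub>E (max m n)\<^esub> \<phi> n (max m n) y)}"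
    have F: "?F m x n y = K (h \<oplus>\<^bsub>H\<^esub> h')"
      if "(m, x) \<in> K h" "(n, y) \<in> K h'" for m x n y
    proof -
      have x: "x \<in> carrier (E m)" "\<theta> m x = h" and y: "y \<in> carrier (E n)" "\<theta> n y = h'"
        using that by (auto simp: K_def)
      let ?k = "max m n"
      have c: "\<phi> m ?k x \<in> carrier (E ?k)" "\<phi> n ?k y \<in> carrier (E ?k)"
        using \<phi> x(1) y(1) by auto
      have "\<theta> ?k (\<phi> m ?k x \<oplus>\<^bsub>E ?k\<^esub> \<phi> n ?k y) = h \<oplus>\<^bsub>H\<^esub> h'"
        using mod_hom_add[OF hom c] compat[OF max.cobounded1 x(1)] compat[OF max.cobounded2 y(1)] x(2) y(2)
        by simp
      then show ?thesis
        using cls[OF E.M.add.m_closed[OF c]] by simp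
    qed
    have F': "(\<Union>(n, y)\<in>K h'. ?F m x n y) = K (h \<oplus>\<^bsub>H\<^esub> h')" if mx: "(m, x) \<in> K h" for m x
    proof (rule union[OF hh'(2)])
      show "(case p of (n, y) \<Rightarrow> ?F m x n y) = K (h \<oplus>\<^bsub>H\<^esub> h')" if "p \<in> K h'" for p
        using that by (cases p) (simp only: prod.case F[OF mx])
    qed
    have "(\<Union>(m, x)\<in>K h. \<Union>(n, y)\<in>K h'. ?F m x n y) = K (h \<oplus>\<^bsub>H\<^esub> h')"
    proof (rule union[OF hh'(1)])
      show "(case p of (m, x) \<Rightarrow> \<Union>(n, y)\<in>K h'. ?F m x n y) = K (h \<oplus>\<^bsub>H\<^esub> h')" if "p \<in> K h" for p
        using that by (cases p) (simp only: prod.case F')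
    qed
    then show ?thesis
      by (simp add: dirlim_def)
  qed
  have smult: "r \<odot>\<^bsub>dirlim E \<phi>\<^esub> K h = K (r \<odot>\<^bsub>H\<^esub> h)" if r: "r \<in> carrier R" and h: "h \<in> carrier H" for r h
  proof -
    have F: "dirlim_rel E \<phi> `` {(n, r \<odot>\<^bsub>E n\<^esub> x)} = K (r \<odot>\<^bsub>H\<^esub> h)" if "(n, x) \<in> K h" for n x
    proof -
      have x: "x \<in> carrier (E n)" "\<theta> n x = h"
        using that by (auto simp: K_def)
      then show ?thesis
        using cls[OF E.smult_closed[OF r x(1)]] mod_hom_smult[OF hom r x(1)] by simp
    qed
    have "(\<Union>(n, x)\<in>K h. dirlim_rel E \<phi> `` {(n, r \<odot>\<^bsub>E n\<^esub> x)}) = K (r \<odot>\<^bsub>H\<^esub> h)"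
    proof (rule union[OF h])
      show "(case p of (n, x) \<Rightarrow> dirlim_rel E \<phi> `` {(n, r \<odot>\<^bsub>E n\<^esub> x)}) = K (r \<odot>\<^bsub>H\<^esub> h)" if "p \<in> K h" for p
        using that by (cases p) (simp only: prod.case F)
    qed
    then show ?thesis
      by (simp add: dirlim_def)
  qed
  have Kinj: "inj_on K (carrier H)"
  proof (rule inj_onI)
    fix h h' assume h: "h \<in> carrier H" "h' \<in> carrier H" "K h = K h'"
    then obtain p where "p \<in> K h" "p \<in> K h'"
      using ne by metis
    then show "h = h'"
      by (auto simp: K_def)
  qed
  let ?\<Theta> = "inv_into (carrier H) K"
  have "mod_hom R (dirlim E \<phi>) H ?\<Theta>"
  proof (rule mod_homI)
    fix A assume "A \<in> carrier (dirlim E \<phi>)"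
    then obtain h where h: "h \<in> carrier H" "A = K h"
      by (auto simp: car)
    then show "?\<Theta> A \<in> carrier H"
      using Kinj by simp
    show "?\<Theta> (r \<odot>\<^bsub>dirlim E \<phi>\<^esub> A) = r \<odot>\<^bsub>H\<^esub> ?\<Theta> A" if "r \<in> carrier R" for r
      using h that Kinj by (simp add: smult)
    fix B assume "B \<in> carrier (dirlim E \<phi>)"
    then obtain h' where "h' \<in> carrier H" "B = K h'"
      by (auto simp: car)
    with h show "?\<Theta> (A \<oplus>\<^bsub>dirlim E \<phi>\<^esub> B) = ?\<Theta> A \<oplus>\<^bsub>H\<^esub> ?\<Theta> B"
      using Kinj by (simp add: add)
  qed
  moreover have "bij_betw ?\<Theta> (carrier (dirlim E \<phi>)) (carrier H)"
    unfolding car by (rule bij_betw_inv_into) (use Kinj in \<open>simp add: bij_betw_def\<close>)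
  ultimately show ?thesis
    unfolding mod_iso_def by blast
qed

text \<open>Any two pairs meet at level \<open>max m n\<close>, where only zero is available; hence
  all pairs form a single class.\<close>

lemma dirlim_zero_module:
  assumes zero: "\<And>n. zero_module (E n)"
    and \<phi>: "\<And>m n x. m \<le> n \<Longrightarrow> x \<in> carrier (E m) \<Longrightarrow> \<phi> m n x \<in> carrier (E n)"
  shows "zero_module (dirlim E \<phi>)"
proof -
  have c: "carrier (E n) = {\<zero>\<^bsub>E n\<^esub>}" for n
    using zero by (simp add: zero_module_def)
  have "((m, x), (n, y)) \<in> dirlim_rel E \<phi>" if "x \<in> carrier (E m)" "y \<in> carrier (E n)" for m n x y
  proof -
    have "\<phi> m (max m n) x = \<phi> n (max m n) y"
      using \<phi>[of m "max m n" x] \<phi>[of n "max m n" y] that c[of "max m n"] by auto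
    then show ?thesis
      using that by (auto simp: dirlim_rel_def intro!: exI[of _ "max m n"])
  qed
  moreover have "dirlim_rel E \<phi> \<subseteq> (SIGMA n:UNIV. carrier (E n)) \<times> (SIGMA n:UNIV. carrier (E n))"
    by (auto simp: dirlim_rel_def)
  ultimately have cls: "dirlim_rel E \<phi> `` {p} = (SIGMA n:UNIV. carrier (E n))"
    if "p \<in> (SIGMA n:UNIV. carrier (E n))" for p
    using that by auto
  have "(SIGMA n:UNIV. carrier (E n)) \<noteq> {}"
    using c by auto
  then have "(SIGMA n:UNIV. carrier (E n)) // dirlim_rel E \<phi> = {SIGMA n:UNIV. carrier (E n)}"
    using cls by (auto simp: quotient_def)
  moreover have "dirlim_rel E \<phi> `` {(0, \<zero>\<^bsub>E 0\<^esub>)} = (SIGMA n:UNIV. carrier (E n))"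
    by (rule cls) (use c in auto)
  ultimately show ?thesis
    by (simp add: zero_module_def dirlim_def)
qed

section \<open>Factoring homomorphisms through quotients\<close>

lemma quot_hom_factor:
  assumes "module R M" "submodule P R M" "module R L" "mod_hom R M L g" "\<And>x. x \<in> P \<Longrightarrow> g x = \<zero>\<^bsub>L\<^esub>"
  obtains h where "mod_hom R (quot_module M P) L h" "\<And>x. x \<in> carrier M \<Longrightarrow> h (P +>\<^bsub>M\<^esub> x) = g x"
proof -
  interpret M: plain_module R M by (rule plain_moduleI) fact
  interpret L: plain_module R L by (rule plain_moduleI) fact
  define h where "h A = g (SOME x. x \<in> A)" for A
  have h: "h (P +>\<^bsub>M\<^esub> x) = g x" if x: "x \<in> carrier M" for x
  proof -
    let ?y = "SOME y. y \<in> P +>\<^bsub>M\<^esub> x"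
    have "?y \<in> P +>\<^bsub>M\<^esub> x"
      by (rule someI[of "\<lambda>y. y \<in> P +>\<^bsub>M\<^esub> x", OF M.self_in_coset[OF assms(2) x]])
    note y = M.coset_memD[OF assms(2) x this]
    then have "?y \<ominus>\<^bsub>M\<^esub> x \<in> P"
      using M.coset_eq_iff[OF assms(2) y(1) x] by simp
    then have "g ?y \<ominus>\<^bsub>L\<^esub> g x = \<zero>\<^bsub>L\<^esub>"
      using assms(5) mod_hom_minus[OF assms(1,3,4) y(1) x] by metis
    then show ?thesis
      using L.minus_eq_zero_iff[OF mod_hom_closed[OF assms(4) y(1)] mod_hom_closed[OF assms(4) x]]
      by (simp add: h_def)
  qed
  have "mod_hom R (quot_module M P) L h"
  proof (rule mod_homI)
    fix A assume "A \<in> carrier (quot_module M P)"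
    then obtain x where x: "x \<in> carrier M" "A = P +>\<^bsub>M\<^esub> x"
      by (auto simp: M.quot_carrier)
    show "h A \<in> carrier L"
      using mod_hom_closed[OF assms(4) x(1)] by (simp add: x h)
    show "h (r \<odot>\<^bsub>quot_module M P\<^esub> A) = r \<odot>\<^bsub>L\<^esub> h A" if "r \<in> carrier R" for r
      using that x(1) by (simp add: x(2) h M.quot_smult[OF assms(2)] mod_hom_smult[OF assms(4)])
    fix B assume "B \<in> carrier (quot_module M P)"
    then obtain y where y: "y \<in> carrier M" "B = P +>\<^bsub>M\<^esub> y"
      by (auto simp: M.quot_carrier)
    show "h (A \<oplus>\<^bsub>quot_module M P\<^esub> B) = h A \<oplus>\<^bsub>L\<^esub> h B"
      using x(1) y(1) by (simp add: x(2) y(2) h M.quot_add[OF assms(2)] mod_hom_add[OF assms(4)])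
  qed
  then show thesis
    using h by (rule that)
qed

lemma precompose_hom:
  assumes "module R M" "module R N" "module R L" "mod_hom R M N q"
  shows "mod_hom R (Hom_module R N L) (Hom_module R M L) (\<lambda>g. \<lambda>x\<in>carrier M. g (q x))"
proof (rule mod_homI)
  interpret M: plain_module R M by (rule plain_moduleI) fact
  note q = mod_hom_closed[OF assms(4)]
  fix g assume g: "g \<in> carrier (Hom_module R N L)"
  show "(\<lambda>x\<in>carrier M. g (q x)) \<in> carrier (Hom_module R M L)"
    using mod_hom_comp[OF assms(4) Hom_module_memD(2)[OF g]] by (simp add: Hom_module_simps)
qed (auto simp: Hom_module_simps mod_hom_closed[OF assms(4)] intro!: restrict_ext)

section \<open>The modules \<open>M/I\<^sup>n M\<close>\<close>

context plain_module
begin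

lemma ideal_smult_submodule:
  assumes "ideal K R"
  shows "submodule (ideal_smult R K M) R M"
  unfolding ideal_smult_def
  by (rule mod_span_submodule) (use ideal.Icarr[OF assms] in auto)

lemma ideal_smult_memI:
  assumes "r \<in> K" "x \<in> carrier M"
  shows "r \<odot>\<^bsub>M\<^esub> x \<in> ideal_smult R K M"
  unfolding ideal_smult_def by (rule subsetD[OF mod_span_superset]) (use assms in auto)

lemma ideal_smult_mono:
  assumes "ideal L R" "K \<subseteq> L"
  shows "ideal_smult R K M \<subseteq> ideal_smult R L M"
  unfolding ideal_smult_def[of R K]
  by (rule mod_span_least[OF ideal_smult_submodule[OF assms(1)]])
    (use assms(2) ideal_smult_memI in auto)

context
  fixes I assumes I: "ideal I R"
begin

lemma pow_submodule: "submodule (ideal_smult R (ideal_pow R I n) M) R M"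
  by (rule ideal_smult_submodule[OF R.ideal_pow_ideal[OF I]])

lemma pow_quot_is_module: "module R (pow_quot R I M n)"
  unfolding pow_quot_def by (rule quot_module_is_module[OF pow_submodule])

lemma pow_quot_killed:
  assumes "r \<in> ideal_pow R I n" "A \<in> carrier (pow_quot R I M n)"
  shows "r \<odot>\<^bsub>pow_quot R I M n\<^esub> A = \<zero>\<^bsub>pow_quot R I M n\<^esub>"
proof -
  let ?P = "ideal_smult R (ideal_pow R I n) M"
  obtain x where x: "x \<in> carrier M" "A = ?P +>\<^bsub>M\<^esub> x"
    using assms(2) by (auto simp: pow_quot_def quot_carrier)
  have r: "r \<in> carrier R"
    by (rule R.ideal_pow_carrier[OF I assms(1)])
  have "?P +>\<^bsub>M\<^esub> (r \<odot>\<^bsub>M\<^esub> x) = ?P +>\<^bsub>M\<^esub> \<zero>\<^bsub>M\<^esub>"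
    using coset_eq_iff[OF pow_submodule, of "r \<odot>\<^bsub>M\<^esub> x" "\<zero>\<^bsub>M\<^esub>"] ideal_smult_memI[OF assms(1) x(1)] r x(1)
    by (simp add: diff_zero)
  then show ?thesis
    by (simp only: pow_quot_def x(2) quot_smult[OF pow_submodule r x(1)] quot_zero[OF pow_submodule])
qed

lemma pow_quot_proj_coset:
  assumes "m \<le> n" "x \<in> carrier M"
  shows "pow_quot_proj R I M m (ideal_smult R (ideal_pow R I n) M +>\<^bsub>M\<^esub> x) =
    ideal_smult R (ideal_pow R I m) M +>\<^bsub>M\<^esub> x"
  unfolding pow_quot_proj_def
proof (rule Union_coset_eqI[OF pow_submodule assms(2)])
  fix y assume y: "y \<in> carrier M"
    "ideal_smult R (ideal_pow R I n) M +>\<^bsub>M\<^esub> y = ideal_smult R (ideal_pow R I n) M +>\<^bsub>M\<^esub> x"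
  then have "y \<ominus>\<^bsub>M\<^esub> x \<in> ideal_smult R (ideal_pow R I n) M"
    using coset_eq_iff[OF pow_submodule y(1) assms(2)] by simp
  then have "y \<ominus>\<^bsub>M\<^esub> x \<in> ideal_smult R (ideal_pow R I m) M"
    using ideal_smult_mono[OF R.ideal_pow_ideal[OF I] R.ideal_pow_antimono[OF I assms(1)]] by blast
  then show "ideal_smult R (ideal_pow R I m) M +>\<^bsub>M\<^esub> y = ideal_smult R (ideal_pow R I m) M +>\<^bsub>M\<^esub> x"
    using coset_eq_iff[OF pow_submodule y(1) assms(2)] by simp
qed

lemma pow_quot_proj_hom:
  assumes "m \<le> n"
  shows "mod_hom R (pow_quot R I M n) (pow_quot R I M m) (pow_quot_proj R I M m)"
proof (rule mod_homI)
  let ?P = "\<lambda>n. ideal_smult R (ideal_pow R I n) M"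
  note pr = pow_quot_proj_coset[OF assms]
  fix A assume "A \<in> carrier (pow_quot R I M n)"
  then obtain x where x: "x \<in> carrier M" "A = ?P n +>\<^bsub>M\<^esub> x"
    by (auto simp: pow_quot_def quot_carrier)
  show "pow_quot_proj R I M m A \<in> carrier (pow_quot R I M m)"
    using x(1) by (simp add: x(2) pr pow_quot_def quot_carrier)
  show "pow_quot_proj R I M m (r \<odot>\<^bsub>pow_quot R I M n\<^esub> A) = r \<odot>\<^bsub>pow_quot R I M m\<^esub> pow_quot_proj R I M m A"
    if "r \<in> carrier R" for r
    using x(1) that by (simp add: x(2) pow_quot_def quot_smult[OF pow_submodule] pr)
  fix B assume "B \<in> carrier (pow_quot R I M n)"
  then obtain y where y: "y \<in> carrier M" "B = ?P n +>\<^bsub>M\<^esub> y"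
    by (auto simp: pow_quot_def quot_carrier)
  show "pow_quot_proj R I M m (A \<oplus>\<^bsub>pow_quot R I M n\<^esub> B) =
      pow_quot_proj R I M m A \<oplus>\<^bsub>pow_quot R I M m\<^esub> pow_quot_proj R I M m B"
    using x(1) y(1) by (simp add: x(2) y(2) pow_quot_def quot_add[OF pow_submodule] pr)
qed

lemma hom_kills_pow:
  assumes "module R L" "mod_hom R M L g"
    and "\<And>r x. r \<in> ideal_pow R I n \<Longrightarrow> x \<in> carrier M \<Longrightarrow> r \<odot>\<^bsub>L\<^esub> g x = \<zero>\<^bsub>L\<^esub>"
    and "x \<in> ideal_smult R (ideal_pow R I n) M"
  shows "g x = \<zero>\<^bsub>L\<^esub>"
proof -
  have "ideal_smult R (ideal_pow R I n) M \<subseteq> {x \<in> carrier M. g x = \<zero>\<^bsub>L\<^esub>}"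
    unfolding ideal_smult_def
    by (rule mod_span_least[OF submodule_kernel[OF module_axioms assms(1,2)]])
      (use mod_hom_smult[OF assms(2)] assms(3) R.ideal_pow_carrier[OF I] in auto)
  then show ?thesis
    using assms(4) by auto
qed

text \<open>One exponent serves a finite set of generators. The elements whose image is killed by
  that power form a submodule, which is therefore all of M.\<close>

lemma fin_gen_hom_into_torsion:
  assumes "fin_gen_module R M" "module R L" "mod_hom R M L g"
    and tors: "\<And>y. y \<in> carrier L \<Longrightarrow> \<exists>n. \<forall>r\<in>ideal_pow R I n. r \<odot>\<^bsub>L\<^esub> y = \<zero>\<^bsub>L\<^esub>"
  obtains n where "\<And>r x. r \<in> ideal_pow R I n \<Longrightarrow> x \<in> carrier M \<Longrightarrow> r \<odot>\<^bsub>L\<^esub> g x = \<zero>\<^bsub>L\<^esub>"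
proof -
  interpret L: plain_module R L by (rule plain_moduleI) fact
  obtain A where A: "finite A" "A \<subseteq> carrier M" "mod_span R M A = carrier M"
    using assms(1) by (auto simp: fin_gen_module_def)
  define S where "S n = {x \<in> carrier M. \<forall>r\<in>ideal_pow R I n. r \<odot>\<^bsub>L\<^esub> g x = \<zero>\<^bsub>L\<^esub>}" for n
  have "\<exists>n. A \<subseteq> S n"
  proof (rule finite_subset_of_chain[OF A(1)])
    show "\<exists>n. a \<in> S n" if "a \<in> A" for a
      using tors[OF mod_hom_closed[OF assms(3)]] A(2) that unfolding S_def by blast
    show "S m \<subseteq> S n" if "m \<le> n" for m n
      using R.ideal_pow_antimono[OF I that] by (auto simp: S_def)
  qed
  then obtain n where n: "A \<subseteq> S n" ..
  have ann: "submodule {y \<in> carrier L. \<forall>r\<in>ideal_pow R I n. r \<odot>\<^bsub>L\<^esub> y = \<zero>\<^bsub>L\<^esub>} R L"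
    by (rule L.annihilator_ideal[OF R.ideal_pow_ideal[OF I]])
  have Sn: "x \<in> S n \<longleftrightarrow> x \<in> carrier M \<and> g x \<in> {y \<in> carrier L. \<forall>r\<in>ideal_pow R I n. r \<odot>\<^bsub>L\<^esub> y = \<zero>\<^bsub>L\<^esub>}" for x
    using mod_hom_closed[OF assms(3)] by (auto simp: S_def)
  have "submodule (S n) R M"
  proof (rule submodule_minusI)
    show "\<zero>\<^bsub>M\<^esub> \<in> S n"
      using L.submodule_zero[OF ann] mod_hom_zero[OF module_axioms assms(2,3)] by (simp add: Sn)
    show "a \<oplus>\<^bsub>M\<^esub> b \<in> S n" if "a \<in> S n" "b \<in> S n" for a b
      using L.submoduleE(5)[OF ann, of "g a" "g b"] that mod_hom_add[OF assms(3), of a b]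
      unfolding Sn by simp
    show "r \<odot>\<^bsub>M\<^esub> x \<in> S n" if "r \<in> carrier R" "x \<in> S n" for r x
      using L.submoduleE(4)[OF ann, of r "g x"] that mod_hom_smult[OF assms(3), of r x]
      unfolding Sn by simp
  qed (auto simp: S_def)
  then have "carrier M \<subseteq> S n"
    using mod_span_least[OF _ n] A(3) by simp
  then show thesis
    by (intro that[of n]) (auto simp: S_def)
qed

end

end

section \<open>Ext and local cohomology\<close>

context torsion_hom
begin

lemma compose_cocycle:
  assumes "torsion_hom R E d I N' t" "mod_hom R N' N u" "f \<in> H.cocycles i"
  shows "compose (carrier N') f u \<in>
    cochain_complex.cocycles (\<lambda>i. Hom_module R N' (E i)) (\<lambda>i. compose (carrier N') (d i)) i"
proof -
  interpret T: torsion_hom R E d I N' t by fact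
  interpret N': plain_module R N' by (rule plain_moduleI) (rule T.modN)
  have f: "f \<in> carrier (H i)" "\<forall>x\<in>carrier N. f x \<in> J.cocycles i"
    using assms(3) by (auto simp: H_cocycles_iff)
  have "mod_hom R N' (E i) (\<lambda>x. f (u x))"
    by (rule mod_hom_comp[OF assms(2) Hom_module_memD(2)[OF f(1)]])
  then show ?thesis
    using f(2) mod_hom_closed[OF assms(2)]
    by (auto simp: T.H_cocycles_iff Hom_module_simps compose_def)
qed

text \<open>\<open>B\<close> is the value of \<open>Ext_map\<close> at \<open>A\<close>, a union
  over all representatives. Each term has the same image under the injective map \<open>psi\<close>
  of N', namely \<open>psi A\<close> composed with \<open>u\<close>, so the union is a single
  class.\<close>

lemma psi_natural:
  assumes "torsion_hom R E d I N' t" "mod_hom R N' N u" "A \<in> carrier (cohomology H dH t)"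
  defines "B \<equiv> \<Union>f\<in>A. cochain_complex.cls (\<lambda>i. Hom_module R N' (E i))
    (\<lambda>i. compose (carrier N') (d i)) t (compose (carrier N') f u)"
  shows "B \<in> carrier (cohomology (\<lambda>i. Hom_module R N' (E i)) (\<lambda>i. compose (carrier N') (d i)) t)"
    "x \<in> carrier N' \<Longrightarrow> torsion_hom.psi R E d I N' t B x = psi A (u x)"
proof -
  interpret T: torsion_hom R E d I N' t by fact
  obtain f where f: "f \<in> H.cocycles t" "A = H.cls t f"
    using assms(3) by (auto simp: H.cohomology_carrier)
  let ?c = "\<lambda>g. compose (carrier N') g u"
  have psi: "T.psi (T.H.cls t (?c g)) = (\<lambda>x\<in>carrier N'. psi A (u x))" if g: "g \<in> A" for g
  proof -
    have gc: "g \<in> H.cocycles t" "H.cls t g = A"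
      using H.cls_memD[OF f(1)] g f(2) by auto
    have "T.psi (T.H.cls t (?c g)) = (\<lambda>x\<in>carrier N'. J.cls t (?c g x))"
      by (rule T.psi_cls[OF compose_cocycle[OF assms(1,2) gc(1)]])
    also have "\<dots> = (\<lambda>x\<in>carrier N'. psi A (u x))"
      unfolding gc(2)[symmetric] psi_cls[OF gc(1)]
      by (rule restrict_ext) (simp add: compose_def mod_hom_closed[OF assms(2)])
    finally show ?thesis .
  qed
  have mem: "T.H.cls t (?c g) \<in> carrier (cohomology T.H T.dH t)" if g: "g \<in> A" for g
    using compose_cocycle[OF assms(1,2) H.cls_memD(1)[OF f(1)]] g f(2)
    by (auto simp: T.H.cohomology_carrier)
  have fA: "f \<in> A"
    using H.self_in_cls[OF H.cocyclesD(1)[OF f(1)]] f(2) by simp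
  have "B = (\<Union>g\<in>A. T.H.cls t (?c f))"
    unfolding B_def
  proof (rule SUP_cong[OF refl])
    show "T.H.cls t (?c g) = T.H.cls t (?c f)" if "g \<in> A" for g
      by (rule inj_onD[OF T.psi_inj _ mem[OF that] mem[OF fA]]) (simp only: psi[OF that] psi[OF fA])
  qed
  then have B: "B = T.H.cls t (?c f)"
    using fA by auto
  show "B \<in> carrier (cohomology T.H T.dH t)"
    unfolding B by (rule mem[OF fA])
  show "T.psi B x = psi A (u x)" if "x \<in> carrier N'"
    unfolding B psi[OF fA] using that by simp
qed

text \<open>Below degree \<open>t\<close> the target is zero, so the union runs over copies of one
  class.\<close>

lemma Hom_cohomology_map_closed:
  assumes "torsion_hom R E d I N' t" "mod_hom R N' N u" "A \<in> carrier (cohomology H dH i)" "i < t"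
  shows "(\<Union>f\<in>A. cochain_complex.cls (\<lambda>i. Hom_module R N' (E i))
      (\<lambda>i. compose (carrier N') (d i)) i (compose (carrier N') f u))
    \<in> carrier (cohomology (\<lambda>i. Hom_module R N' (E i)) (\<lambda>i. compose (carrier N') (d i)) i)"
proof -
  interpret T: torsion_hom R E d I N' t by fact
  obtain f where f: "f \<in> H.cocycles i" "A = H.cls i f"
    using assms(3) by (auto simp: H.cohomology_carrier)
  let ?c = "\<lambda>g. compose (carrier N') g u" and ?z = "\<zero>\<^bsub>cohomology T.H T.dH i\<^esub>"
  have z: "carrier (cohomology T.H T.dH i) = {?z}"
    using T.Hom_cohomology_zero[OF assms(4)] by (simp add: zero_module_def)
  have "T.H.cls i (?c g) \<in> carrier (cohomology T.H T.dH i)" if "g \<in> A" for g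
    using compose_cocycle[OF assms(1,2) H.cls_memD(1)[OF f(1)]] that f(2)
    by (auto simp: T.H.cohomology_carrier)
  then have "(\<Union>g\<in>A. T.H.cls i (?c g)) = (\<Union>g\<in>A. ?z)"
    unfolding z by (intro SUP_cong[OF refl]) blast
  moreover have "A \<noteq> {}"
    using H.self_in_cls[OF H.cocyclesD(1)[OF f(1)]] f(2) by auto
  ultimately show ?thesis
    unfolding z by simp
qed

end

section \<open>The test module R/I and the equivalence of the two vanishing conditions\<close>

context baer_complex
begin

lemma cohomology_J_torsion:
  assumes "y \<in> carrier (cohomology J d i)"
  shows "\<exists>n. \<forall>r\<in>ideal_pow R I n. r \<odot>\<^bsub>cohomology J d i\<^esub> y = \<zero>\<^bsub>cohomology J d i\<^esub>"
proof -
  obtain z where z: "z \<in> J.cocycles i" "y = J.cls i z"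
    using assms by (auto simp: J.cohomology_carrier)
  then obtain n where n: "\<forall>r\<in>ideal_pow R I n. r \<odot>\<^bsub>J i\<^esub> z = \<zero>\<^bsub>J i\<^esub>"
    using J.cocyclesD(1)[OF z(1)] by (auto simp: torsion_carrier)
  have "r \<odot>\<^bsub>cohomology J d i\<^esub> y = \<zero>\<^bsub>cohomology J d i\<^esub>" if "r \<in> ideal_pow R I n" for r
    using n that J.cohomology_smult[OF C.R.ideal_pow_carrier[OF I that] z(1)]
    by (simp add: z(2) J.cohomology_zero)
  then show ?thesis
    by blast
qed

lemma ideal_submodule: "submodule I R (ring_module R)"
proof -
  interpret A: plain_module R "ring_module R"
    by (rule plain_moduleI) (rule C.R.ring_module_is_module)
  show ?thesis
    by (rule A.submodule_minusI)
      (use ideal.Icarr[OF I] C.R.ideal_zero_closed[OF I] C.R.ideal_add_closed[OF I]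
        ideal.I_l_closed[OF I] in auto)
qed

lemma torsion_hom_quotient_ring:
  assumes "\<And>i. i < t \<Longrightarrow> J.cocycles i \<subseteq> coboundaries J d i"
  shows "torsion_hom R E d I (quot_module (ring_module R) I) t"
proof (intro torsion_hom.intro torsion_hom_axioms.intro)
  interpret A: plain_module R "ring_module R"
    by (rule plain_moduleI) (rule C.R.ring_module_is_module)
  let ?Q = "quot_module (ring_module R) I"
  show "baer_complex R E d I"
    by (rule baer_complex_axioms)
  show "module R ?Q"
    by (rule A.quot_module_is_module[OF ideal_submodule])
  have "r \<odot>\<^bsub>?Q\<^esub> x = \<zero>\<^bsub>?Q\<^esub>" if r: "r \<in> I" and x: "x \<in> carrier ?Q" for r x
  proof -
    have rc: "r \<in> carrier R"
      by (rule ideal.Icarr[OF I r])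
    obtain s where s: "s \<in> carrier R" "x = I +>\<^bsub>ring_module R\<^esub> s"
      using x by (auto simp: A.quot_carrier)
    have "I +>\<^bsub>ring_module R\<^esub> (r \<otimes>\<^bsub>R\<^esub> s) = I +>\<^bsub>ring_module R\<^esub> \<zero>\<^bsub>R\<^esub>"
      using A.coset_eq_iff[OF ideal_submodule, of "r \<otimes>\<^bsub>R\<^esub> s" "\<zero>\<^bsub>R\<^esub>"] A.diff_zero[of "r \<otimes>\<^bsub>R\<^esub> s"]
        ideal.I_r_closed[OF I r s(1)] rc s(1) by simp
    then show ?thesis
      using A.quot_smult[OF ideal_submodule, of r s] A.quot_zero[OF ideal_submodule] rc s by simp
  qed
  then show "\<exists>k. \<forall>r\<in>ideal_pow R I k. \<forall>x\<in>carrier ?Q. r \<odot>\<^bsub>?Q\<^esub> x = \<zero>\<^bsub>?Q\<^esub>"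
    using C.R.ideal_pow_1[OF I] by (intro exI[of _ 1]) simp
qed (rule assms)

text \<open>Let the power \<open>k + 1\<close> be the first to kill \<open>y\<close>. Some multiple
  of \<open>y\<close> by an element of the k-th power is nonzero, and I kills it.\<close>

lemma torsion_socle:
  fixes L :: "('a, 'l) module"
  assumes "module R L" "y \<in> carrier L" "y \<noteq> \<zero>\<^bsub>L\<^esub>" "\<exists>n. \<forall>r\<in>ideal_pow R I n. r \<odot>\<^bsub>L\<^esub> y = \<zero>\<^bsub>L\<^esub>"
  obtains z where "z \<in> carrier L" "z \<noteq> \<zero>\<^bsub>L\<^esub>" "\<And>r. r \<in> I \<Longrightarrow> r \<odot>\<^bsub>L\<^esub> z = \<zero>\<^bsub>L\<^esub>"
proof -
  interpret L: plain_module R L by (rule plain_moduleI) fact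
  define P where "P n \<longleftrightarrow> (\<forall>r\<in>ideal_pow R I n. r \<odot>\<^bsub>L\<^esub> y = \<zero>\<^bsub>L\<^esub>)" for n
  have "\<exists>n. P n"
    using assms(4) by (simp add: P_def)
  \<comment> \<open>The zeroth power is R and contains one, so it cannot kill a nonzero
    element.\<close>
  moreover have "\<not> P 0"
    using assms(2,3) L.smult_one[OF assms(2)] by (auto simp: P_def intro!: bexI[OF _ C.R.one_closed])
  ultimately obtain k where k: "\<not> P k" "P (Suc k)"
    using ex_least_nat_less[of P] by (metis order_refl)
  then obtain r where r: "r \<in> ideal_pow R I k" "r \<odot>\<^bsub>L\<^esub> y \<noteq> \<zero>\<^bsub>L\<^esub>"
    by (auto simp: P_def)
  have rc: "r \<in> carrier R"
    by (rule C.R.ideal_pow_carrier[OF I r(1)])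
  have "s \<odot>\<^bsub>L\<^esub> (r \<odot>\<^bsub>L\<^esub> y) = \<zero>\<^bsub>L\<^esub>" if s: "s \<in> I" for s
  proof -
    have sc: "s \<in> carrier R"
      by (rule ideal.Icarr[OF I s])
    have "r \<otimes>\<^bsub>R\<^esub> s \<in> ideal_pow R I (Suc k)"
      unfolding ideal_pow_Suc by (rule ideal_prod.prod[OF r(1) s])
    then have "(r \<otimes>\<^bsub>R\<^esub> s) \<odot>\<^bsub>L\<^esub> y = \<zero>\<^bsub>L\<^esub>"
      using k(2) by (simp add: P_def)
    then show ?thesis
      using L.smult_assoc1[OF sc rc assms(2)] C.R.m_comm[OF rc sc] by simp
  qed
  then show thesis
    using r(2) rc assms(2) by (intro that[of "r \<odot>\<^bsub>L\<^esub> y"]) auto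
qed

text \<open>In the first unsettled degree \<open>psi\<close> identifies the vanishing Ext module
  with the homomorphisms from R/I to the cohomology of \<open>J\<close>. That cohomology is torsion;
  were it nonzero, an element killed by I would define a nonzero such homomorphism.\<close>

lemma exact_of_Ext_quotient_ring:
  assumes "\<And>i. i < t \<Longrightarrow> zero_module (cohomology (\<lambda>i. Hom_module R (quot_module (ring_module R) I) (E i))
      (\<lambda>i. compose (carrier (quot_module (ring_module R) I)) (d i)) i)"
  shows "i < t \<Longrightarrow> J.cocycles i \<subseteq> coboundaries J d i"
proof (induct i rule: less_induct)
  case (less i)
  interpret A: plain_module R "ring_module R"
    by (rule plain_moduleI) (rule C.R.ring_module_is_module)
  let ?Q = "quot_module (ring_module R) I" and ?L = "cohomology J d i"
  \<comment> \<open>The locale is taken with \<open>i\<close> in place of \<open>t\<close>: the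
    induction hypothesis gives exactness below \<open>i\<close>, and \<open>psi\<close> becomes
    available in degree \<open>i\<close> itself.\<close>
  interpret T: torsion_hom R E d I ?Q i
    by (rule torsion_hom_quotient_ring) (use less in auto)
  have L: "module R ?L"
    by (rule J.cohomology_is_module)
  interpret L: plain_module R ?L by (rule plain_moduleI) (rule L)
  interpret H: plain_module R "Hom_module R ?Q ?L"
    by (rule plain_moduleI) (rule Hom_module_is_module[OF T.modN L])
  have "carrier (cohomology T.H T.dH i) = {\<zero>\<^bsub>cohomology T.H T.dH i\<^esub>}"
    using assms[OF less(2)] by (simp add: zero_module_def)
  then have "carrier (Hom_module R ?Q ?L) = {T.psi \<zero>\<^bsub>cohomology T.H T.dH i\<^esub>}"
    using T.psi_bij by (auto simp: bij_betw_def)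
  then have Hom0: "\<phi> = \<zero>\<^bsub>Hom_module R ?Q ?L\<^esub>" if "\<phi> \<in> carrier (Hom_module R ?Q ?L)" for \<phi>
    using that H.M.zero_closed by auto
  have "y = \<zero>\<^bsub>?L\<^esub>" if y: "y \<in> carrier ?L" for y
  proof (rule ccontr)
    assume "y \<noteq> \<zero>\<^bsub>?L\<^esub>"
    then obtain z where z: "z \<in> carrier ?L" "z \<noteq> \<zero>\<^bsub>?L\<^esub>" "\<And>r. r \<in> I \<Longrightarrow> r \<odot>\<^bsub>?L\<^esub> z = \<zero>\<^bsub>?L\<^esub>"
      using torsion_socle[OF L y _ cohomology_J_torsion[OF y]] by blast
    have "mod_hom R (ring_module R) ?L (\<lambda>r. r \<odot>\<^bsub>?L\<^esub> z)"
      by (rule mod_homI) (use z(1) in \<open>auto simp: L.smult_l_distr L.smult_assoc1\<close>)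
    then obtain h where h: "mod_hom R ?Q ?L h"
      "\<And>x. x \<in> carrier (ring_module R) \<Longrightarrow> h (I +>\<^bsub>ring_module R\<^esub> x) = x \<odot>\<^bsub>?L\<^esub> z"
      by (rule quot_hom_factor[OF A.module_axioms ideal_submodule L _ z(3)]) blast+
    let ?h = "restrict h (carrier ?Q)"
    interpret Q: plain_module R ?Q by (rule plain_moduleI) (rule T.modN)
    have "?h \<in> carrier (Hom_module R ?Q ?L)"
      using h(1) by (simp add: Hom_module_simps)
    then have eq: "?h = \<zero>\<^bsub>Hom_module R ?Q ?L\<^esub>"
      by (rule Hom0)
    have "I +>\<^bsub>ring_module R\<^esub> \<one>\<^bsub>R\<^esub> \<in> carrier ?Q"
      by (simp add: A.quot_carrier)
    then have "h (I +>\<^bsub>ring_module R\<^esub> \<one>\<^bsub>R\<^esub>) = \<zero>\<^bsub>?L\<^esub>"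
      using fun_cong[OF eq, of "I +>\<^bsub>ring_module R\<^esub> \<one>\<^bsub>R\<^esub>"] by (simp add: Hom_module_simps)
    then show False
      using h(2)[of "\<one>\<^bsub>R\<^esub>"] z(1,2) by simp
  qed
  then have "zero_module ?L"
    using L.M.zero_closed by (auto simp: zero_module_def)
  then show ?case
    by (simp add: J.zero_cohomology_iff)
qed

end

section \<open>Passage to the limit over the quotients of M by the powers of I\<close>

locale pow_quot_complex = baer_complex R E d I
  for R :: "('a, 'r) ring_scheme" and E :: "nat \<Rightarrow> ('a, 'i) module" and d I +
  fixes M :: "('a, 'm) module" and t :: nat
  assumes modM: "module R M" and fin_gen: "fin_gen_module R M"
    and exact: "i < t \<Longrightarrow> J.cocycles i \<subseteq> coboundaries J d i"
begin

interpretation M: plain_module R M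
  by (rule plain_moduleI) (rule modM)

abbreviation Q :: "nat \<Rightarrow> ('a, 'm set) module"
  where "Q n \<equiv> pow_quot R I M n"

abbreviation L :: "('a, 'i set) module"
  where "L \<equiv> cohomology J d t"

sublocale T: torsion_hom R E d I "Q n" t for n
proof (intro torsion_hom.intro torsion_hom_axioms.intro)
  show "baer_complex R E d I"
    by (rule baer_complex_axioms)
  show "module R (Q n)"
    by (rule M.pow_quot_is_module[OF I])
  show "\<exists>k. \<forall>r\<in>ideal_pow R I k. \<forall>x\<in>carrier (Q n). r \<odot>\<^bsub>Q n\<^esub> x = \<zero>\<^bsub>Q n\<^esub>"
    using M.pow_quot_killed[OF I] by blast
qed (rule exact)

definition transition :: "nat \<Rightarrow> nat \<Rightarrow> nat \<Rightarrow> ('m set \<Rightarrow> 'i) set \<Rightarrow> ('m set \<Rightarrow> 'i) set"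
  where "transition i m n A =
    (\<Union>f\<in>A. T.H.cls n i (compose (carrier (Q n)) f (pow_quot_proj R I M m)))"

lemma dirlim_Ext_zero:
  assumes "i < t"
  shows "zero_module (dirlim (\<lambda>n. cohomology (T.H n) (T.dH n) i) (transition i))"
proof (rule dirlim_zero_module)
  show "zero_module (cohomology (T.H n) (T.dH n) i)" for n
    by (rule T.Hom_cohomology_zero[OF assms])
  show "transition i m n A \<in> carrier (cohomology (T.H n) (T.dH n) i)"
    if "m \<le> n" "A \<in> carrier (cohomology (T.H m) (T.dH m) i)" for m n A
    unfolding transition_def
    by (rule T.Hom_cohomology_map_closed[OF T.torsion_hom_axioms M.pow_quot_proj_hom[OF I that(1)] that(2) assms])
qed

text \<open>Each level maps to the homomorphisms from M by \<open>psi\<close> followed by pullback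
  along the projection of M onto its quotient. This is injective because \<open>psi\<close> is and
  the projection is surjective; naturality of \<open>psi\<close> gives compatibility, and finite
  generation of M gives joint surjectivity.\<close>

theorem dirlim_Ext_iso:
  "mod_iso R (dirlim (\<lambda>n. cohomology (T.H n) (T.dH n) t) (transition t)) (Hom_module R M L)"
proof -
  let ?P = "\<lambda>n. ideal_smult R (ideal_pow R I n) M"
  let ?q = "\<lambda>n x. ?P n +>\<^bsub>M\<^esub> x"
  define \<theta> where "\<theta> n A = (\<lambda>x\<in>carrier M. T.psi n A (?q n x))" for n A
  have Lmod: "module R L"
    by (rule J.cohomology_is_module)
  have q: "mod_hom R M (Q n) (?q n)" for n
    unfolding pow_quot_def by (rule M.quot_proj_hom[OF M.pow_submodule[OF I]])
  have q_surj: "carrier (Q n) = ?q n ` carrier M" for n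
    by (simp add: pow_quot_def M.quot_carrier)
  have psi_mem: "T.psi n A \<in> carrier (Hom_module R (Q n) L)"
    if "A \<in> carrier (cohomology (T.H n) (T.dH n) t)" for n A
    by (rule mod_hom_closed[OF T.psi_hom that])
  show ?thesis
  proof (rule dirlim_mod_iso[where \<theta> = \<theta>])
    show "module R (cohomology (T.H n) (T.dH n) t)" for n
      by (rule T.H.cohomology_is_module)
    show "module R (Hom_module R M L)"
      by (rule Hom_module_is_module[OF modM Lmod])
    show "mod_hom R (cohomology (T.H n) (T.dH n) t) (Hom_module R M L) (\<theta> n)" for n
      unfolding \<theta>_def by (rule mod_hom_comp[OF T.psi_hom precompose_hom[OF modM T.modN Lmod q]])
    show "inj_on (\<theta> n) (carrier (cohomology (T.H n) (T.dH n) t))" for n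
    proof (rule inj_onI)
      fix A B assume AB: "A \<in> carrier (cohomology (T.H n) (T.dH n) t)"
        "B \<in> carrier (cohomology (T.H n) (T.dH n) t)" "\<theta> n A = \<theta> n B"
      have "T.psi n A y = T.psi n B y" if y: "y \<in> carrier (Q n)" for y
      proof -
        obtain x where "x \<in> carrier M" "y = ?q n x"
          using y q_surj by auto
        then show ?thesis
          using fun_cong[OF AB(3), of x] by (simp add: \<theta>_def)
      qed
      then have "T.psi n A = T.psi n B"
        by (rule extensionalityI[OF Hom_module_memD(1)[OF psi_mem[OF AB(1)]]
            Hom_module_memD(1)[OF psi_mem[OF AB(2)]]])
      then show "A = B"
        using inj_onD[OF T.psi_inj] AB(1,2) by blast
    qed
    fix m n A assume mn: "m \<le> n" and A: "A \<in> carrier (cohomology (T.H m) (T.dH m) t)"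
    note nat = T.psi_natural[OF T.torsion_hom_axioms M.pow_quot_proj_hom[OF I mn] A, folded transition_def]
    show "transition t m n A \<in> carrier (cohomology (T.H n) (T.dH n) t)"
      by (rule nat(1))
    show "\<theta> n (transition t m n A) = \<theta> m A"
      unfolding \<theta>_def
    proof (rule restrict_ext)
      fix x assume x: "x \<in> carrier M"
      show "T.psi n (transition t m n A) (?q n x) = T.psi m A (?q m x)"
        using nat(2)[OF mod_hom_closed[OF q x]] M.pow_quot_proj_coset[OF I mn x] by simp
    qed
  next
    fix g assume g: "g \<in> carrier (Hom_module R M L)"
    note gh = Hom_module_memD(2)[OF g]
    \<comment> \<open>The level at which \<open>g\<close> appears: the n-th power kills its image,
      so \<open>g\<close> vanishes on the corresponding submodule of M and factors through
      \<open>Q n\<close>.\<close>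
    obtain n where n: "\<And>r x. r \<in> ideal_pow R I n \<Longrightarrow> x \<in> carrier M \<Longrightarrow> r \<odot>\<^bsub>L\<^esub> g x = \<zero>\<^bsub>L\<^esub>"
      by (rule M.fin_gen_hom_into_torsion[OF I fin_gen Lmod gh cohomology_J_torsion], assumption) (rule that)
    obtain h where h: "mod_hom R (Q n) L h" "\<And>x. x \<in> carrier M \<Longrightarrow> h (?q n x) = g x"
      unfolding pow_quot_def
      by (rule quot_hom_factor[OF modM M.pow_submodule[OF I] Lmod gh
          M.hom_kills_pow[OF I Lmod gh n]]) blast+
    interpret Qn: plain_module R "Q n"
      by (rule plain_moduleI) (rule T.modN)
    have "restrict h (carrier (Q n)) \<in> carrier (Hom_module R (Q n) L)"
      using h(1) by (simp add: Hom_module_simps)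
    then obtain A where A: "A \<in> carrier (cohomology (T.H n) (T.dH n) t)"
      "restrict h (carrier (Q n)) = T.psi n A"
      using T.psi_surj by blast
    have "\<theta> n A = g"
      unfolding \<theta>_def A(2)[symmetric]
      by (rule extensionalityI[OF _ Hom_module_memD(1)[OF g]])
        (auto simp: h(2) mod_hom_closed[OF q])
    then show "\<exists>n. g \<in> \<theta> n ` carrier (cohomology (T.H n) (T.dH n) t)"
      using A(1) by blast
  qed
qed

end

lemma Hom_complex_eq:
  "Hom_complex R N X = (\<lambda>i. Hom_module R N (fst (inj_res R X) i))"
  by (intro ext) (simp add: Hom_complex_def)

lemma Hom_diff_eq:
  "Hom_diff R N X = (\<lambda>i. compose (carrier N) (snd (inj_res R X) i))"
  by (intro ext) (simp add: Hom_diff_def)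

theorem proposition2p3:
  fixes R :: "('a, 'r) ring_scheme"
    and \<aa> :: "'a set"
    and M :: "('a, 'm) module"
    and X :: "('a, 'x) module"
    and t :: nat
  assumes "cring R" and "noetherian_ring R"
    and "ideal \<aa> R"
    and "module R M" and "fin_gen_module R M"
    and "module R X"
    and "0 < t"
  shows
    "((\<forall>i<t. zero_module (local_cohomology R \<aa> i X)) \<longleftrightarrow>
      (\<forall>i<t. zero_module (Ext R i (quot_module (ring_module R) \<aa>) X)))
     \<and>
     ((\<forall>i<t. zero_module (local_cohomology R \<aa> i X)) \<or>
      (\<forall>i<t. zero_module (Ext R i (quot_module (ring_module R) \<aa>) X))
      \<longrightarrow>
      (\<forall>i<t. zero_module (gen_local_cohomology R \<aa> i M X)) \<and>
      mod_iso R (gen_local_cohomology R \<aa> t M X)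
                (Hom_module R M (local_cohomology R \<aa> t X)) \<and>
      mod_iso R (Ext R t (quot_module (ring_module R) \<aa>) X)
                (Hom_module R (quot_module (ring_module R) \<aa>) (local_cohomology R \<aa> t X)))"
proof -
  let ?E = "fst (inj_res R X)" and ?d = "snd (inj_res R X)" and ?Q = "quot_module (ring_module R) \<aa>"
  note res = inj_res_baer[OF assms(1,2,6)]
  interpret B: baer_complex R ?E ?d \<aa>
    by (intro baer_complex.intro cochain_complex.intro baer_complex_axioms.intro
        res(1)[unfolded baer_module_def, THEN conjunct1] res assms(1-3))
  have lc: "local_cohomology R \<aa> i X = cohomology B.J ?d i" for i
    by (simp add: local_cohomology_def)
  have ExtQ: "Ext R i ?Q X =
      cohomology (\<lambda>i. Hom_module R ?Q (?E i)) (\<lambda>i. compose (carrier ?Q) (?d i)) i" for i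
    by (simp only: Ext_def Hom_complex_eq Hom_diff_eq)
  have exact_iff: "(\<forall>i<t. zero_module (local_cohomology R \<aa> i X)) \<longleftrightarrow>
      (\<forall>i<t. B.J.cocycles i \<subseteq> coboundaries B.J ?d i)"
    by (simp only: lc B.J.zero_cohomology_iff)
  have ab: "\<forall>i<t. zero_module (Ext R i ?Q X)" if "\<forall>i<t. B.J.cocycles i \<subseteq> coboundaries B.J ?d i"
  proof -
    interpret T: torsion_hom R ?E ?d \<aa> ?Q t
      by (rule B.torsion_hom_quotient_ring) (use that in blast)
    show ?thesis
      using T.Hom_cohomology_zero by (simp only: ExtQ) blast
  qed
  have ba: "\<forall>i<t. B.J.cocycles i \<subseteq> coboundaries B.J ?d i" if "\<forall>i<t. zero_module (Ext R i ?Q X)"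
    using B.exact_of_Ext_quotient_ring[of t] that unfolding ExtQ by blast
  have main: "(\<forall>i<t. zero_module (gen_local_cohomology R \<aa> i M X)) \<and>
      mod_iso R (gen_local_cohomology R \<aa> t M X) (Hom_module R M (local_cohomology R \<aa> t X)) \<and>
      mod_iso R (Ext R t ?Q X) (Hom_module R ?Q (local_cohomology R \<aa> t X))"
    if exact: "\<forall>i<t. B.J.cocycles i \<subseteq> coboundaries B.J ?d i"
  proof -
    interpret T: torsion_hom R ?E ?d \<aa> ?Q t
      by (rule B.torsion_hom_quotient_ring) (use exact in blast)
    interpret P: pow_quot_complex R ?E ?d \<aa> M t
      by (intro pow_quot_complex.intro pow_quot_complex_axioms.intro B.baer_complex_axioms assms(4,5))
        (use exact in blast)
    \<comment> \<open>The complexes, classes and transition maps of the locale have the shape of the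
      unfolded definitions, so this is an equality of records and not merely an isomorphism.\<close>
    have glc: "gen_local_cohomology R \<aa> i M X =
        dirlim (\<lambda>n. cohomology (P.T.H n) (P.T.dH n) i) (P.transition i)" for i
      unfolding gen_local_cohomology_def Ext_def Ext_map_def Hom_complex_eq Hom_diff_eq
        P.transition_def P.T.H.cls_def ..
    show ?thesis
      unfolding glc lc ExtQ mod_iso_def[of R "cohomology T.H T.dH t"]
      using P.dirlim_Ext_zero P.dirlim_Ext_iso T.psi_hom T.psi_bij by blast
  qed
  show ?thesis
    unfolding exact_iff using ab ba main by blast
qed

end
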